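(* Let $G$ be a finite group with a split $BN$-pair of characteristic $p$ satisfying the commutator relations, $k$ a field of characteristic different from $p$ which is a splitting field for all subgroups of $G$, and $\mathcal{L}'$ a set of Levi subgroups of $G$ as in the context. Let $(L,X)$ be a weakly cuspidal pair and let $M\in\mathcal{L}'$ with $L\le M$. Put $Y:=R_L^G(X)$, $Z:=R_L^M(X)$, $H_G:=\mathrm{End}_{kG}(Y)$, $H_M:=\mathrm{End}_{kM}(Z)$, $F_Y:=\mathrm{Hom}_{kG}(Y,-):kG\text{-mod}\to\text{mod-}H_G$ and $F_Z:=\mathrm{Hom}_{kM}(Z,-):kM\text{-mod}\to\text{mod-}H_M$. Then the functors $$\mathrm{Res}^{H_G}_{H_M}\circ F_Y\quad\text{and}\quad F_Z\circ{}^*\!R_M^G$$ from $kG\text{-mod}$ to $\text{mod-}H_M$ are naturally isomorphic.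
   Context: $\mathcal{L}$ denotes the set of $N$-conjugates of the standard Levi subgroups of $G$, and $\mathcal{L}'\subseteq\mathcal{L}$ is an $N$-stable subset containing $G$ and $B\cap N$ and such that $L_1\cap{}^x\!L_2\in\mathcal{L}'$ for all $L_1,L_2\in\mathcal{L}'$ and $x\in N$. For $M\in\mathcal{L}'$ put $\mathcal{L}'_M=\{L\in\mathcal{L}'\mid L\le M\}$. $R_L^G$ and ${}^*\!R_L^G$ are Harish-Chandra induction and restriction. A simple $kL$-module $X$ ($L\in\mathcal{L}'$) is weakly cuspidal with respect to $\mathcal{L}'_L$ if ${}^*\!R_{L_1}^L(X)=0$ for all $L_1\in\mathcal{L}'_L$ with $L_1\ne L$; then $(L,X)$ is called a weakly cuspidal pair. $kG\text{-mod}$ is the category of finite-dimensional left $kG$-modules and $\text{mod-}A$ the category of finite-dimensional right $A$-modules; the endomorphism algebras act on the right of Hom-spaces by composition of maps. The functor $R_M^G$ gives a natural embedding $H_M\to\mathrm{End}_{kG}(R_M^G(Z))$, and since $R_M^G(Z)\cong Y$ this induces an embedding $H_M\to H_G$ and hence a restriction functor $\mathrm{Res}^{H_G}_{H_M}:\text{mod-}H_G\to\text{mod-}H_M$. *)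

theory Defs
  imports Complex_Main "HOL-Computational_Algebra.Primes" "HOL-Algebra.Multiplicative_Group"
begin

section \<open>Categories, functors, natural isomorphisms\<close>

record ('o, 'm) cat =
  Obj :: "'o set"
  Arr :: "'o \<Rightarrow> 'o \<Rightarrow> 'm set"
  Cmp :: "'o \<Rightarrow> 'o \<Rightarrow> 'o \<Rightarrow> 'm \<Rightarrow> 'm \<Rightarrow> 'm"
  Idn :: "'o \<Rightarrow> 'm"

text \<open>\<open>Cmp C a b c g f\<close> is the composite \<open>g f\<close> of \<open>f : a \<rightarrow> b\<close> and \<open>g : b \<rightarrow> c\<close>.\<close>

locale category =
  fixes C :: "('o, 'm) cat"
  assumes Idn_closed: "a \<in> Obj C \<Longrightarrow> Idn C a \<in> Arr C a a"
    and Cmp_closed: "\<lbrakk>a \<in> Obj C; b \<in> Obj C; c \<in> Obj C; f \<in> Arr C a b; g \<in> Arr C b c\<rbrakk>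
      \<Longrightarrow> Cmp C a b c g f \<in> Arr C a c"
    and Idn_right: "\<lbrakk>a \<in> Obj C; b \<in> Obj C; f \<in> Arr C a b\<rbrakk> \<Longrightarrow> Cmp C a a b f (Idn C a) = f"
    and Idn_left: "\<lbrakk>a \<in> Obj C; b \<in> Obj C; f \<in> Arr C a b\<rbrakk> \<Longrightarrow> Cmp C a b b (Idn C b) f = f"
    and Cmp_assoc: "\<lbrakk>a \<in> Obj C; b \<in> Obj C; c \<in> Obj C; d \<in> Obj C;
      f \<in> Arr C a b; g \<in> Arr C b c; h \<in> Arr C c d\<rbrakk>
      \<Longrightarrow> Cmp C a c d h (Cmp C a b c g f) = Cmp C a b d (Cmp C b c d h g) f"

record ('o1, 'm1, 'o2, 'm2) fctr =
  FObj :: "'o1 \<Rightarrow> 'o2"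
  FArr :: "'o1 \<Rightarrow> 'o1 \<Rightarrow> 'm1 \<Rightarrow> 'm2"

locale is_functor = C: category C + D: category D
  for C :: "('o1, 'm1) cat" and D :: "('o2, 'm2) cat" +
  fixes F :: "('o1, 'm1, 'o2, 'm2) fctr"
  assumes FObj_closed: "a \<in> Obj C \<Longrightarrow> FObj F a \<in> Obj D"
    and FArr_closed: "\<lbrakk>a \<in> Obj C; b \<in> Obj C; f \<in> Arr C a b\<rbrakk>
      \<Longrightarrow> FArr F a b f \<in> Arr D (FObj F a) (FObj F b)"
    and FArr_Idn: "a \<in> Obj C \<Longrightarrow> FArr F a a (Idn C a) = Idn D (FObj F a)"
    and FArr_Cmp: "\<lbrakk>a \<in> Obj C; b \<in> Obj C; c \<in> Obj C; f \<in> Arr C a b; g \<in> Arr C b c\<rbrakk>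
      \<Longrightarrow> FArr F a c (Cmp C a b c g f) =
        Cmp D (FObj F a) (FObj F b) (FObj F c) (FArr F b c g) (FArr F a b f)"

definition fctr_comp :: "('o2, 'm2, 'o3, 'm3) fctr \<Rightarrow> ('o1, 'm1, 'o2, 'm2) fctr
    \<Rightarrow> ('o1, 'm1, 'o3, 'm3) fctr"  (infixr \<open>\<circ>F\<close> 55)
  where "F' \<circ>F F = \<lparr>FObj = FObj F' \<circ> FObj F,
    FArr = (\<lambda>a b f. FArr F' (FObj F a) (FObj F b) (FArr F a b f))\<rparr>"

definition is_iso :: "('o, 'm) cat \<Rightarrow> 'o \<Rightarrow> 'o \<Rightarrow> 'm \<Rightarrow> bool"
  where "is_iso C a b f \<longleftrightarrow> f \<in> Arr C a b \<and>
    (\<exists>g \<in> Arr C b a. Cmp C a b a g f = Idn C a \<and> Cmp C b a b f g = Idn C b)"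

definition naturally_isomorphic :: "('o1, 'm1) cat \<Rightarrow> ('o2, 'm2) cat
    \<Rightarrow> ('o1, 'm1, 'o2, 'm2) fctr \<Rightarrow> ('o1, 'm1, 'o2, 'm2) fctr \<Rightarrow> bool"
  where "naturally_isomorphic C D F F' \<longleftrightarrow> is_functor C D F \<and> is_functor C D F' \<and>
    (\<exists>\<eta>. (\<forall>a \<in> Obj C. is_iso D (FObj F a) (FObj F' a) (\<eta> a)) \<and>
      (\<forall>a \<in> Obj C. \<forall>b \<in> Obj C. \<forall>f \<in> Arr C a b.
        Cmp D (FObj F a) (FObj F b) (FObj F' b) (\<eta> b) (FArr F a b f) =
        Cmp D (FObj F a) (FObj F' a) (FObj F' b) (FArr F' a b f) (\<eta> a)))"


section \<open>Modules for group algebras and right modules for algebras\<close>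

definition fin_dim :: "('k, 'c) ring_scheme \<Rightarrow> ('k, 'v, 'd) module_scheme \<Rightarrow> bool"
  where "fin_dim k V \<longleftrightarrow> (\<exists>E. finite E \<and> E \<subseteq> carrier V \<and>
    (\<forall>v \<in> carrier V. \<exists>c \<in> E \<rightarrow> carrier k. v = (\<Oplus>\<^bsub>V\<^esub>e \<in> E. c e \<odot>\<^bsub>V\<^esub> e)))"

definition lin_maps :: "('k, 'c) ring_scheme \<Rightarrow> ('k, 'v, 'd) module_scheme
    \<Rightarrow> ('k, 'w, 'e) module_scheme \<Rightarrow> ('v \<Rightarrow> 'w) set"
  where "lin_maps k V W = {f \<in> carrier V \<rightarrow>\<^sub>E carrier W.
    (\<forall>v \<in> carrier V. \<forall>v' \<in> carrier V. f (v \<oplus>\<^bsub>V\<^esub> v') = f v \<oplus>\<^bsub>W\<^esub> f v') \<and>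
    (\<forall>c \<in> carrier k. \<forall>v \<in> carrier V. f (c \<odot>\<^bsub>V\<^esub> v) = c \<odot>\<^bsub>W\<^esub> f v)}"

text \<open>
  A left \<open>kG\<close>-module is a \<open>k\<close>-vector space with a linear \<open>G\<close>-action. Of the library record
  \<open>module\<close> only the components of a vector space are used; its fields \<open>mult\<close> and \<open>one\<close> are
  irrelevant except when the record holds a \<open>k\<close>-algebra.
\<close>

record ('k, 'g, 'v) gmodule = "('k, 'v) module" +
  act :: "'g \<Rightarrow> 'v \<Rightarrow> 'v"

locale kG_module = module k V + group G
  for k :: "('k, 'c) ring_scheme" and G :: "('g, 'b) monoid_scheme"
    and V :: "('k, 'g, 'v) gmodule" +
  assumes fin_dim: "fin_dim k V"
    and act_closed: "\<lbrakk>g \<in> carrier G; v \<in> carrier V\<rbrakk> \<Longrightarrow> act V g v \<in> carrier V"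
    and act_add: "\<lbrakk>g \<in> carrier G; v \<in> carrier V; v' \<in> carrier V\<rbrakk>
      \<Longrightarrow> act V g (v \<oplus>\<^bsub>V\<^esub> v') = act V g v \<oplus>\<^bsub>V\<^esub> act V g v'"
    and act_smult: "\<lbrakk>g \<in> carrier G; c \<in> carrier k; v \<in> carrier V\<rbrakk>
      \<Longrightarrow> act V g (c \<odot>\<^bsub>V\<^esub> v) = c \<odot>\<^bsub>V\<^esub> act V g v"
    and act_one: "v \<in> carrier V \<Longrightarrow> act V \<one>\<^bsub>G\<^esub> v = v"
    and act_mult: "\<lbrakk>g \<in> carrier G; h \<in> carrier G; v \<in> carrier V\<rbrakk>
      \<Longrightarrow> act V (g \<otimes>\<^bsub>G\<^esub> h) v = act V g (act V h v)"

definition kG_hom :: "('k, 'c) ring_scheme \<Rightarrow> ('g, 'b) monoid_scheme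
    \<Rightarrow> ('k, 'g, 'v) gmodule \<Rightarrow> ('k, 'g, 'w) gmodule \<Rightarrow> ('v \<Rightarrow> 'w) set"
  where "kG_hom k G V W = {f \<in> lin_maps k V W.
    \<forall>g \<in> carrier G. \<forall>v \<in> carrier V. f (act V g v) = act W g (f v)}"

text \<open>The category of all \<open>kG\<close>-modules whose carrier is a set of elements of a given type \<open>'v\<close>.\<close>

definition kG_mod :: "('k, 'c) ring_scheme \<Rightarrow> ('g, 'b) monoid_scheme
    \<Rightarrow> (('k, 'g, 'v) gmodule, 'v \<Rightarrow> 'v) cat"
  where "kG_mod k G = \<lparr>Obj = {V. kG_module k G V}, Arr = kG_hom k G,
    Cmp = (\<lambda>U V W g f. compose (carrier U) g f), Idn = (\<lambda>V. restrict id (carrier V))\<rparr>"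

definition simple_kG_module :: "('k, 'c) ring_scheme \<Rightarrow> ('g, 'b) monoid_scheme
    \<Rightarrow> ('k, 'g, 'v) gmodule \<Rightarrow> bool"
  where "simple_kG_module k G V \<longleftrightarrow> kG_module k G V \<and> carrier V \<noteq> {\<zero>\<^bsub>V\<^esub>} \<and>
    (\<forall>W. submodule W k V \<and> (\<forall>g \<in> carrier G. \<forall>w \<in> W. act V g w \<in> W)
      \<longrightarrow> W = {\<zero>\<^bsub>V\<^esub>} \<or> W = carrier V)"

text \<open>
  Every simple module of a finite group \<open>G\<close> has dimension at most \<open>|G|\<close>, hence is isomorphic to
  one whose carrier is a set of functions from \<open>G\<close> to \<open>k\<close>; so nothing is lost by
  considering only modules over this type.
\<close>

definition splitting_field :: "('k, 'c) ring_scheme \<Rightarrow> ('g, 'b) monoid_scheme \<Rightarrow> bool"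
  where "splitting_field k G \<longleftrightarrow> (\<forall>V :: ('k, 'g, 'g \<Rightarrow> 'k) gmodule.
    simple_kG_module k G V \<longrightarrow>
    (\<forall>f \<in> kG_hom k G V V. \<exists>c \<in> carrier k. \<forall>v \<in> carrier V. f v = c \<odot>\<^bsub>V\<^esub> v))"

definition ring_char :: "('k, 'c) ring_scheme \<Rightarrow> nat"
  where "ring_char k = (if \<exists>n::nat > 0. [n] \<cdot>\<^bsub>k\<^esub> \<one>\<^bsub>k\<^esub> = \<zero>\<^bsub>k\<^esub>
    then LEAST n::nat. n > 0 \<and> [n] \<cdot>\<^bsub>k\<^esub> \<one>\<^bsub>k\<^esub> = \<zero>\<^bsub>k\<^esub> else 0)"

text \<open>A \<open>k\<close>-algebra, not necessarily commutative, is given by a record of type \<open>module\<close>.\<close>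

record ('k, 'a, 'v) rmodule = "('k, 'v) module" +
  ract :: "'v \<Rightarrow> 'a \<Rightarrow> 'v"

locale right_module = module k V
  for k :: "('k, 'c) ring_scheme" and A :: "('k, 'a) module"
    and V :: "('k, 'a, 'v) rmodule" +
  assumes fin_dim: "fin_dim k V"
    and ract_closed: "\<lbrakk>a \<in> carrier A; v \<in> carrier V\<rbrakk> \<Longrightarrow> ract V v a \<in> carrier V"
    and ract_add_left: "\<lbrakk>a \<in> carrier A; v \<in> carrier V; v' \<in> carrier V\<rbrakk>
      \<Longrightarrow> ract V (v \<oplus>\<^bsub>V\<^esub> v') a = ract V v a \<oplus>\<^bsub>V\<^esub> ract V v' a"
    and ract_add_right: "\<lbrakk>a \<in> carrier A; a' \<in> carrier A; v \<in> carrier V\<rbrakk>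
      \<Longrightarrow> ract V v (a \<oplus>\<^bsub>A\<^esub> a') = ract V v a \<oplus>\<^bsub>V\<^esub> ract V v a'"
    and ract_smult_left: "\<lbrakk>a \<in> carrier A; c \<in> carrier k; v \<in> carrier V\<rbrakk>
      \<Longrightarrow> ract V (c \<odot>\<^bsub>V\<^esub> v) a = c \<odot>\<^bsub>V\<^esub> ract V v a"
    and ract_smult_right: "\<lbrakk>a \<in> carrier A; c \<in> carrier k; v \<in> carrier V\<rbrakk>
      \<Longrightarrow> ract V v (c \<odot>\<^bsub>A\<^esub> a) = c \<odot>\<^bsub>V\<^esub> ract V v a"
    and ract_one: "v \<in> carrier V \<Longrightarrow> ract V v \<one>\<^bsub>A\<^esub> = v"
    and ract_mult: "\<lbrakk>a \<in> carrier A; b \<in> carrier A; v \<in> carrier V\<rbrakk>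
      \<Longrightarrow> ract V v (a \<otimes>\<^bsub>A\<^esub> b) = ract V (ract V v a) b"

definition rmod_hom :: "('k, 'c) ring_scheme \<Rightarrow> ('k, 'a) module
    \<Rightarrow> ('k, 'a, 'v) rmodule \<Rightarrow> ('k, 'a, 'w) rmodule \<Rightarrow> ('v \<Rightarrow> 'w) set"
  where "rmod_hom k A V W = {f \<in> lin_maps k V W.
    \<forall>a \<in> carrier A. \<forall>v \<in> carrier V. f (ract V v a) = ract W (f v) a}"

definition mod_cat :: "('k, 'c) ring_scheme \<Rightarrow> ('k, 'a) module
    \<Rightarrow> (('k, 'a, 'v) rmodule, 'v \<Rightarrow> 'v) cat"
  where "mod_cat k A = \<lparr>Obj = {V. right_module k A V}, Arr = rmod_hom k A,
    Cmp = (\<lambda>U V W g f. compose (carrier U) g f), Idn = (\<lambda>V. restrict id (carrier V))\<rparr>"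

definition End_alg :: "('k, 'c) ring_scheme \<Rightarrow> ('g, 'b) monoid_scheme
    \<Rightarrow> ('k, 'g, 'v) gmodule \<Rightarrow> ('k, 'v \<Rightarrow> 'v) module"
  where "End_alg k G Y = \<lparr>carrier = kG_hom k G Y Y,
    mult = compose (carrier Y),
    one = restrict id (carrier Y),
    zero = (\<lambda>y \<in> carrier Y. \<zero>\<^bsub>Y\<^esub>),
    add = (\<lambda>f f'. \<lambda>y \<in> carrier Y. f y \<oplus>\<^bsub>Y\<^esub> f' y),
    smult = (\<lambda>c f. \<lambda>y \<in> carrier Y. c \<odot>\<^bsub>Y\<^esub> f y)\<rparr>"

text \<open>The functor \<open>Hom(Y, -)\<close> from \<open>kG\<close>-modules to right modules for \<open>End(Y)\<close>.\<close>

definition Hom_functor :: "('k, 'c) ring_scheme \<Rightarrow> ('g, 'b) monoid_scheme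
    \<Rightarrow> ('k, 'g, 'y) gmodule
    \<Rightarrow> (('k, 'g, 'v) gmodule, 'v \<Rightarrow> 'v, ('k, 'y \<Rightarrow> 'y, 'y \<Rightarrow> 'v) rmodule,
        ('y \<Rightarrow> 'v) \<Rightarrow> ('y \<Rightarrow> 'v)) fctr"
  where "Hom_functor k G Y = \<lparr>
    FObj = (\<lambda>V. \<lparr>carrier = kG_hom k G Y V,
      mult = undefined, one = undefined,
      zero = (\<lambda>y \<in> carrier Y. \<zero>\<^bsub>V\<^esub>),
      add = (\<lambda>f f'. \<lambda>y \<in> carrier Y. f y \<oplus>\<^bsub>V\<^esub> f' y),
      smult = (\<lambda>c f. \<lambda>y \<in> carrier Y. c \<odot>\<^bsub>V\<^esub> f y),
      ract = (\<lambda>f h. compose (carrier Y) f h)\<rparr>),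
    FArr = (\<lambda>V W t. \<lambda>f \<in> kG_hom k G Y V. compose (carrier Y) t f)\<rparr>"

text \<open>Restriction of right modules along a homomorphism \<open>\<iota>\<close> of algebras.\<close>

definition Res_functor :: "('a \<Rightarrow> 'b)
    \<Rightarrow> (('k, 'b, 'v) rmodule, 'v \<Rightarrow> 'v, ('k, 'a, 'v) rmodule, 'v \<Rightarrow> 'v) fctr"
  where "Res_functor \<iota> = \<lparr>
    FObj = (\<lambda>V. \<lparr>carrier = carrier V, mult = monoid.mult V, one = monoid.one V, zero = ring.zero V,
      add = ring.add V, smult = smult V, ract = (\<lambda>v a. ract V v (\<iota> a))\<rparr>),
    FArr = (\<lambda>V W t. t)\<rparr>"


section \<open>Groups with a split BN-pair satisfying the commutator relations\<close>

abbreviation weyl_group :: "('g, 'b) monoid_scheme \<Rightarrow> 'g set \<Rightarrow> 'g set \<Rightarrow> 'g set monoid"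
  where "weyl_group G B N \<equiv> (G\<lparr>carrier := N\<rparr>) Mod (B \<inter> N)"

abbreviation conj_set :: "('g, 'b) monoid_scheme \<Rightarrow> 'g \<Rightarrow> 'g set \<Rightarrow> 'g set"
  where "conj_set G x A \<equiv> x <#\<^bsub>G\<^esub> A #>\<^bsub>G\<^esub> inv\<^bsub>G\<^esub> x"

text \<open>Elements of the Weyl group, in particular those of \<open>S\<close>, are cosets of \<open>B \<inter> N\<close> in \<open>N\<close>.\<close>

locale BN_pair = group G for G :: "('g, 'b) monoid_scheme" (structure) +
  fixes B N :: "'g set" and S :: "'g set set"
  assumes finite_G: "finite (carrier G)"
    and B_subgroup: "subgroup B G"
    and N_subgroup: "subgroup N G"
    and generate_BN: "generate G (B \<union> N) = carrier G"
    and normal_BN: "B \<inter> N \<lhd> G\<lparr>carrier := N\<rparr>"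
    and S_subset: "S \<subseteq> carrier (weyl_group G B N)"
    and generate_S: "generate (weyl_group G B N) S = carrier (weyl_group G B N)"
    and S_involution: "s \<in> S \<Longrightarrow> s \<noteq> \<one>\<^bsub>weyl_group G B N\<^esub> \<and>
      s \<otimes>\<^bsub>weyl_group G B N\<^esub> s = \<one>\<^bsub>weyl_group G B N\<^esub>"
    and exchange: "\<lbrakk>s \<in> S; n \<in> s; m \<in> N\<rbrakk> \<Longrightarrow>
      n <# B #> m \<subseteq> (B #> m <#> B) \<union> (B #> (n \<otimes> m) <#> B)"
    and conj_neq: "\<lbrakk>s \<in> S; n \<in> s\<rbrakk> \<Longrightarrow> conj_set G n B \<noteq> B"
begin

abbreviation W where "W \<equiv> weyl_group G B N"

definition word :: "'g set list \<Rightarrow> 'g set"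
  where "word ss = foldr (\<lambda>s w. s \<otimes>\<^bsub>W\<^esub> w) ss \<one>\<^bsub>W\<^esub>"

definition len :: "'g set \<Rightarrow> nat"
  where "len w = (LEAST n. \<exists>ss \<in> lists S. length ss = n \<and> word ss = w)"

definition longest :: "'g set"
  where "longest = (ARG_MAX len w. w \<in> carrier W)"

text \<open>
  The reflection representation of \<open>W\<close> on the real vector space with basis \<open>S\<close>; vectors are
  coordinate functions, \<open>simple_root s\<close> is the basis vector belonging to \<open>s\<close>, and the form has
  the value \<open>- cos (\<pi> / m)\<close> on two basis vectors \<open>s\<close>, \<open>t\<close>, where \<open>m\<close> is the order of \<open>s t\<close>.
\<close>

definition simple_root :: "'g set \<Rightarrow> ('g set \<Rightarrow> real)"
  where "simple_root s = (\<lambda>t. if t = s then 1 else 0)"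

definition cox_form :: "'g set \<Rightarrow> 'g set \<Rightarrow> real"
  where "cox_form s t = - cos (pi / real (group.ord W (s \<otimes>\<^bsub>W\<^esub> t)))"

definition reflection :: "'g set \<Rightarrow> ('g set \<Rightarrow> real) \<Rightarrow> ('g set \<Rightarrow> real)"
  where "reflection s v = (\<lambda>t. v t - 2 * (\<Sum>r \<in> S. cox_form s r * v r) * simple_root s t)"

text \<open>The image of the simple root of \<open>s\<close> under \<open>word ss\<close>.\<close>

definition root_of :: "'g set list \<Rightarrow> 'g set \<Rightarrow> ('g set \<Rightarrow> real)"
  where "root_of ss s = foldr reflection ss (simple_root s)"

definition roots :: "'g set set \<Rightarrow> ('g set \<Rightarrow> real) set"
  where "roots I = {root_of ss s | ss s. ss \<in> lists I \<and> s \<in> I}"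

text \<open>The preimage in \<open>N\<close> of the subgroup of \<open>W\<close> generated by \<open>I\<close>.\<close>

definition N_sub :: "'g set set \<Rightarrow> 'g set"
  where "N_sub I = \<Union> (generate W I)"

text \<open>
  For \<open>A\<close> normalized by \<open>B \<inter> N\<close> all representatives \<open>n\<close> of the coset \<open>w\<close> give the same conjugate.
\<close>

definition coset_conj :: "'g set \<Rightarrow> 'g set \<Rightarrow> 'g set"
  where "coset_conj w A = (\<Union>n \<in> w. conj_set G n A)"

end

locale split_BN_pair = BN_pair G B N S
  for G :: "('g, 'b) monoid_scheme" (structure) and B N S +
  fixes U :: "'g set" and p :: nat
  assumes prime_p: "prime p"
    and U_normal: "U \<lhd> G\<lparr>carrier := B\<rparr>"
    and U_p_group: "\<exists>n. card U = p ^ n"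
    and B_decomp: "B = U <#> (B \<inter> N)"
    and H_abelian: "\<lbrakk>x \<in> B \<inter> N; y \<in> B \<inter> N\<rbrakk> \<Longrightarrow> x \<otimes> y = y \<otimes> x"
    and H_p'_group: "\<not> p dvd card (B \<inter> N)"
    and saturated: "(\<Inter>n \<in> N. conj_set G n B) = B \<inter> N"
begin

text \<open>
  With \<open>w\<^sub>0\<close> the longest element, the root subgroup of a simple root \<open>s\<close> is the intersection of \<open>U\<close>
  with its conjugate by \<open>s w\<^sub>0\<close>; the root subgroup of \<open>w s\<close> is the \<open>w\<close>-conjugate of it. It
  depends only on the root, so that the union below is over copies of one and the same subgroup.
\<close>

definition simple_root_subgroup :: "'g set \<Rightarrow> 'g set"
  where "simple_root_subgroup s = U \<inter> coset_conj (s \<otimes>\<^bsub>W\<^esub> longest) U"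

definition root_subgroup :: "('g set \<Rightarrow> real) \<Rightarrow> 'g set"
  where "root_subgroup \<alpha> = \<Union> {coset_conj (word ss) (simple_root_subgroup s) | ss s.
    ss \<in> lists S \<and> s \<in> S \<and> root_of ss s = \<alpha>}"

text \<open>
  The roots are normalized to length one, so the coefficients \<open>i\<close> and \<open>j\<close> in the commutator
  relations are positive reals; this does not depend on how roots are scaled.
\<close>

definition commutator_relations :: bool
  where "commutator_relations \<longleftrightarrow> (\<forall>\<alpha> \<in> roots S. \<forall>\<beta> \<in> roots S. \<alpha> \<noteq> \<beta> \<and> \<alpha> \<noteq> (\<lambda>t. - \<beta> t) \<longrightarrow>
    (\<forall>x \<in> root_subgroup \<alpha>. \<forall>y \<in> root_subgroup \<beta>.
      x \<otimes> y \<otimes> inv x \<otimes> inv y \<in> generate G (\<Union> {root_subgroup \<gamma> | \<gamma>.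
        \<gamma> \<in> roots S \<and> (\<exists>i > 0. \<exists>j > 0. \<gamma> = (\<lambda>t. i * \<alpha> t + j * \<beta> t))})))"

definition std_levi :: "'g set set \<Rightarrow> 'g set"
  where "std_levi I = generate G ((B \<inter> N) \<union> (\<Union>\<alpha> \<in> roots I. root_subgroup \<alpha>))"

definition levis :: "'g set set"
  where "levis = {conj_set G n (std_levi I) | n I. n \<in> N \<and> I \<subseteq> S}"

text \<open>
  A Levi subgroup \<open>M\<close>, the \<open>n\<close>-conjugate of \<open>L\<^sub>J = std_levi J\<close>, has itself a split BN-pair,
  transported by \<open>n\<close> from the one of \<open>L\<^sub>J\<close> consisting of \<open>B \<inter> L\<^sub>J\<close> and \<open>N_sub J\<close>. Its parabolic
  subgroups are the \<open>N \<inter> M\<close>-conjugates of the standard ones, which correspond to subsets \<open>I\<close> of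
  \<open>J\<close>. Conjugation by \<open>N \<inter> M\<close> is covered by varying \<open>n\<close>. For \<open>M = G\<close> one has \<open>J = S\<close> and
  gets the \<open>N\<close>-conjugates of the subgroups \<open>B (N_sub I) B\<close>.
\<close>

definition parabolics :: "'g set \<Rightarrow> 'g set set"
  where "parabolics M = {conj_set G n ((B \<inter> std_levi J) <#> N_sub I <#> (B \<inter> std_levi J)) | n I J.
    n \<in> N \<and> I \<subseteq> J \<and> J \<subseteq> S \<and> M = conj_set G n (std_levi J)}"

end

locale split_BN_pair_comm = split_BN_pair +
  assumes commutator_relations: "commutator_relations"


section \<open>Harish-Chandra induction and restriction\<close>

text \<open>The largest normal \<open>p\<close>-subgroup; for a parabolic subgroup this is the unipotent radical.\<close>

definition p_core :: "('g, 'b) monoid_scheme \<Rightarrow> nat \<Rightarrow> 'g set \<Rightarrow> 'g set"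
  where "p_core G p P = generate G (\<Union> {A. A \<lhd> G\<lparr>carrier := P\<rparr> \<and> (\<exists>n. card A = p ^ n)})"

definition levi_complement :: "('g, 'b) monoid_scheme \<Rightarrow> nat \<Rightarrow> 'g set \<Rightarrow> 'g set \<Rightarrow> bool"
  where "levi_complement G p P L \<longleftrightarrow> subgroup L G \<and> L \<subseteq> P \<and>
    L \<inter> p_core G p P = {\<one>\<^bsub>G\<^esub>} \<and> L <#>\<^bsub>G\<^esub> p_core G p P = P"

text \<open>Inflation along the projection of \<open>P = L U\<^sub>P\<close> onto \<open>L\<close>.\<close>

definition inflate :: "('g, 'b) monoid_scheme \<Rightarrow> nat \<Rightarrow> 'g set \<Rightarrow> 'g set
    \<Rightarrow> ('k, 'g, 'v) gmodule \<Rightarrow> ('k, 'g, 'v) gmodule"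
  where "inflate G p P L X =
    X\<lparr>act := \<lambda>g. act X (THE l. l \<in> L \<and> g \<in> l <#\<^bsub>G\<^esub> p_core G p P)\<rparr>"

text \<open>
  The module induced from a subgroup \<open>P\<close> to \<open>G\<close>, realized on functions \<open>f\<close> with
  \<open>f (g q) = q\<^sup>-\<^sup>1 f (g)\<close> for \<open>q\<close> in \<open>P\<close>. The tensor \<open>g \<otimes> x\<close> corresponds to the function with
  support \<open>g P\<close> and value \<open>x\<close> at \<open>g\<close>.
\<close>

definition ind_module :: "('g, 'b) monoid_scheme \<Rightarrow> 'g set
    \<Rightarrow> ('k, 'g, 'v) gmodule \<Rightarrow> ('k, 'g, 'g \<Rightarrow> 'v) gmodule"
  where "ind_module G P X = \<lparr>
    carrier = {f \<in> carrier G \<rightarrow>\<^sub>E carrier X.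
      \<forall>g \<in> carrier G. \<forall>q \<in> P. f (g \<otimes>\<^bsub>G\<^esub> q) = act X (inv\<^bsub>G\<^esub> q) (f g)},
    mult = undefined, one = undefined,
    zero = (\<lambda>g \<in> carrier G. \<zero>\<^bsub>X\<^esub>),
    add = (\<lambda>f f'. \<lambda>g \<in> carrier G. f g \<oplus>\<^bsub>X\<^esub> f' g),
    smult = (\<lambda>c f. \<lambda>g \<in> carrier G. c \<odot>\<^bsub>X\<^esub> f g),
    act = (\<lambda>x f. \<lambda>g \<in> carrier G. f (inv\<^bsub>G\<^esub> x \<otimes>\<^bsub>G\<^esub> g))\<rparr>"

text \<open>
  In the following, \<open>P\<close> is a function choosing for Levi subgroups \<open>L \<subseteq> M\<close> a parabolic subgroup
  \<open>P M L\<close> of \<open>M\<close> with Levi complement \<open>L\<close>, and \<open>HC_ind\<close>, \<open>HC_res\<close> are formed with respect to it.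
\<close>

definition HC_ind :: "('g, 'b) monoid_scheme \<Rightarrow> nat \<Rightarrow> ('g set \<Rightarrow> 'g set \<Rightarrow> 'g set)
    \<Rightarrow> 'g set \<Rightarrow> 'g set
    \<Rightarrow> (('k, 'g, 'v) gmodule, 'v \<Rightarrow> 'v, ('k, 'g, 'g \<Rightarrow> 'v) gmodule, ('g \<Rightarrow> 'v) \<Rightarrow> ('g \<Rightarrow> 'v)) fctr"
  where "HC_ind G p P M L = \<lparr>
    FObj = (\<lambda>X. ind_module (G\<lparr>carrier := M\<rparr>) (P M L) (inflate G p (P M L) L X)),
    FArr = (\<lambda>X X' t.
      \<lambda>f \<in> carrier (ind_module (G\<lparr>carrier := M\<rparr>) (P M L) (inflate G p (P M L) L X)).
        compose M t f)\<rparr>"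

definition HC_res :: "('g, 'b) monoid_scheme \<Rightarrow> nat \<Rightarrow> ('g set \<Rightarrow> 'g set \<Rightarrow> 'g set)
    \<Rightarrow> 'g set \<Rightarrow> 'g set
    \<Rightarrow> (('k, 'g, 'v) gmodule, 'v \<Rightarrow> 'v, ('k, 'g, 'v) gmodule, 'v \<Rightarrow> 'v) fctr"
  where "HC_res G p P M L = (let fix = (\<lambda>V. {v \<in> carrier V. \<forall>u \<in> p_core G p (P M L). act V u v = v})
    in \<lparr>FObj = (\<lambda>V. V\<lparr>carrier := fix V\<rparr>), FArr = (\<lambda>V V' t. restrict t (fix V))\<rparr>)"

context split_BN_pair
begin

definition levi_system :: "'g set set \<Rightarrow> bool"
  where "levi_system \<L> \<longleftrightarrow> \<L> \<subseteq> levis \<and> carrier G \<in> \<L> \<and> B \<inter> N \<in> \<L> \<and>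
    (\<forall>n \<in> N. \<forall>L \<in> \<L>. conj_set G n L \<in> \<L>) \<and>
    (\<forall>L\<^sub>1 \<in> \<L>. \<forall>L\<^sub>2 \<in> \<L>. \<forall>n \<in> N. L\<^sub>1 \<inter> conj_set G n L\<^sub>2 \<in> \<L>)"

definition parabolic_choice :: "'g set set \<Rightarrow> ('g set \<Rightarrow> 'g set \<Rightarrow> 'g set) \<Rightarrow> bool"
  where "parabolic_choice \<L> P \<longleftrightarrow> (\<forall>M \<in> \<L>. \<forall>L \<in> \<L>. L \<subseteq> M \<longrightarrow>
    P M L \<in> parabolics M \<and> levi_complement G p (P M L) L)"

end

definition weakly_cuspidal_pair :: "('k, 'c) ring_scheme \<Rightarrow> ('g, 'b) monoid_scheme \<Rightarrow> nat
    \<Rightarrow> 'g set set \<Rightarrow> ('g set \<Rightarrow> 'g set \<Rightarrow> 'g set) \<Rightarrow> 'g set \<Rightarrow> ('k, 'g, 'v) gmodule \<Rightarrow> bool"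
  where "weakly_cuspidal_pair k G p \<L> P L X \<longleftrightarrow> L \<in> \<L> \<and> simple_kG_module k (G\<lparr>carrier := L\<rparr>) X \<and>
    (\<forall>L\<^sub>1 \<in> \<L>. L\<^sub>1 \<subseteq> L \<and> L\<^sub>1 \<noteq> L \<longrightarrow> carrier (FObj (HC_res G p P L L\<^sub>1) X) = {\<zero>\<^bsub>X\<^esub>})"

definition kG_iso :: "('k, 'c) ring_scheme \<Rightarrow> ('g, 'b) monoid_scheme
    \<Rightarrow> ('k, 'g, 'v) gmodule \<Rightarrow> ('k, 'g, 'w) gmodule \<Rightarrow> ('v \<Rightarrow> 'w) set"
  where "kG_iso k G V W = {f \<in> kG_hom k G V W. bij_betw f (carrier V) (carrier W)}"

text \<open>
  The embedding of \<open>End(Z)\<close> into \<open>End(Y)\<close> given by a functor \<open>R\<close> and an isomorphism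
  \<open>\<phi> : R(Z) \<rightarrow> Y\<close>, which sends \<open>h\<close> to \<open>\<phi> R(h) \<phi>\<^sup>-\<^sup>1\<close>.
\<close>

definition End_embedding :: "(('k, 'g, 'z) gmodule, 'z \<Rightarrow> 'z, ('k, 'g, 'w) gmodule, 'w \<Rightarrow> 'w) fctr
    \<Rightarrow> ('k, 'g, 'z) gmodule \<Rightarrow> ('k, 'g, 'y) gmodule \<Rightarrow> ('w \<Rightarrow> 'y)
    \<Rightarrow> ('z \<Rightarrow> 'z) \<Rightarrow> ('y \<Rightarrow> 'y)"
  where "End_embedding R Z Y \<phi> h =
    (\<lambda>y \<in> carrier Y. \<phi> (FArr R Z Z h (inv_into (carrier (FObj R Z)) \<phi> y)))"

end

theory Submission
  imports Defs
begin

text \<open>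
  By Frobenius reciprocity a homomorphism from \<open>R\<^sub>M\<^sup>G(Z)\<close> to \<open>V\<close> is determined by its restriction to
  \<open>1 \<otimes> Z\<close>, which is an arbitrary homomorphism of \<open>Z\<close> into the fixed points of the unipotent radical
  in \<open>V\<close>; so \<open>f \<mapsto> (z \<mapsto> f (\<phi> (1 \<otimes> z)))\<close> is the required isomorphism. That \<open>Z\<close> is a module for \<open>M\<close>
  at all needs the parabolic subgroup chosen in \<open>M\<close> to be contained in \<open>M\<close>. As Levi subgroups are
  generated by root subgroups, this amounts to the rank one statement that the subgroup generated by
  \<open>B \<inter> N\<close> and the two root subgroups belonging to a simple reflection contains a representative of it.
\<close>

section \<open>Lengths in groups generated by involutions\<close>

text \<open>The inclusion of the chosen parabolic subgroup in M is the hard point: Levi subgroups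
  are defined by root subgroups, parabolic subgroups by products with \<open>N_sub I\<close>, and
  the axioms do not compare the two. What the axioms offer is exchange. It gives disjointness of the
  double cosets of B and, through them, a length function with a longest element w0. From these come
  the two facts behind the rank one statement: B is the product of its intersections with the
  conjugates of B by s and by s w0, and, with saturation, B meets its conjugate by w0 in T. On the
  module side, the objects of both categories are finite-dimensional, so induced modules, Hom spaces
  and fixed points have to be shown to be so. In each case finitely many linear maps into a space
  known to be finite-dimensional separate the points, and no bases are needed.\<close>

locale involution_system = group W for W :: "('a, 'b) monoid_scheme" (structure) +
  fixes S :: "'a set"
  assumes S_closed: "S \<subseteq> carrier W"
    and S_generates: "generate W S = carrier W"
    and S_square: "s \<in> S \<Longrightarrow> s \<otimes> s = \<one>"
begin

text \<open>Abstract copies of \<open>word\<close> and \<open>len\<close>;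
  \<open>len_eq_wlen\<close> identifies the lengths later.\<close>

definition wprod :: "'a list \<Rightarrow> 'a"
  where "wprod ss = foldr (\<lambda>s w. s \<otimes> w) ss \<one>"

definition wlen :: "'a \<Rightarrow> nat"
  where "wlen w = (LEAST n. \<exists>ss \<in> lists S. length ss = n \<and> wprod ss = w)"

lemma S_carrier [simp]: "s \<in> S \<Longrightarrow> s \<in> carrier W"
  using S_closed by blast

lemma S_inv: "s \<in> S \<Longrightarrow> inv s = s"
  by (simp add: S_square inv_equality)

lemma S_cancel [simp]: "\<lbrakk>s \<in> S; w \<in> carrier W\<rbrakk> \<Longrightarrow> s \<otimes> (s \<otimes> w) = w"
  by (simp flip: m_assoc add: S_square)

lemma wprod_simps [simp]: "wprod [] = \<one>" "wprod (s # ss) = s \<otimes> wprod ss"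
  by (simp_all add: wprod_def)

lemma wprod_closed [simp]: "ss \<in> lists S \<Longrightarrow> wprod ss \<in> carrier W"
  by (induction ss) auto

lemma wprod_append: "\<lbrakk>ss \<in> lists S; ts \<in> lists S\<rbrakk> \<Longrightarrow> wprod (ss @ ts) = wprod ss \<otimes> wprod ts"
  by (induction ss) (auto simp: m_assoc)

lemma wprod_rev: "ss \<in> lists S \<Longrightarrow> wprod (rev ss) = inv (wprod ss)"
  by (induction ss) (auto simp: wprod_append in_lists_conv_set inv_mult_group S_inv)

lemma ex_word:
  assumes "w \<in> carrier W"
  shows "\<exists>ss \<in> lists S. wprod ss = w"
proof -
  have "w \<in> generate W S" using assms S_generates by simp
  then show ?thesis
  proof induction
    case one
    then show ?case by (intro bexI[of _ "[]"]) auto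
  next
    case (incl h)
    then show ?case by (intro bexI[of _ "[h]"]) auto
  next
    case (inv h)
    then show ?case by (intro bexI[of _ "[h]"]) (auto simp: S_inv)
  next
    case (eng h1 h2)
    then show ?case by (metis append_in_lists_conv wprod_append)
  qed
qed

lemma wlen_le: "ss \<in> lists S \<Longrightarrow> wlen (wprod ss) \<le> length ss"
  unfolding wlen_def by (rule Least_le) auto

lemma reduced_word:
  assumes "w \<in> carrier W"
  obtains ss where "ss \<in> lists S" "wprod ss = w" "length ss = wlen w"
proof -
  have "\<exists>n. \<exists>ss \<in> lists S. length ss = n \<and> wprod ss = w"
    using ex_word[OF assms] by auto
  then have "\<exists>ss \<in> lists S. length ss = wlen w \<and> wprod ss = w"
    unfolding wlen_def by (rule LeastI_ex)
  then show thesis using that by blast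
qed

lemma wlen_inv_le: "w \<in> carrier W \<Longrightarrow> wlen (inv w) \<le> wlen w"
  by (metis reduced_word wprod_rev wlen_le length_rev in_lists_conv_set set_rev)

lemma wlen_inv: "w \<in> carrier W \<Longrightarrow> wlen (inv w) = wlen w"
  using wlen_inv_le[of w] wlen_inv_le[of "inv w"] by simp

lemma wlen_mult_le:
  assumes "v \<in> carrier W" "w \<in> carrier W"
  shows "wlen (v \<otimes> w) \<le> wlen v + wlen w"
proof -
  obtain ss ts where "ss \<in> lists S" "wprod ss = v" "length ss = wlen v"
    "ts \<in> lists S" "wprod ts = w" "length ts = wlen w"
    using assms by (metis reduced_word)
  then show ?thesis using wlen_le[of "ss @ ts"] by (simp add: wprod_append)
qed

lemma wlen_S_le: "s \<in> S \<Longrightarrow> wlen s \<le> 1"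
  using wlen_le[of "[s]"] by simp

lemma wlen_eq_1:
  assumes "w \<in> carrier W" "wlen w = 1"
  shows "w \<in> S"
proof -
  obtain ss where "ss \<in> lists S" "wprod ss = w" "length ss = 1"
    using assms by (metis reduced_word)
  then show ?thesis by (auto simp: length_Suc_conv)
qed

end

text \<open>For fixed s, \<open>Q s\<close> stands for the half-space of those w for which s w is
  longer than w. The three properties are Bourbaki's criterion for a Coxeter system. With Q
  abstract, the BN-pair can supply it by double cosets before anything is known about
  lengths.\<close>

locale exchange_system = involution_system W S for W :: "('a, 'b) monoid_scheme" (structure) and S +
  fixes Q :: "'a \<Rightarrow> 'a \<Rightarrow> bool"
  assumes Q_one: "s \<in> S \<Longrightarrow> Q s \<one>"
    and Q_commute: "\<lbrakk>s \<in> S; t \<in> S; w \<in> carrier W; Q s w; \<not> Q s (w \<otimes> t)\<rbrakk> \<Longrightarrow> s \<otimes> w = w \<otimes> t"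
    and Q_flip: "\<lbrakk>s \<in> S; w \<in> carrier W; Q s w\<rbrakk> \<Longrightarrow> \<not> Q s (s \<otimes> w)"
begin

text \<open>Among the products of v with the initial segments of ts, consider the first at which
  \<open>Q s\<close> fails: there \<open>Q_commute\<close> moves s to the right, where it cancels
  against the letter just reached. Starting at v rather than at the identity records that the
  deleted letter lies beyond v, which the argument for w0 needs.\<close>

lemma exchange_after:
  assumes "s \<in> S" "v \<in> carrier W" "ts \<in> lists S" "Q s v" "\<not> Q s (v \<otimes> wprod ts)"
  shows "\<exists>us \<in> lists S. length us < length ts \<and> s \<otimes> v \<otimes> wprod ts = v \<otimes> wprod us"
  using assms(2-5)
proof (induction ts arbitrary: v)
  case Nil
  then show ?case by simp
next
  case (Cons t ts)
  then have t: "t \<in> S" and ts: "ts \<in> lists S" by auto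
  show ?case
  proof (cases "Q s (v \<otimes> t)")
    case True
    have "\<not> Q s (v \<otimes> t \<otimes> wprod ts)" using Cons.prems t ts by (simp add: m_assoc)
    then obtain us where us: "us \<in> lists S" "length us < length ts"
      "s \<otimes> (v \<otimes> t) \<otimes> wprod ts = v \<otimes> t \<otimes> wprod us"
      using Cons.IH[of "v \<otimes> t"] Cons.prems(1) True t ts by auto
    then show ?thesis
      using t ts Cons.prems(1) assms(1)
      by (intro bexI[of _ "t # us"]) (auto simp: m_assoc)
  next
    case False
    then have "s \<otimes> v = v \<otimes> t" using Q_commute assms(1) t Cons.prems by blast
    then have "s \<otimes> v \<otimes> wprod (t # ts) = v \<otimes> wprod ts"
      using t ts Cons.prems(1) assms(1) by (simp add: m_assoc)
    then show ?thesis using ts by (intro bexI[of _ ts]) auto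
  qed
qed

text \<open>Exchange from v = 1 gives s w a word with fewer letters than a reduced word of
  w.\<close>

lemma wlen_not_Q:
  assumes "s \<in> S" "w \<in> carrier W" "\<not> Q s w"
  shows "wlen (s \<otimes> w) < wlen w"
proof -
  obtain ts where ts: "ts \<in> lists S" "wprod ts = w" "length ts = wlen w"
    using assms(2) by (rule reduced_word)
  then obtain us where "us \<in> lists S" "length us < length ts" "s \<otimes> w = wprod us"
    using exchange_after[of s \<one> ts] assms Q_one by auto
  then show ?thesis using ts wlen_le[of us] by simp
qed

text \<open>By \<open>Q_flip\<close> the preceding bound applies to s w, and s (s w) = w; a single
  letter changes the length by at most one.\<close>

lemma wlen_Q:
  assumes "s \<in> S" "w \<in> carrier W" "Q s w"
  shows "wlen (s \<otimes> w) = Suc (wlen w)"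
proof -
  have "wlen (s \<otimes> (s \<otimes> w)) < wlen (s \<otimes> w)"
    using assms by (intro wlen_not_Q Q_flip) auto
  moreover have "wlen (s \<otimes> w) \<le> 1 + wlen w"
    using wlen_mult_le[of s w] wlen_S_le[of s] assms by simp
  ultimately show ?thesis using assms by simp
qed

lemma Q_iff:
  assumes "s \<in> S" "w \<in> carrier W"
  shows "Q s w \<longleftrightarrow> wlen w < wlen (s \<otimes> w)"
  using assms wlen_Q wlen_not_Q by force

text \<open>
  Every reduced word is the beginning of a reduced word of \<open>w\<^sub>0\<close>: if \<open>w\<^sub>0 = w v\<close> reduced
  and \<open>s w\<close> is longer than \<open>w\<close>, then the letter deleted in passing to \<open>s w\<^sub>0\<close> lies in \<open>v\<close>.
\<close>

lemma wlen_longest_word: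
  assumes w0: "w\<^sub>0 \<in> carrier W" and max: "\<And>w. w \<in> carrier W \<Longrightarrow> wlen w \<le> wlen w\<^sub>0"
    and "ss \<in> lists S" "length ss = wlen (wprod ss)"
  shows "wlen (inv (wprod ss) \<otimes> w\<^sub>0) + length ss \<le> wlen w\<^sub>0"
  using assms(3,4)
proof (induction ss)
  case Nil
  then show ?case using w0 by simp
next
  case (Cons s ss)
  then have s: "s \<in> S" and ss: "ss \<in> lists S" by auto
  let ?w = "wprod ss"
  have w: "?w \<in> carrier W" using ss by simp
  \<comment> \<open>This bound shows that the tail of the reduced word is again reduced.\<close>
  have "wlen (s \<otimes> ?w) \<le> 1 + wlen ?w"
    using wlen_mult_le[of s ?w] wlen_S_le[of s] s w by simp
  with Cons.prems wlen_le[OF ss] have len: "length ss = wlen ?w"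
    and less: "wlen ?w < wlen (s \<otimes> ?w)" by auto
  have IH: "wlen (inv ?w \<otimes> w\<^sub>0) + length ss \<le> wlen w\<^sub>0" using Cons.IH ss len by blast
  obtain ts where ts: "ts \<in> lists S" "wprod ts = inv ?w \<otimes> w\<^sub>0" "length ts = wlen (inv ?w \<otimes> w\<^sub>0)"
    using w w0 reduced_word[of "inv ?w \<otimes> w\<^sub>0"] by auto
  have w0_eq: "?w \<otimes> wprod ts = w\<^sub>0" using ts w w0 by (simp flip: m_assoc)
  have "Q s ?w" using Q_iff s w less by simp
  \<comment> \<open>Multiplication by s cannot lengthen an element of maximal length.\<close>
  moreover have "\<not> Q s w\<^sub>0" using Q_iff[OF s w0] max[of "s \<otimes> w\<^sub>0"] s w0 by simp
  ultimately obtain us where us: "us \<in> lists S" "length us < length ts"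
    "s \<otimes> ?w \<otimes> wprod ts = ?w \<otimes> wprod us"
    using exchange_after[OF s w ts(1)] w0_eq by auto
  have "s \<otimes> w\<^sub>0 = ?w \<otimes> wprod us" using us(3) w0_eq s w ts(1) by (simp add: m_assoc)
  then have "inv (wprod (s # ss)) \<otimes> w\<^sub>0 = wprod us"
    using s w us(1) w0 by (simp add: inv_mult_group S_inv m_assoc inv_solve_left')
  then show ?case using us ts IH wlen_le[OF us(1)] by simp
qed

text \<open>One inequality is the extension of reduced words to w0, the other is subadditivity for
  w0 = w (w^-1 w0).\<close>

lemma wlen_longest:
  assumes w0: "w\<^sub>0 \<in> carrier W" and max: "\<And>w. w \<in> carrier W \<Longrightarrow> wlen w \<le> wlen w\<^sub>0"
    and w: "w \<in> carrier W"
  shows "wlen (inv w \<otimes> w\<^sub>0) + wlen w = wlen w\<^sub>0"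
proof -
  obtain ss where "ss \<in> lists S" "wprod ss = w" "length ss = wlen w"
    using w by (rule reduced_word)
  then have "wlen (inv w \<otimes> w\<^sub>0) + wlen w \<le> wlen w\<^sub>0"
    using wlen_longest_word[OF w0 max] by metis
  moreover have "wlen (w \<otimes> (inv w \<otimes> w\<^sub>0)) \<le> wlen w + wlen (inv w \<otimes> w\<^sub>0)"
    using w w0 by (intro wlen_mult_le) auto
  ultimately show ?thesis using w w0 by (simp flip: m_assoc)
qed

end

section \<open>Double cosets in a BN-pair\<close>

context BN_pair
begin

text \<open>These rules would unfold products in the Weyl group into products of cosets; without
  them the group laws of W apply as they stand.\<close>

declare mult_FactGroup [simp del] one_FactGroup [simp del]

abbreviation T where "T \<equiv> B \<inter> N"

lemma B_carrier [simp]: "b \<in> B \<Longrightarrow> b \<in> carrier G"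
  by (rule subgroup.mem_carrier[OF B_subgroup])

lemma N_carrier [simp]: "n \<in> N \<Longrightarrow> n \<in> carrier G"
  by (rule subgroup.mem_carrier[OF N_subgroup])

lemma BN_closed [simp]:
  "\<lbrakk>x \<in> B; y \<in> B\<rbrakk> \<Longrightarrow> x \<otimes> y \<in> B" "x \<in> B \<Longrightarrow> inv x \<in> B" "\<one> \<in> B"
  "\<lbrakk>x \<in> N; y \<in> N\<rbrakk> \<Longrightarrow> x \<otimes> y \<in> N" "x \<in> N \<Longrightarrow> inv x \<in> N" "\<one> \<in> N"
  using B_subgroup N_subgroup
  by (auto simp: subgroup.m_closed subgroup.m_inv_closed subgroup.one_closed)

lemma T_subgroup: "subgroup T G"
  using B_subgroup N_subgroup by (rule subgroups_Inter_pair)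

lemma T_conj:
  assumes "n \<in> N" "t \<in> T"
  shows "n \<otimes> t \<otimes> inv n \<in> T" "inv n \<otimes> t \<otimes> n \<in> T"
  using normal.inv_op_closed2[OF normal_BN, of n t] normal.inv_op_closed1[OF normal_BN, of n t]
    assms m_inv_consistent[OF N_subgroup] by auto

lemma group_W: "group W"
  using normal_BN by (rule normal.factorgroup_is_group)

lemma
  assumes "w \<in> carrier W" "n \<in> w"
  shows W_mem_N: "n \<in> N" and W_eq: "w = T #> n"
proof -
  obtain a where a: "a \<in> N" "w = T #> a"
    using assms(1) by (auto simp: FactGroup_def RCOSETS_def r_coset_def)
  then show "n \<in> N" using assms(2) by (auto simp: r_coset_def)
  show "w = T #> n"
    using repr_independence[of n T a] assms(2) a T_subgroup by auto
qed

lemma W_nonempty: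
  assumes "w \<in> carrier W"
  obtains n where "n \<in> w"
proof -
  obtain a where "a \<in> N" "w = T #> a"
    using assms by (auto simp: FactGroup_def RCOSETS_def r_coset_def)
  moreover have "a \<in> T #> a" using rcos_self[OF _ T_subgroup] \<open>a \<in> N\<close> by simp
  ultimately show thesis using that by simp
qed

lemma W_mult: "w \<otimes>\<^bsub>W\<^esub> w' = w <#> w'"
  by (simp add: FactGroup_def set_mult_def)

lemma W_one: "\<one>\<^bsub>W\<^esub> = T"
  by (simp add: FactGroup_def)

lemma W_mult_mem: "\<lbrakk>n \<in> w; m \<in> w'\<rbrakk> \<Longrightarrow> n \<otimes> m \<in> w \<otimes>\<^bsub>W\<^esub> w'"
  by (auto simp: W_mult set_mult_def)

lemma W_mult_memE:
  assumes "x \<in> w \<otimes>\<^bsub>W\<^esub> w'"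
  obtains n m where "n \<in> w" "m \<in> w'" "x = n \<otimes> m"
  using assms by (auto simp: W_mult set_mult_def)

lemma W_inv_mem:
  assumes "w \<in> carrier W" "n \<in> w"
  shows "inv n \<in> inv\<^bsub>W\<^esub> w"
proof -
  have "inv\<^bsub>W\<^esub> w = set_inv\<^bsub>G\<lparr>carrier := N\<rparr>\<^esub> w"
    using normal.inv_FactGroup[OF normal_BN assms(1)] .
  moreover have "inv\<^bsub>G\<lparr>carrier := N\<rparr>\<^esub> n = inv n"
    using m_inv_consistent[OF N_subgroup W_mem_N[OF assms]] .
  ultimately show ?thesis using assms(2) unfolding SET_INV_def by force
qed

lemma T_mult_mem:
  assumes "w \<in> carrier W" "n \<in> w" "t \<in> T"
  shows "t \<otimes> n \<in> w" "n \<otimes> t \<in> w"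
proof -
  have *: "t \<otimes> n \<in> w" if "t \<in> T" for t
    using W_eq[OF assms(1,2)] that by (auto simp: r_coset_def)
  have "n \<otimes> t = (n \<otimes> t \<otimes> inv n) \<otimes> n"
    using W_mem_N[OF assms(1,2)] assms(3) by (simp add: m_assoc)
  then show "n \<otimes> t \<in> w" using *[OF T_conj(1)[OF W_mem_N[OF assms(1,2)] assms(3)]] by simp
  show "t \<otimes> n \<in> w" using * assms(3) by blast
qed

text \<open>W consists of right cosets T n; normality of T makes them left cosets as well.\<close>

lemma W_same_coset:
  assumes "w \<in> carrier W" "n \<in> w" "m \<in> w"
  obtains t where "t \<in> T" "m = n \<otimes> t"
proof -
  have nm: "n \<in> N" "m \<in> N" using W_mem_N assms by auto
  have "m \<in> T #> n" using W_eq[OF assms(1,2)] assms(3) by simp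
  then obtain t where t: "t \<in> T" "m = t \<otimes> n" by (auto simp: r_coset_def)
  have "inv n \<otimes> t \<otimes> n \<in> T" using T_conj nm t by blast
  moreover have "m = n \<otimes> (inv n \<otimes> t \<otimes> n)" using t nm by (simp flip: m_assoc)
  ultimately show thesis using that by blast
qed

lemma S_mem_W [simp]: "s \<in> S \<Longrightarrow> s \<in> carrier W"
  using S_subset by blast

lemma S_mem_N: "s \<in> S \<Longrightarrow> n \<in> s \<Longrightarrow> n \<in> N"
  using W_mem_N S_mem_W by blast

sublocale weyl: involution_system W S
proof -
  interpret W: group W by (rule group_W)
  show "involution_system W S"
    by unfold_locales (use S_subset generate_S S_involution in auto)
qed

text \<open>The double coset B w B. Letting n range over the whole coset w avoids choosing a
  representative; \<open>dcosE\<close> shows that any one of them will do.\<close>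

definition dcos :: "'g set \<Rightarrow> 'g set"
  where "dcos w = {b \<otimes> n \<otimes> b' | b n b'. b \<in> B \<and> n \<in> w \<and> b' \<in> B}"

lemma dcosI: "\<lbrakk>b \<in> B; n \<in> w; b' \<in> B\<rbrakk> \<Longrightarrow> b \<otimes> n \<otimes> b' \<in> dcos w"
  unfolding dcos_def by blast

lemma mem_dcos: "\<lbrakk>w \<in> carrier W; n \<in> w\<rbrakk> \<Longrightarrow> n \<in> dcos w"
  using dcosI[of \<one> n w \<one>] W_mem_N by simp

lemma dcosE:
  assumes "x \<in> dcos w" "w \<in> carrier W" "n \<in> w"
  obtains b b' where "b \<in> B" "b' \<in> B" "x = b \<otimes> n \<otimes> b'"
proof -
  obtain b m b' where b: "b \<in> B" "m \<in> w" "b' \<in> B" "x = b \<otimes> m \<otimes> b'"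
    using assms(1) unfolding dcos_def by blast
  obtain t where t: "t \<in> T" "m = n \<otimes> t" using W_same_coset assms(2,3) b(2) by blast
  have "x = b \<otimes> n \<otimes> (t \<otimes> b')" using b t W_mem_N assms(2,3) by (simp add: m_assoc)
  then show thesis using that[of b "t \<otimes> b'"] b t by simp
qed

lemma dcos_mult:
  assumes "x \<in> dcos w" "w \<in> carrier W" "b \<in> B"
  shows "b \<otimes> x \<in> dcos w" "x \<otimes> b \<in> dcos w"
proof -
  obtain c n c' where c: "c \<in> B" "n \<in> w" "c' \<in> B" "x = c \<otimes> n \<otimes> c'"
    using assms(1) unfolding dcos_def by blast
  have "n \<in> carrier G" using W_mem_N assms(2) c by simp
  then have "b \<otimes> x = (b \<otimes> c) \<otimes> n \<otimes> c'" "x \<otimes> b = c \<otimes> n \<otimes> (c' \<otimes> b)"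
    using c assms(3) by (simp_all add: m_assoc)
  then show "b \<otimes> x \<in> dcos w" "x \<otimes> b \<in> dcos w"
    using c assms(3) dcosI by (metis BN_closed(1))+
qed

lemma dcos_inv:
  assumes "x \<in> dcos w" "w \<in> carrier W"
  shows "inv x \<in> dcos (inv\<^bsub>W\<^esub> w)"
proof -
  obtain b n b' where b: "b \<in> B" "n \<in> w" "b' \<in> B" "x = b \<otimes> n \<otimes> b'"
    using assms(1) unfolding dcos_def by blast
  have "n \<in> carrier G" using W_mem_N assms(2) b by simp
  then have "inv x = inv b' \<otimes> inv n \<otimes> inv b"
    using b by (simp add: inv_mult_group m_assoc)
  then show ?thesis using b W_inv_mem[OF assms(2)] dcosI by simp
qed

lemma dcos_one: "dcos T = B"
proof
  show "dcos T \<subseteq> B" unfolding dcos_def by auto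
  show "B \<subseteq> dcos T"
    using dcosI[of _ \<one> T \<one>] subgroup.one_closed[OF T_subgroup] by force
qed

lemma exchange_left:
  assumes "s \<in> S" "n \<in> s" "w \<in> carrier W" "m \<in> w" "b \<in> B"
  shows "n \<otimes> b \<otimes> m \<in> dcos w \<union> dcos (s \<otimes>\<^bsub>W\<^esub> w)"
proof -
  have m: "m \<in> N" using W_mem_N[OF assms(3,4)] .
  have "n \<otimes> b \<otimes> m \<in> n <# B #> m"
    using assms(5) by (auto simp: l_coset_def r_coset_def)
  then have "n \<otimes> b \<otimes> m \<in> (B #> m <#> B) \<union> (B #> (n \<otimes> m) <#> B)"
    using exchange[OF assms(1,2) m] by blast
  then show ?thesis
    using assms(4) W_mult_mem[OF assms(2,4)] dcosI
    by (fastforce simp: r_coset_def set_mult_def)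
qed

text \<open>The mirror image of \<open>exchange_left\<close>, by inversion: s is its own inverse,
  and B w B is inverted to B w^-1 B.\<close>

lemma exchange_right:
  assumes "s \<in> S" "n \<in> s" "w \<in> carrier W" "m \<in> w" "b \<in> B"
  shows "m \<otimes> b \<otimes> n \<in> dcos w \<union> dcos (w \<otimes>\<^bsub>W\<^esub> s)"
proof -
  have n: "n \<in> carrier G" and m: "m \<in> carrier G"
    using S_mem_N[OF assms(1,2)] W_mem_N[OF assms(3,4)] by auto
  have s: "s \<in> carrier W" using assms by simp
  have "inv n \<otimes> inv b \<otimes> inv m \<in> dcos (inv\<^bsub>W\<^esub> w) \<union> dcos (s \<otimes>\<^bsub>W\<^esub> inv\<^bsub>W\<^esub> w)"
    using exchange_left[OF assms(1), of "inv n" "inv\<^bsub>W\<^esub> w" "inv m" "inv b"]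
      W_inv_mem[OF s assms(2)] W_inv_mem[OF assms(3,4)] assms weyl.S_inv by simp
  moreover have "inv (inv n \<otimes> inv b \<otimes> inv m) = m \<otimes> b \<otimes> n"
    using n m assms(5) by (simp add: inv_mult_group m_assoc)
  moreover have "inv\<^bsub>W\<^esub> (s \<otimes>\<^bsub>W\<^esub> inv\<^bsub>W\<^esub> w) = w \<otimes>\<^bsub>W\<^esub> s"
    using assms(1,3) by (simp add: weyl.inv_mult_group weyl.S_inv)
  ultimately show ?thesis
    using dcos_inv[of _ "inv\<^bsub>W\<^esub> w"] dcos_inv[of _ "s \<otimes>\<^bsub>W\<^esub> inv\<^bsub>W\<^esub> w"] assms(3) s
    by (metis Un_iff weyl.inv_closed weyl.inv_inv weyl.m_closed)
qed

text \<open>Tits' induction on the word. Cancelling its first letter puts a representative m of the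
  tail into BwB or BswB, by exchange. Comparison of lengths rules out the first; in the second the
  tail equals s w by induction.\<close>

lemma bruhat_word:
  assumes "ss \<in> lists S" "w \<in> carrier W" "length ss \<le> weyl.wlen w"
    "x \<in> dcos (weyl.wprod ss)" "x \<in> dcos w"
  shows "weyl.wprod ss = w"
  using assms
proof (induction ss arbitrary: w x rule: list.induct)
  case Nil
  then have "x \<in> B" by (simp add: W_one dcos_one)
  obtain m where m: "m \<in> w" using Nil.prems by (auto intro: W_nonempty)
  then have mc: "m \<in> N" using W_mem_N Nil.prems by auto
  obtain b b' where b: "b \<in> B" "b' \<in> B" "x = b \<otimes> m \<otimes> b'" using m Nil.prems dcosE by blast
  then have "m = inv b \<otimes> x \<otimes> inv b'" using mc \<open>x \<in> B\<close>
    by (metis B_carrier N_carrier inv_solve_left inv_solve_right m_assoc m_closed inv_closed)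
  then have "m \<in> B" using b \<open>x \<in> B\<close> BN_closed(1,2) by metis
  then have "m \<in> T" using mc by simp
  then have "T #> m = T" by (metis T_subgroup subgroup.rcos_const is_group)
  then show ?case using W_eq[OF \<open>w \<in> carrier W\<close> m] by (simp add: W_one)
next
  case (Cons s ss)
  let ?u = "weyl.wprod ss"
  have s: "s \<in> S" and ss: "ss \<in> lists S" using Cons.prems by auto
  have u: "?u \<in> carrier W" using ss by simp
  obtain n where n: "n \<in> s" using s by (auto intro: W_nonempty[OF S_mem_W])
  obtain m where m: "m \<in> ?u" using u by (auto intro: W_nonempty)
  obtain m' where m': "m' \<in> w" using Cons.prems by (auto intro: W_nonempty)
  have nN: "n \<in> N" and mN: "m \<in> N" and m'N: "m' \<in> N"
    using W_mem_N[OF S_mem_W[OF s] n] W_mem_N[OF u m] W_mem_N[OF Cons.prems(2) m'] by auto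
  have "n \<otimes> m \<in> weyl.wprod (s # ss)" using W_mult_mem n m by simp
  then obtain b b' where b: "b \<in> B" "b' \<in> B" "x = b \<otimes> (n \<otimes> m) \<otimes> b'"
    using Cons.prems dcosE by (metis weyl.wprod_closed)
  obtain c c' where c: "c \<in> B" "c' \<in> B" "x = c \<otimes> m' \<otimes> c'"
    using Cons.prems m' dcosE by blast
  define d where "d = inv b \<otimes> c"
  define d' where "d' = c' \<otimes> inv b'"
  have d: "d \<in> B" "d' \<in> B" using b c by (auto simp: d_def d'_def)
  have eq: "c \<otimes> (m' \<otimes> c') = b \<otimes> (n \<otimes> (m \<otimes> b'))" using b c nN mN m'N by (simp add: m_assoc)
  have "d \<otimes> m' \<otimes> d' = inv b \<otimes> (c \<otimes> (m' \<otimes> c')) \<otimes> inv b'"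
    unfolding d_def d'_def using b(1,2) c(1,2) m'N by (simp add: m_assoc)
  also have "\<dots> = n \<otimes> m"
    unfolding eq using b(1,2) nN mN by (simp add: m_assoc r_inv) (simp flip: m_assoc)
  finally have "m = inv n \<otimes> d \<otimes> m' \<otimes> d'" using d nN mN m'N
    by (simp add: m_assoc inv_solve_left)
  moreover have "inv n \<otimes> d \<otimes> m' \<in> dcos w \<union> dcos (s \<otimes>\<^bsub>W\<^esub> w)"
    using exchange_left[OF s, of "inv n" w m' d] W_inv_mem[OF S_mem_W[OF s] n] weyl.S_inv[OF s]
      Cons.prems(2) m' d by simp
  ultimately have "m \<in> dcos w \<union> dcos (s \<otimes>\<^bsub>W\<^esub> w)"
    using dcos_mult(2) Cons.prems(2) s d by auto
  moreover have mu: "m \<in> dcos ?u" using m u by (rule mem_dcos[rotated])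
  \<comment> \<open>Otherwise induction would identify the tail with w, although w needs more
    letters than the tail has.\<close>
  have "m \<notin> dcos w"
  proof
    assume "m \<in> dcos w"
    then have "?u = w" using Cons.IH[OF ss Cons.prems(2) _ mu] Cons.prems(3) by simp
    then show False using weyl.wlen_le[OF ss] Cons.prems(3) by simp
  qed
  ultimately have m2: "m \<in> dcos (s \<otimes>\<^bsub>W\<^esub> w)" by simp
  \<comment> \<open>Multiplication by s shortens w by at most one, so the length bound of the
    induction hypothesis survives.\<close>
  have "weyl.wlen (s \<otimes>\<^bsub>W\<^esub> (s \<otimes>\<^bsub>W\<^esub> w)) \<le> 1 + weyl.wlen (s \<otimes>\<^bsub>W\<^esub> w)"
    using weyl.wlen_mult_le[of s "s \<otimes>\<^bsub>W\<^esub> w"] weyl.wlen_S_le[OF s] s Cons.prems(2) by simp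
  then have "length ss \<le> weyl.wlen (s \<otimes>\<^bsub>W\<^esub> w)" using Cons.prems(2,3) s by simp
  then have "?u = s \<otimes>\<^bsub>W\<^esub> w" using Cons.IH[OF ss _ _ mu m2] s Cons.prems(2) by simp
  then show ?case using s Cons.prems(2) by simp
qed

text \<open>The situation is symmetric in v and w, so v may be taken to be no longer than w.\<close>

lemma bruhat:
  assumes "v \<in> carrier W" "w \<in> carrier W" "x \<in> dcos v" "x \<in> dcos w"
  shows "v = w"
  using assms
proof (induction "weyl.wlen v" "weyl.wlen w" arbitrary: v w rule: linorder_wlog)
  case le
  then show ?case using bruhat_word by (metis weyl.reduced_word)
next
  case sym
  then show ?case by metis
qed

text \<open>The product of BsB and BwB is then the single double coset BswB. By \<open>Q_iff\<close>
  this turns out to be the case in which s w is longer than w; being free of lengths, the condition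
  can serve as the Q of \<open>exchange_system\<close>.\<close>

definition longer :: "'g set \<Rightarrow> 'g set \<Rightarrow> bool"
  where "longer s w \<longleftrightarrow> (\<forall>n \<in> s. \<forall>b \<in> B. \<forall>m \<in> w. n \<otimes> b \<otimes> m \<in> dcos (s \<otimes>\<^bsub>W\<^esub> w))"

text \<open>In a finite group a conjugate of B contained in B would be all of B.\<close>

lemma conj_B_not_subset:
  assumes "s \<in> S" "n \<in> s"
  obtains b where "b \<in> B" "n \<otimes> b \<otimes> inv n \<notin> B"
proof -
  have n: "n \<in> carrier G" using S_mem_N[OF assms] by simp
  have eq: "conj_set G n B = (\<lambda>b. n \<otimes> b \<otimes> inv n) ` B"
    by (auto simp: l_coset_def r_coset_def)
  have "inj_on (\<lambda>b. n \<otimes> b \<otimes> inv n) B"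
    using n by (auto simp: inj_on_def)
  then have "card (conj_set G n B) = card B" unfolding eq by (rule card_image)
  moreover have "finite B" using finite_G B_subgroup by (meson finite_subset subgroup.subset)
  ultimately have "\<not> conj_set G n B \<subseteq> B" using conj_neq[OF assms] card_subset_eq by metis
  then show thesis using that unfolding eq by auto
qed

text \<open>Choose n b n^-1 outside B, hence in BnB, and multiply it by a representative m of w. If
  \<open>longer s\<close> held for both w and s w, the product would lie in BswB as well as in
  BwB.\<close>

lemma longer_flip:
  assumes "s \<in> S" "w \<in> carrier W" "longer s w"
  shows "\<not> longer s (s \<otimes>\<^bsub>W\<^esub> w)"
proof
  assume *: "longer s (s \<otimes>\<^bsub>W\<^esub> w)"
  have sW: "s \<in> carrier W" using assms by simp
  obtain n where n: "n \<in> s" using sW by (auto intro: W_nonempty)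
  obtain m where m: "m \<in> w" using assms(2) by (auto intro: W_nonempty)
  have nN: "n \<in> N" and mN: "m \<in> N" using W_mem_N sW n assms(2) m by auto
  have n': "inv n \<in> s" using W_inv_mem[OF sW n] weyl.S_inv[OF assms(1)] by simp
  obtain b where b: "b \<in> B" "n \<otimes> b \<otimes> inv n \<notin> B" using conj_B_not_subset assms n by blast
  have "n \<otimes> b \<otimes> inv n \<in> dcos s"
    using exchange_left[OF assms(1) n sW n' b(1)] b(2) weyl.S_square[OF assms(1)]
    by (simp add: W_one dcos_one)
  then obtain c c' where c: "c \<in> B" "c' \<in> B" "n \<otimes> b \<otimes> inv n = c \<otimes> n \<otimes> c'"
    using dcosE sW n by blast
  have "n \<otimes> c' \<otimes> m \<in> dcos (s \<otimes>\<^bsub>W\<^esub> w)" using assms(3) n m c unfolding longer_def by blast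
  then have "c \<otimes> (n \<otimes> c' \<otimes> m) \<in> dcos (s \<otimes>\<^bsub>W\<^esub> w)"
    using dcos_mult(1)[OF _ _ c(1)] sW assms(2) by simp
  also have "c \<otimes> (n \<otimes> c' \<otimes> m) = (c \<otimes> n \<otimes> c') \<otimes> m" using c(1,2) nN mN by (simp add: m_assoc)
  also have "\<dots> = n \<otimes> b \<otimes> (inv n \<otimes> m)" unfolding c(3)[symmetric] using b nN mN by (simp add: m_assoc)
  finally have "n \<otimes> b \<otimes> (inv n \<otimes> m) \<in> dcos (s \<otimes>\<^bsub>W\<^esub> w)" .
  moreover have "n \<otimes> b \<otimes> (inv n \<otimes> m) \<in> dcos (s \<otimes>\<^bsub>W\<^esub> (s \<otimes>\<^bsub>W\<^esub> w))"
    using * n b W_mult_mem[OF n' m] unfolding longer_def by blast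
  ultimately have "s \<otimes>\<^bsub>W\<^esub> w = w" using bruhat[of "s \<otimes>\<^bsub>W\<^esub> w" w] assms(1,2) sW by simp
  then show False using S_involution[OF assms(1)] sW assms(2) weyl.r_cancel_one by blast
qed

text \<open>For the commutation property, a product n b m that violates \<open>longer s\<close> for
  w t lies in BwtB by exchange on the left. By \<open>longer s w\<close> and exchange on the right
  it lies in BswB, so disjointness gives s w = w t.\<close>

sublocale weyl: exchange_system W S longer
proof
  fix s assume s: "s \<in> S"
  show "longer s \<one>\<^bsub>W\<^esub>"
    unfolding longer_def
  proof (intro ballI)
    fix n b m assume "n \<in> s" "b \<in> B" "m \<in> \<one>\<^bsub>W\<^esub>"
    then have n: "n \<in> s" "b \<in> B" and m: "m \<in> T" by (auto simp: W_one)
    then have "\<one> \<otimes> n \<otimes> (b \<otimes> m) \<in> dcos s"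
      by (intro dcosI) auto
    then show "n \<otimes> b \<otimes> m \<in> dcos (s \<otimes>\<^bsub>W\<^esub> \<one>\<^bsub>W\<^esub>)"
      using s n m S_mem_N[OF s n(1)] by (simp add: m_assoc)
  qed
next
  fix s w assume "s \<in> S" "w \<in> carrier W" "longer s w"
  then show "\<not> longer s (s \<otimes>\<^bsub>W\<^esub> w)" by (rule longer_flip)
next
  fix s t w assume s: "s \<in> S" and t: "t \<in> S" and w: "w \<in> carrier W"
    and q: "longer s w" and nq: "\<not> longer s (w \<otimes>\<^bsub>W\<^esub> t)"
  have sw: "s \<otimes>\<^bsub>W\<^esub> w \<in> carrier W" and wt: "w \<otimes>\<^bsub>W\<^esub> t \<in> carrier W" using s t w by auto
  obtain n b m where n: "n \<in> s" "b \<in> B" "m \<in> w \<otimes>\<^bsub>W\<^esub> t"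
    "n \<otimes> b \<otimes> m \<notin> dcos (s \<otimes>\<^bsub>W\<^esub> (w \<otimes>\<^bsub>W\<^esub> t))"
    using nq unfolding longer_def by blast
  then have in1: "n \<otimes> b \<otimes> m \<in> dcos (w \<otimes>\<^bsub>W\<^esub> t)" using exchange_left[OF s n(1) wt n(3,2)] by blast
  obtain m1 m2 where m: "m1 \<in> w" "m2 \<in> t" "m = m1 \<otimes> m2" using n(3) by (rule W_mult_memE)
  have c: "n \<in> carrier G" "m1 \<in> carrier G" "m2 \<in> carrier G"
    using W_mem_N[OF _ n(1)] W_mem_N[OF _ m(1)] W_mem_N[OF _ m(2)] s t w by auto
  have "n \<otimes> b \<otimes> m1 \<in> dcos (s \<otimes>\<^bsub>W\<^esub> w)" using q n m unfolding longer_def by blast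
  then obtain d l d' where d: "d \<in> B" "l \<in> s \<otimes>\<^bsub>W\<^esub> w" "d' \<in> B" "n \<otimes> b \<otimes> m1 = d \<otimes> l \<otimes> d'"
    unfolding dcos_def by blast
  have l: "l \<in> carrier G" using W_mem_N[OF sw d(2)] by simp
  have "n \<otimes> b \<otimes> m = d \<otimes> l \<otimes> d' \<otimes> m2"
    unfolding d(4)[symmetric] using c n m by (simp add: m_assoc)
  also have "\<dots> = d \<otimes> (l \<otimes> d' \<otimes> m2)" using c l d by (simp add: m_assoc)
  also have "\<dots> \<in> dcos (s \<otimes>\<^bsub>W\<^esub> w) \<union> dcos (s \<otimes>\<^bsub>W\<^esub> w \<otimes>\<^bsub>W\<^esub> t)"
    using exchange_right[OF t m(2) sw d(2,3)] dcos_mult(1)[OF _ _ d(1)] sw t by auto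
  finally have "n \<otimes> b \<otimes> m \<in> dcos (s \<otimes>\<^bsub>W\<^esub> w)"
    using n(4) s t w by (simp add: weyl.m_assoc)
  then show "s \<otimes>\<^bsub>W\<^esub> w = w \<otimes>\<^bsub>W\<^esub> t" using in1 bruhat sw wt by blast
qed

lemma len_eq_wlen: "len = weyl.wlen"
  by (simp add: fun_eq_iff len_def weyl.wlen_def word_def weyl.wprod_def)

lemma finite_W: "finite (carrier W)"
proof -
  have "finite N" using finite_G N_subgroup by (meson finite_subset subgroup.subset)
  then show ?thesis by (auto simp: FactGroup_def RCOSETS_def)
qed

text \<open>\<open>longest\<close> is given by ARG_MAX and is meaningful because finiteness of W
  bounds the lengths.\<close>

lemma longest_closed: "longest \<in> carrier W"
  and longest_max: "w \<in> carrier W \<Longrightarrow> weyl.wlen w \<le> weyl.wlen longest"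
proof -
  obtain b where "\<forall>w \<in> carrier W. weyl.wlen w \<le> b"
    using finite_nat_set_iff_bounded_le[of "weyl.wlen ` carrier W"] finite_W by auto
  then have "\<forall>w. w \<in> carrier W \<longrightarrow> weyl.wlen w < Suc b" by auto
  then have "arg_max weyl.wlen (\<lambda>w. w \<in> carrier W) \<in> carrier W \<and>
    (\<forall>w. w \<in> carrier W \<longrightarrow> weyl.wlen w \<le> weyl.wlen (arg_max weyl.wlen (\<lambda>w. w \<in> carrier W)))"
    by (intro arg_max_nat_lemma[of "\<lambda>w. w \<in> carrier W" "\<one>\<^bsub>W\<^esub>"]) auto
  then show "longest \<in> carrier W" "w \<in> carrier W \<Longrightarrow> weyl.wlen w \<le> weyl.wlen longest"
    by (simp_all add: longest_def len_eq_wlen)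
qed

end

section \<open>Conjugation and orders of elements in a group\<close>

context group
begin

text \<open>Conjugation as a right action: \<open>cj n b \<in> B\<close> says that b lies in n B
  n^-1, and successive conjugations compose in reading order.\<close>

definition cj :: "'a \<Rightarrow> 'a \<Rightarrow> 'a"
  where "cj g x = inv g \<otimes> x \<otimes> g"

lemma cj_closed [simp]: "\<lbrakk>g \<in> carrier G; x \<in> carrier G\<rbrakk> \<Longrightarrow> cj g x \<in> carrier G"
  by (simp add: cj_def)

lemma cj_mult: "\<lbrakk>g \<in> carrier G; x \<in> carrier G; y \<in> carrier G\<rbrakk> \<Longrightarrow> cj g (x \<otimes> y) = cj g x \<otimes> cj g y"
  by (simp add: cj_def m_assoc) (simp flip: m_assoc)

lemma cj_inv: "\<lbrakk>g \<in> carrier G; x \<in> carrier G\<rbrakk> \<Longrightarrow> cj g (inv x) = inv (cj g x)"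
  by (simp add: cj_def inv_mult_group m_assoc)

lemma cj_cj: "\<lbrakk>g \<in> carrier G; h \<in> carrier G; x \<in> carrier G\<rbrakk> \<Longrightarrow> cj h (cj g x) = cj (g \<otimes> h) x"
  by (simp add: cj_def inv_mult_group m_assoc)

lemma cj_by_one [simp]: "x \<in> carrier G \<Longrightarrow> cj \<one> x = x"
  by (simp add: cj_def)

lemma cj_one [simp]: "g \<in> carrier G \<Longrightarrow> cj g \<one> = \<one>"
  by (simp add: cj_def)

lemma cj_pow: "\<lbrakk>g \<in> carrier G; x \<in> carrier G\<rbrakk> \<Longrightarrow> cj g (x [^] (n::nat)) = cj g x [^] n"
  by (induction n) (auto simp: cj_mult)

lemma cj_eq_one: "\<lbrakk>g \<in> carrier G; x \<in> carrier G; cj g x = \<one>\<rbrakk> \<Longrightarrow> x = \<one>"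
  by (metis cj_cj cj_by_one cj_one inv_closed r_inv)

lemma subgroup_pow_card:
  assumes "subgroup A G" "x \<in> A"
  shows "x [^] card A = \<one>"
proof -
  interpret A: group "G\<lparr>carrier := A\<rparr>" using assms(1) by (rule subgroup_imp_group)
  have "x [^]\<^bsub>G\<lparr>carrier := A\<rparr>\<^esub> card A = \<one>"
    using A.pow_order_eq_1[of x] assms(2) by (simp add: order_def)
  then show ?thesis by (simp flip: nat_pow_consistent)
qed

lemma coprime_pow_eq_one:
  assumes "x \<in> carrier G" "x [^] (m::nat) = \<one>" "x [^] (n::nat) = \<one>" "coprime m n"
  shows "x = \<one>"
proof -
  have "ord x dvd m" "ord x dvd n" using assms pow_eq_id by auto
  then have "ord x = 1" using assms(4) coprime_common_divisor_nat by blast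
  then show ?thesis using assms(1) ord_eq_1 by blast
qed

lemma conj_set_eq: "conj_set G n A = (\<lambda>a. n \<otimes> a \<otimes> inv n) ` A"
  by (auto simp: l_coset_def r_coset_def)

lemma mem_conj_set_cj:
  assumes "n \<in> carrier G" "x \<in> carrier G" "cj n x \<in> A"
  shows "x \<in> conj_set G n A"
proof -
  have "x = n \<otimes> cj n x \<otimes> inv n" using assms by (simp add: cj_def m_assoc) (simp flip: m_assoc)
  then show ?thesis unfolding conj_set_eq using assms(3) by blast
qed

lemma conj_subgroup:
  assumes "n \<in> carrier G" "subgroup A G"
  shows "subgroup (conj_set G n A) G"
proof (rule subgroupI)
  interpret A: subgroup A G by fact
  show "conj_set G n A \<subseteq> carrier G" using assms(1) by (auto simp: conj_set_eq)
  show "conj_set G n A \<noteq> {}" using A.one_closed unfolding conj_set_eq by blast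
  fix x y assume x: "x \<in> conj_set G n A" and y: "y \<in> conj_set G n A"
  obtain a where a: "a \<in> A" "x = n \<otimes> a \<otimes> inv n" using x by (auto simp: conj_set_eq)
  obtain b where b: "b \<in> A" "y = n \<otimes> b \<otimes> inv n" using y by (auto simp: conj_set_eq)
  have "inv x = n \<otimes> inv a \<otimes> inv n" using a assms(1) by (simp add: inv_mult_group m_assoc)
  then show "inv x \<in> conj_set G n A" using a by (auto simp: conj_set_eq)
  have "x \<otimes> y = n \<otimes> (a \<otimes> b) \<otimes> inv n"
    using a b assms(1) by (simp add: m_assoc) (simp flip: m_assoc)
  then show "x \<otimes> y \<in> conj_set G n A" using a b by (auto simp: conj_set_eq)
qed

end

section \<open>Intersections of B with its conjugates\<close>

context BN_pair
begin

lemma longer_right: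
  assumes "s \<in> S" "n \<in> s" "w \<in> carrier W" "m \<in> w" "b \<in> B" "longer s (inv\<^bsub>W\<^esub> w)"
  shows "m \<otimes> b \<otimes> n \<in> dcos (w \<otimes>\<^bsub>W\<^esub> s)"
proof -
  have n: "n \<in> carrier G" and m: "m \<in> carrier G"
    using S_mem_N[OF assms(1,2)] W_mem_N[OF assms(3,4)] by auto
  have s: "s \<in> carrier W" using assms by simp
  have "inv n \<otimes> inv b \<otimes> inv m \<in> dcos (s \<otimes>\<^bsub>W\<^esub> inv\<^bsub>W\<^esub> w)"
    using assms(6) W_inv_mem[OF s assms(2)] W_inv_mem[OF assms(3,4)] assms(1,5) weyl.S_inv
    unfolding longer_def by simp
  then have "inv (inv n \<otimes> inv b \<otimes> inv m) \<in> dcos (inv\<^bsub>W\<^esub> (s \<otimes>\<^bsub>W\<^esub> inv\<^bsub>W\<^esub> w))"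
    using s assms(3) by (intro dcos_inv) auto
  moreover have "inv (inv n \<otimes> inv b \<otimes> inv m) = m \<otimes> b \<otimes> n"
    using n m assms(5) by (simp add: inv_mult_group m_assoc)
  moreover have "inv\<^bsub>W\<^esub> (s \<otimes>\<^bsub>W\<^esub> inv\<^bsub>W\<^esub> w) = w \<otimes>\<^bsub>W\<^esub> s"
    using assms(1,3) by (simp add: weyl.inv_mult_group weyl.S_inv)
  ultimately show ?thesis by simp
qed

lemma W_mult_neq: "s \<in> S \<Longrightarrow> w \<in> carrier W \<Longrightarrow> s \<otimes>\<^bsub>W\<^esub> w \<noteq> w"
  using S_involution[of s] weyl.r_cancel_one[of w s] by auto

lemma S_inv_mem: "s \<in> S \<Longrightarrow> n \<in> s \<Longrightarrow> inv n \<in> s"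
  using W_inv_mem[of s n] weyl.S_inv by simp

lemma S_conj_dcos:
  assumes "s \<in> S" "n \<in> s" "m \<in> s" "b \<in> B"
  shows "n \<otimes> b \<otimes> m \<in> dcos s \<union> B"
  using exchange_left[of s n s m b] assms weyl.S_square by (simp add: W_one dcos_one)

text \<open>The letters of the word are stripped off one at a time. With \<open>?x\<close> the
  product that remains after s, were r^-1 b r outside B, it would lie in BrB, and r^-1 b r m' would
  lie in BsxB because s lengthens \<open>?x\<close>. But it equals m' (m^-1 b m), which lies in BxB.
  In short: if lengths add up in y v, then B \<inter> (yv)B(yv)^-1 lies in yBy^-1.\<close>

lemma cj_in_B_chain:
  assumes "ss \<in> lists S" "v \<in> carrier W"
    "weyl.wlen (weyl.wprod ss \<otimes>\<^bsub>W\<^esub> v) = length ss + weyl.wlen v"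
    "m \<in> weyl.wprod ss \<otimes>\<^bsub>W\<^esub> v" "n \<in> weyl.wprod ss" "b \<in> B" "cj m b \<in> B"
  shows "cj n b \<in> B"
  using assms(1,3-)
proof (induction ss arbitrary: n m b rule: list.induct)
  case Nil
  then show ?case by (simp add: W_one cj_def)
next
  case (Cons s ss)
  let ?x = "weyl.wprod ss \<otimes>\<^bsub>W\<^esub> v"
  have s: "s \<in> S" and ss: "ss \<in> lists S" using Cons.prems by auto
  have xW: "?x \<in> carrier W" using ss assms(2) by simp
  have sx: "weyl.wprod (s # ss) \<otimes>\<^bsub>W\<^esub> v = s \<otimes>\<^bsub>W\<^esub> ?x" using s ss assms(2) by (simp add: weyl.m_assoc)
  obtain r n' where n: "r \<in> s" "n' \<in> weyl.wprod ss" "n = r \<otimes> n'"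
    using Cons.prems by (auto elim: W_mult_memE)
  have m: "m \<in> s \<otimes>\<^bsub>W\<^esub> ?x" using Cons.prems(3) sx by simp
  define m' where "m' = inv r \<otimes> m"
  have "m' \<in> s \<otimes>\<^bsub>W\<^esub> (s \<otimes>\<^bsub>W\<^esub> ?x)"
    unfolding m'_def using W_mult_mem[OF S_inv_mem[OF s n(1)] m] .
  then have m': "m' \<in> ?x" using s xW by simp
  have r: "r \<in> carrier G" using S_mem_N[OF s n(1)] by simp
  have n'c: "n' \<in> carrier G" using W_mem_N[OF _ n(2)] ss by simp
  have m'c: "m' \<in> carrier G" using W_mem_N[OF xW m'] by simp
  have mc: "m \<in> carrier G" using W_mem_N[OF _ m] s xW by simp
  have m_eq: "m = r \<otimes> m'" using r mc by (simp add: m'_def flip: m_assoc)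
  have b: "b \<in> carrier G" using Cons.prems by simp
  \<comment> \<open>Additivity of lengths passes to the tail, and s lengthens the remaining
    product.\<close>
  have le: "weyl.wlen ?x \<le> length ss + weyl.wlen v"
    using weyl.wlen_mult_le[of "weyl.wprod ss" v] weyl.wlen_le[OF ss] ss assms(2) by simp
  have len: "weyl.wlen (s \<otimes>\<^bsub>W\<^esub> ?x) = Suc (length ss + weyl.wlen v)"
    using Cons.prems(2) sx by simp
  have "longer s ?x" using weyl.Q_iff[OF s xW] le len by simp
  with weyl.wlen_Q[OF s xW] len have len': "weyl.wlen ?x = length ss + weyl.wlen v" by simp
  have cm': "cj r b \<otimes> m' = m' \<otimes> cj m b"
    using r m'c b by (simp add: m_eq cj_def inv_mult_group m_assoc) (simp flip: m_assoc)
  have "cj r b \<in> B"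
  proof (rule ccontr)
    assume "cj r b \<notin> B"
    then have "cj r b \<in> dcos s"
      using S_conj_dcos[OF s S_inv_mem[OF s n(1)] n(1)] Cons.prems by (auto simp: cj_def)
    then obtain d d' where d: "d \<in> B" "d' \<in> B" "cj r b = d \<otimes> r \<otimes> d'"
      using dcosE s n(1) S_mem_W by metis
    have "r \<otimes> d' \<otimes> m' \<in> dcos (s \<otimes>\<^bsub>W\<^esub> ?x)"
      using \<open>longer s ?x\<close> n(1) d m' unfolding longer_def by blast
    then have "d \<otimes> (r \<otimes> d' \<otimes> m') \<in> dcos (s \<otimes>\<^bsub>W\<^esub> ?x)"
      using dcos_mult(1)[OF _ _ d(1)] s xW by simp
    also have "d \<otimes> (r \<otimes> d' \<otimes> m') = cj r b \<otimes> m'" using d r m'c by (simp add: m_assoc)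
    finally have "m' \<otimes> cj m b \<in> dcos (s \<otimes>\<^bsub>W\<^esub> ?x)" by (simp add: cm')
    moreover have "m' \<otimes> cj m b \<in> dcos ?x"
      using dcos_mult(2)[OF mem_dcos[OF xW m'] xW] Cons.prems by blast
    ultimately show False using bruhat[of "s \<otimes>\<^bsub>W\<^esub> ?x" ?x] W_mult_neq[OF s xW] s xW by simp
  qed
  moreover have "cj m' (cj r b) \<in> B" using Cons.prems(6) r m'c b m_eq by (simp add: cj_cj)
  ultimately have "cj n' (cj r b) \<in> B" using Cons.IH[OF ss len' m' n(2)] by blast
  then show ?case using r n'c b n(3) by (simp add: cj_cj)
qed

text \<open>Every w begins a reduced word of w0, so the preceding lemma applies with v = w^-1
  w0.\<close>

lemma cj_longest_in_B:
  assumes "m \<in> longest" "b \<in> B" "cj m b \<in> B" "n \<in> N"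
  shows "cj n b \<in> B"
proof -
  let ?w = "T #> n"
  have w: "?w \<in> carrier W" using assms(4) by (auto simp: FactGroup_def RCOSETS_def r_coset_def)
  have n: "n \<in> ?w" using rcos_self[OF _ T_subgroup] assms(4) by simp
  obtain ss where ss: "ss \<in> lists S" "weyl.wprod ss = ?w" "length ss = weyl.wlen ?w"
    using w by (rule weyl.reduced_word)
  have eq: "?w \<otimes>\<^bsub>W\<^esub> (inv\<^bsub>W\<^esub> ?w \<otimes>\<^bsub>W\<^esub> longest) = longest"
    using w longest_closed by (simp flip: weyl.m_assoc)
  show ?thesis
    using cj_in_B_chain[of ss "inv\<^bsub>W\<^esub> ?w \<otimes>\<^bsub>W\<^esub> longest" m n b]
      weyl.wlen_longest[OF longest_closed longest_max w] ss eq w n longest_closed assms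
    by simp
qed

text \<open>By maximality s w0 is shorter than w0, so passing from s w0 back to w0
  lengthens.\<close>

lemma longer_S_longest: "s \<in> S \<Longrightarrow> longer s (s \<otimes>\<^bsub>W\<^esub> longest)"
  using weyl.Q_iff[of s "s \<otimes>\<^bsub>W\<^esub> longest"] longest_closed longest_max[of "s \<otimes>\<^bsub>W\<^esub> longest"]
    W_mult_neq[of s longest] weyl.Q_iff[of s longest] weyl.wlen_not_Q[of s longest]
  by fastforce

text \<open>Since s lengthens s w0, n^-1 b m with m = n n0 has the form c n0 d with c and d in B.
  Solving for b gives b = (n c n^-1)(m d m^-1), so these are the two factors; what remains is that
  the first lies in B.\<close>

lemma B_factorization:
  assumes "s \<in> S" "n \<in> s" "n\<^sub>0 \<in> longest" "b \<in> B"
  obtains b\<^sub>1 b\<^sub>2 where "b\<^sub>1 \<in> B" "b\<^sub>2 \<in> B" "b = b\<^sub>1 \<otimes> b\<^sub>2" "cj n b\<^sub>1 \<in> B" "cj (n \<otimes> n\<^sub>0) b\<^sub>2 \<in> B"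
proof -
  define m where "m = n \<otimes> n\<^sub>0"
  let ?sw = "s \<otimes>\<^bsub>W\<^esub> longest"
  have s: "s \<in> carrier W" using assms by simp
  have sw: "?sw \<in> carrier W" using s longest_closed by simp
  have m: "m \<in> ?sw" unfolding m_def using W_mult_mem assms by blast
  have n: "n \<in> carrier G" and n0: "n\<^sub>0 \<in> carrier G"
    using S_mem_N[OF assms(1,2)] W_mem_N[OF longest_closed assms(3)] by auto
  have mc: "m \<in> carrier G" unfolding m_def using n n0 by simp
  have "inv n \<otimes> b \<otimes> m \<in> dcos (s \<otimes>\<^bsub>W\<^esub> ?sw)"
    using longer_S_longest[OF assms(1)] S_inv_mem[OF assms(1,2)] assms(4) m
    unfolding longer_def by blast
  then have "inv n \<otimes> b \<otimes> m \<in> dcos longest" using assms(1) longest_closed by simp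
  then obtain c d where c: "c \<in> B" "d \<in> B" "inv n \<otimes> b \<otimes> m = c \<otimes> n\<^sub>0 \<otimes> d"
    using dcosE[OF _ longest_closed assms(3)] by blast
  define b1 where "b1 = n \<otimes> c \<otimes> inv n"
  define b2 where "b2 = m \<otimes> d \<otimes> inv m"
  have "b1 \<otimes> b2 = n \<otimes> (c \<otimes> n\<^sub>0 \<otimes> d) \<otimes> inv m"
    unfolding b1_def b2_def m_def using n n0 c(1,2)
    by (simp add: m_assoc inv_mult_group) (simp flip: m_assoc)
  also have "\<dots> = b"
    unfolding c(3)[symmetric] using n mc assms(4) by (simp add: m_assoc) (simp flip: m_assoc)
  finally have b_eq: "b = b1 \<otimes> b2" by simp
  have cj1: "cj n b1 = c" unfolding b1_def cj_def using n c
    by (simp add: m_assoc) (simp flip: m_assoc)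
  have cj2: "cj m b2 = d" unfolding b2_def cj_def using mc c
    by (simp add: m_assoc) (simp flip: m_assoc)
  have b1c: "b1 \<in> carrier G" and b2c: "b2 \<in> carrier G"
    unfolding b1_def b2_def using n mc c by auto
  \<comment> \<open>Otherwise b1^-1 lies in BsB, so that b1^-1 b m lies in Bw0B; but b1^-1 b m = m d
    lies in Bsw0B.\<close>
  have b1B: "b1 \<in> B"
  proof (rule ccontr)
    assume "b1 \<notin> B"
    then have "b1 \<in> dcos s"
      using S_conj_dcos[OF assms(1,2) S_inv_mem[OF assms(1,2)] c(1)] by (auto simp: b1_def)
    then have "inv b1 \<in> dcos s" using dcos_inv[OF _ s] weyl.S_inv[OF assms(1)] by simp
    then obtain e e' where e: "e \<in> B" "e' \<in> B" "inv b1 = e \<otimes> n \<otimes> e'"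
      using dcosE[OF _ s assms(2)] by blast
    have "n \<otimes> (e' \<otimes> b) \<otimes> m \<in> dcos (s \<otimes>\<^bsub>W\<^esub> ?sw)"
      using longer_S_longest[OF assms(1)] assms(2,4) e m unfolding longer_def by simp
    then have "e \<otimes> (n \<otimes> (e' \<otimes> b) \<otimes> m) \<in> dcos longest"
      using dcos_mult(1)[OF _ longest_closed e(1)] assms(1) longest_closed by simp
    also have "e \<otimes> (n \<otimes> (e' \<otimes> b) \<otimes> m) = inv b1 \<otimes> b \<otimes> m"
      unfolding e(3) using e(1,2) n mc assms(4) by (simp add: m_assoc)
    also have "\<dots> = m \<otimes> d"
      unfolding b_eq using b1c b2c mc c by (simp add: b2_def m_assoc flip: m_assoc[of "inv b1"])
    finally have "m \<otimes> d \<in> dcos longest" .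
    moreover have "m \<otimes> d \<in> dcos ?sw" using dcos_mult(2)[OF mem_dcos[OF sw m] sw c(2)] .
    ultimately show False
      using bruhat[OF sw longest_closed] W_mult_neq[OF assms(1) longest_closed] by blast
  qed
  have "b2 = inv b1 \<otimes> b" unfolding b_eq using b1c b2c by (simp flip: m_assoc)
  then have "b2 \<in> B" using b1B assms(4) by simp
  then show thesis using that[OF b1B _ b_eq] cj1 cj2 c m_def by simp
qed

end

section \<open>Root subgroups in Levi subgroups\<close>

context split_BN_pair
begin

lemma U_subset: "U \<subseteq> B"
  using normal_imp_subgroup[OF U_normal] subgroup.subset by fastforce

lemma U_subgroup: "subgroup U G"
  using incl_subgroup[OF B_subgroup normal_imp_subgroup[OF U_normal]] .

lemma U_mem_B: "u \<in> U \<Longrightarrow> u \<in> B"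
  using U_subset by blast

lemma U_carrier [simp]: "u \<in> U \<Longrightarrow> u \<in> carrier G"
  using U_mem_B by simp

lemma U_closed [simp]:
  "\<lbrakk>x \<in> U; y \<in> U\<rbrakk> \<Longrightarrow> x \<otimes> y \<in> U" "x \<in> U \<Longrightarrow> inv x \<in> U" "\<one> \<in> U"
  using U_subgroup by (auto simp: subgroup.m_closed subgroup.m_inv_closed subgroup.one_closed)

lemma U_cj: "b \<in> B \<Longrightarrow> u \<in> U \<Longrightarrow> cj b u \<in> U"
  using normal.inv_op_closed1[OF U_normal, of b u] m_inv_consistent[OF B_subgroup]
  by (simp add: cj_def)

lemma T_cj: "n \<in> N \<Longrightarrow> t \<in> T \<Longrightarrow> cj n t \<in> T"
  using T_conj(2) by (simp add: cj_def)

lemma coprime_card: "coprime (card U) (card T)"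
proof -
  obtain a where "card U = p ^ a" using U_p_group by blast
  moreover have "coprime p (card T)" using prime_p H_p'_group prime_imp_coprime by blast
  ultimately show ?thesis by simp
qed

lemma U_inter_T: "x \<in> U \<Longrightarrow> x \<in> T \<Longrightarrow> x = \<one>"
  using coprime_pow_eq_one[OF _ _ _ coprime_card] subgroup_pow_card U_subgroup T_subgroup U_carrier
  by blast

lemma B_split:
  assumes "b \<in> B"
  obtains u t where "u \<in> U" "t \<in> T" "b = u \<otimes> t"
proof -
  have "b \<in> U <#> T" using assms B_decomp by blast
  then show thesis using that by (auto simp: set_mult_def)
qed

lemma pow_mod_U:
  assumes "u \<in> U" "t \<in> T"
  shows "\<exists>v \<in> U. (u \<otimes> t) [^] (i::nat) = v \<otimes> t [^] i"
proof (induction i)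
  case 0
  show ?case by (intro bexI[of _ \<one>]) auto
next
  case (Suc i)
  then obtain v where v: "v \<in> U" "(u \<otimes> t) [^] i = v \<otimes> t [^] i" by blast
  let ?h = "t [^] i"
  have h: "?h \<in> B" using assms(2) T_subgroup B_subgroup by (induction i) auto
  then have hc: "?h \<in> carrier G" by simp
  have "cj (inv ?h) u \<in> U" using U_cj h assms(1) by simp
  moreover have "(u \<otimes> t) [^] Suc i = (v \<otimes> cj (inv ?h) u) \<otimes> t [^] Suc i"
    using v assms hc by (simp add: cj_def m_assoc) (simp flip: m_assoc)
  ultimately show ?case using v(1) by (intro bexI[of _ "v \<otimes> cj (inv ?h) u"]) auto
qed

text \<open>\<open>x\<close> is a \<open>p\<close>-element, and \<open>B / U\<close> is a \<open>p'\<close>-group.\<close>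

lemma conj_U_in_B:
  assumes "x \<in> B" "g \<in> carrier G" "cj g x \<in> U"
  shows "x \<in> U"
proof -
  have x: "x \<in> carrier G" using assms(1) by simp
  have "cj g (x [^] card U) = \<one>"
    using cj_pow[OF assms(2) x] subgroup_pow_card[OF U_subgroup assms(3)] by simp
  then have pow: "x [^] card U = \<one>" using cj_eq_one[OF assms(2)] x by simp
  obtain u t where ut: "u \<in> U" "t \<in> T" "x = u \<otimes> t" using assms(1) by (rule B_split)
  then obtain v where v: "v \<in> U" "v \<otimes> t [^] card U = \<one>"
    using pow_mod_U[OF ut(1,2), of "card U"] pow by auto
  have tc: "t \<in> carrier G" using ut by simp
  have "inv v = t [^] card U" using v tc
    by (metis U_carrier inv_unique' nat_pow_closed inv_equality inv_comm)
  moreover have "t [^] (i::nat) \<in> T" for i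
    using ut(2) subgroup.one_closed[OF T_subgroup] subgroup.m_closed[OF T_subgroup]
    by (induction i) auto
  \<comment> \<open>This power lies in T and, being v^-1, also in U.\<close>
  ultimately have "t [^] card U = \<one>" using U_inter_T v(1) U_closed(2) by metis
  moreover have "t [^] card T = \<one>" using subgroup_pow_card[OF T_subgroup] ut by blast
  ultimately have "t = \<one>" using coprime_pow_eq_one[OF tc _ _ coprime_card] by blast
  then show ?thesis using ut by simp
qed

text \<open>N normalizes T, so after splitting off t the other factor still goes into B under
  conjugation by m; being conjugate to an element of U, it then lies in U by
  \<open>conj_U_in_B\<close>.\<close>

lemma B_split_cj:
  assumes "b \<in> B" "m \<in> N" "cj m b \<in> B"
  obtains u t where "u \<in> U" "t \<in> T" "b = u \<otimes> t" "cj m u \<in> U"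
proof -
  obtain u t where ut: "u \<in> U" "t \<in> T" "b = u \<otimes> t" using assms(1) by (rule B_split)
  have "u = b \<otimes> inv t" using ut by (simp add: m_assoc)
  then have "cj m u = cj m b \<otimes> inv (cj m t)" using assms ut by (simp add: cj_mult m_assoc)
  then have "cj m u \<in> B" using assms T_cj ut by simp
  moreover have "cj (inv m) (cj m u) \<in> U" using ut assms(2) by (simp add: cj_cj)
  ultimately have "cj m u \<in> U" using conj_U_in_B[of "cj m u" "inv m"] assms(2) by simp
  then show thesis using that ut by blast
qed

text \<open>Membership in B after conjugation by w0 forces it for every n in N, and saturation says
  that all these conjugates of B meet in T.\<close>

lemma cj_longest_in_T:
  assumes "m \<in> longest" "b \<in> B" "cj m b \<in> B"
  shows "b \<in> T"
proof -
  have "b \<in> (\<Inter>n \<in> N. conj_set G n B)"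
    using cj_longest_in_B[OF assms] mem_conj_set_cj assms(2) by auto
  then show ?thesis using saturated by simp
qed

lemma coset_conj_subset:
  assumes "w \<in> carrier W" "A \<subseteq> carrier G"
  shows "coset_conj w A \<subseteq> carrier G"
  using W_mem_N[OF assms(1)] assms(2) by (auto simp: coset_conj_def conj_set_eq)

text \<open>Representatives of a coset differ by elements of T, which normalize U, so a single m
  decides membership.\<close>

lemma mem_simple_root_subgroup:
  assumes "s \<in> S" "m \<in> s \<otimes>\<^bsub>W\<^esub> longest"
  shows "x \<in> simple_root_subgroup s \<longleftrightarrow> x \<in> U \<and> cj m x \<in> U"
proof
  have w: "s \<otimes>\<^bsub>W\<^esub> longest \<in> carrier W" using assms(1) longest_closed by simp
  have m: "m \<in> N" using W_mem_N[OF w assms(2)] .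
  show "x \<in> U \<and> cj m x \<in> U \<Longrightarrow> x \<in> simple_root_subgroup s"
    using mem_conj_set_cj[of m x U] m assms(2)
    by (auto simp: simple_root_subgroup_def coset_conj_def)
  assume x: "x \<in> simple_root_subgroup s"
  then obtain l u where l: "l \<in> s \<otimes>\<^bsub>W\<^esub> longest" "u \<in> U" "x = l \<otimes> u \<otimes> inv l"
    by (auto simp: simple_root_subgroup_def coset_conj_def conj_set_eq)
  obtain t where t: "t \<in> T" "l = m \<otimes> t" using W_same_coset[OF w assms(2) l(1)] by blast
  have "cj m x = cj (inv t) u"
    unfolding l(3) t(2) cj_def using m t l(2)
    by (simp add: inv_mult_group m_assoc) (simp flip: m_assoc)
  then have "cj m x \<in> U" using U_cj t l(2) by simp
  then show "x \<in> U \<and> cj m x \<in> U" using x by (simp add: simple_root_subgroup_def)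
qed

text \<open>
  With \<open>X = simple_root_subgroup s\<close> and \<open>1 \<noteq> x \<in> X\<close>, the element \<open>n x n\<^sup>-\<^sup>1\<close> lies in \<open>B n B\<close>, and
  decomposing the two factors from \<open>B\<close> gives \<open>n x n\<^sup>-\<^sup>1 \<in> X T u n T X T\<close> with
  \<open>u \<in> U \<inter> \<^sup>nU\<close>. Conjugating by the longest element shows that \<open>u = 1\<close>.
\<close>

lemma S_meets_rank_one:
  assumes s: "s \<in> S"
  shows "\<exists>r \<in> s. r \<in> generate G
    (T \<union> simple_root_subgroup s \<union> coset_conj s (simple_root_subgroup s))"
proof -
  let ?X = "simple_root_subgroup s"
  let ?K = "generate G (T \<union> ?X \<union> coset_conj s ?X)"
  obtain n where n: "n \<in> s" using s by (auto intro: W_nonempty[OF S_mem_W])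
  obtain n0 where n0: "n0 \<in> longest" using longest_closed by (auto intro: W_nonempty)
  define m where "m = n \<otimes> n0"
  have m: "m \<in> s \<otimes>\<^bsub>W\<^esub> longest" unfolding m_def using W_mult_mem n n0 .
  have sW: "s \<in> carrier W" using s by simp
  have swW: "s \<otimes>\<^bsub>W\<^esub> longest \<in> carrier W" using sW longest_closed by simp
  have nN: "n \<in> N" using S_mem_N s n .
  have n0N: "n0 \<in> N" using W_mem_N longest_closed n0 .
  have mN: "m \<in> N" unfolding m_def using nN n0N by simp
  have [simp]: "n \<in> carrier G" "n0 \<in> carrier G" "m \<in> carrier G" using nN n0N mN by auto
  note X_iff = mem_simple_root_subgroup[OF s m]
  have ss_T: "x \<otimes> y \<in> T" if "x \<in> s" "y \<in> s" for x y
    using W_mult_mem[OF that] weyl.S_square[OF s] by (simp add: W_one)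
  \<comment> \<open>Were X trivial, the second factor in \<open>B_factorization\<close> would lie in
    T, and n^-1 b n would lie in B for every b in B, against
    \<open>conj_B_not_subset\<close>.\<close>
  have "\<exists>x \<in> ?X. x \<noteq> \<one>"
  proof (rule ccontr)
    assume "\<not> (\<exists>x \<in> ?X. x \<noteq> \<one>)"
    then have triv: "x = \<one>" if "x \<in> ?X" for x using that by blast
    obtain b where b: "b \<in> B" "inv n \<otimes> b \<otimes> inv (inv n) \<notin> B"
      using conj_B_not_subset[OF s S_inv_mem[OF s n]] by blast
    obtain b1 b2 where bb: "b1 \<in> B" "b2 \<in> B" "b = b1 \<otimes> b2" "cj n b1 \<in> B" "cj m b2 \<in> B"
      using B_factorization[OF s n n0 b(1)] m_def by metis
    obtain u t where ut: "u \<in> U" "t \<in> T" "b2 = u \<otimes> t" "cj m u \<in> U"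
      using B_split_cj[OF bb(2) mN bb(5)] by blast
    then have "u = \<one>" using triv X_iff by blast
    then have "cj n b2 \<in> B" using ut T_cj[OF nN] by simp
    then have "cj n b \<in> B" using bb by (simp add: cj_mult)
    then show False using b(2) by (simp add: cj_def)
  qed
  then obtain x where x: "x \<in> ?X" "x \<noteq> \<one>" by blast
  have xU: "x \<in> U" and xm: "cj m x \<in> U" using x X_iff by auto
  define x' where "x' = n \<otimes> x \<otimes> inv n"
  have x'c: "x' \<in> carrier G" unfolding x'_def using xU by simp
  have x'_cj: "x' = cj (inv n) x" by (simp add: x'_def cj_def)
  have x'K: "x' \<in> coset_conj s ?X" using x(1) n by (auto simp: x'_def coset_conj_def conj_set_eq)
  \<comment> \<open>As n^2 lies in T, n^-1 n0 differs from m = n n0 by a factor from T on the right,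
    and T normalizes U.\<close>
  have x'0: "cj n0 x' \<in> U"
  proof -
    have eq: "m \<otimes> cj n0 (inv n \<otimes> inv n) = inv n \<otimes> n0"
      by (simp add: m_def cj_def m_assoc) (simp flip: m_assoc)
    have "cj n0 (inv n \<otimes> inv n) \<in> T"
      using T_cj[OF n0N ss_T[OF S_inv_mem[OF s n] S_inv_mem[OF s n]]] .
    then have "cj (cj n0 (inv n \<otimes> inv n)) (cj m x) \<in> U" using U_cj xm by blast
    then show ?thesis using xU by (simp add: x'_cj cj_cj eq)
  qed
  \<comment> \<open>Otherwise both x' and its conjugate by n0 would lie in B, so x' would lie in T
    and x in U \<inter> T.\<close>
  have "x' \<notin> B"
  proof
    assume "x' \<in> B"
    then have "x' \<in> T" using cj_longest_in_T[OF n0] x'0 U_mem_B by blast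
    then have "cj n x' \<in> T" by (rule T_cj[OF nN])
    then have "x \<in> T" using xU by (simp add: x'_cj cj_cj)
    then show False using U_inter_T xU x(2) by blast
  qed
  then have "x' \<in> dcos s"
    using S_conj_dcos[OF s n S_inv_mem[OF s n]] xU U_mem_B by (auto simp: x'_def)
  then obtain b b' where b: "b \<in> B" "b' \<in> B" "x' = b \<otimes> n \<otimes> b'" using dcosE[OF _ sW n] by blast
  \<comment> \<open>Factoring b^-1 rather than b puts the factors from B \<inter> nBn^-1 next to n
    on both sides.\<close>
  obtain c1 c2 where c: "c1 \<in> B" "c2 \<in> B" "inv b = c1 \<otimes> c2" "cj n c1 \<in> B" "cj m c2 \<in> B"
    using B_factorization[OF s n n0, of "inv b"] b(1) m_def by (metis BN_closed(2))
  obtain d1 d2 where d: "d1 \<in> B" "d2 \<in> B" "b' = d1 \<otimes> d2" "cj n d1 \<in> B" "cj m d2 \<in> B"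
    using B_factorization[OF s n n0 b(2)] m_def by metis
  have b_eq: "b = inv c2 \<otimes> inv c1"
    using c b by (metis B_carrier inv_inv inv_mult_group)
  obtain x1 h1 where x1: "x1 \<in> U" "h1 \<in> T" "inv c2 = x1 \<otimes> h1" "cj m x1 \<in> U"
    using B_split_cj[of "inv c2" m] c mN by (auto simp: cj_inv)
  obtain u1 k1 where u1: "u1 \<in> U" "k1 \<in> T" "inv c1 = u1 \<otimes> k1" "cj n u1 \<in> U"
    using B_split_cj[of "inv c1" n] c nN by (auto simp: cj_inv)
  obtain u2 h2 where u2: "u2 \<in> U" "h2 \<in> T" "d1 = u2 \<otimes> h2" "cj n u2 \<in> U"
    using B_split_cj[of d1 n] d nN by blast
  obtain x2 k2 where x2: "x2 \<in> U" "k2 \<in> T" "d2 = x2 \<otimes> k2" "cj m x2 \<in> U"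
    using B_split_cj[of d2 m] d mN by blast
  have [simp]: "h1 \<in> carrier G" "k1 \<in> carrier G" "h2 \<in> carrier G" "k2 \<in> carrier G"
    using x1 u1 u2 x2 by auto
  have [simp]: "x1 \<in> carrier G" "u1 \<in> carrier G" "u2 \<in> carrier G" "x2 \<in> carrier G"
    using x1 u1 u2 x2 by auto
  define r where "r = k1 \<otimes> n"
  have r: "r \<in> s" unfolding r_def using T_mult_mem(1)[OF sW n u1(2)] .
  have rN: "r \<in> N" using S_mem_N s r .
  then have [simp]: "r \<in> carrier G" by simp
  \<comment> \<open>Collects on the left of r the parts of b and b' from U \<inter> nUn^-1, the
    second one moved across r.\<close>
  define u where "u = u1 \<otimes> cj (inv r) u2"
  have [simp]: "u \<in> carrier G" unfolding u_def by simp
  have x'_eq: "x' = x1 \<otimes> h1 \<otimes> u \<otimes> r \<otimes> h2 \<otimes> x2 \<otimes> k2"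
  proof -
    have "x' = (x1 \<otimes> h1) \<otimes> (u1 \<otimes> k1) \<otimes> n \<otimes> ((u2 \<otimes> h2) \<otimes> (x2 \<otimes> k2))"
      unfolding b(3) b_eq d(3) x1(3) u1(3) u2(3) x2(3) ..
    also have "\<dots> = x1 \<otimes> h1 \<otimes> u1 \<otimes> r \<otimes> u2 \<otimes> h2 \<otimes> x2 \<otimes> k2"
      by (simp add: r_def m_assoc)
    also have "\<dots> = x1 \<otimes> h1 \<otimes> u \<otimes> r \<otimes> h2 \<otimes> x2 \<otimes> k2"
    proof -
      have "u1 \<otimes> (r \<otimes> (u2 \<otimes> y)) = u \<otimes> (r \<otimes> y)" if "y \<in> carrier G" for y
        unfolding u_def cj_def using that by (simp add: m_assoc) (simp flip: m_assoc)
      then show ?thesis by (simp add: m_assoc)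
    qed
    finally show ?thesis .
  qed
  have uU: "u \<in> U" and unU: "cj n u \<in> U"
  proof -
    have "n \<otimes> cj n k1 = r" by (simp add: cj_def r_def flip: m_assoc)
    then have "cj r u2 = cj (cj n k1) (cj n u2)" by (simp add: cj_cj)
    also have "\<dots> \<in> U" using U_cj u2(4) T_cj[OF nN u1(2)] by simp
    finally have "cj r u2 \<in> U" .
    then have "cj (inv (r \<otimes> r)) (cj r u2) \<in> U"
      using U_cj[of "inv (r \<otimes> r)"] ss_T[OF r r] by simp
    moreover have "r \<otimes> inv (r \<otimes> r) = inv r" by (simp add: inv_mult_group flip: m_assoc)
    ultimately have "cj (inv r) u2 \<in> U" by (simp add: cj_cj)
    then show "u \<in> U" unfolding u_def using u1 by simp
    have "inv r \<otimes> n \<in> T" using ss_T[OF S_inv_mem[OF s r] n] .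
    then have "cj (inv r \<otimes> n) u2 \<in> U" using U_cj u2(1) by simp
    then show "cj n u \<in> U" unfolding u_def using u1(4) by (simp add: cj_mult cj_cj)
  qed
  \<comment> \<open>This reflection is again simple: it equals (s w0)^-1 w0, whose length is that of
    w0 minus that of s w0, which is 1.\<close>
  define s' where "s' = inv\<^bsub>W\<^esub> longest \<otimes>\<^bsub>W\<^esub> s \<otimes>\<^bsub>W\<^esub> longest"
  have s'W: "s' \<in> carrier W" unfolding s'_def using sW longest_closed by simp
  have lsw: "weyl.wlen longest = Suc (weyl.wlen (s \<otimes>\<^bsub>W\<^esub> longest))"
    using weyl.wlen_Q[OF s swW longer_S_longest[OF s]] s longest_closed by simp
  have "inv\<^bsub>W\<^esub> (s \<otimes>\<^bsub>W\<^esub> longest) \<otimes>\<^bsub>W\<^esub> longest = s'"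
    unfolding s'_def using sW longest_closed by (simp add: weyl.inv_mult_group weyl.S_inv[OF s])
  then have "weyl.wlen s' = 1"
    using weyl.wlen_longest[OF longest_closed longest_max swW] lsw by simp
  then have s': "s' \<in> S" using weyl.wlen_eq_1 s'W by blast
  \<comment> \<open>The minimal parabolic subgroup of s'. Conjugation by n0 carries into it x' and
    every factor of its expression other than u, hence also u.\<close>
  define P where "P = B \<union> dcos s'"
  have P_mult: "y \<otimes> z \<in> P" if "y \<in> P" "z \<in> P" for y z
  proof -
    obtain q where q: "q \<in> s'" using s'W by (auto intro: W_nonempty)
    have qc: "q \<in> carrier G" using S_mem_N[OF s' q] by simp
    show ?thesis
    proof (cases "y \<in> B \<or> z \<in> B")
      case True
      then show ?thesis using that dcos_mult[OF _ s'W] by (auto simp: P_def)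
    next
      case False
      then have "y \<in> dcos s'" "z \<in> dcos s'" using that by (auto simp: P_def)
      then obtain a a' e e' where a: "a \<in> B" "a' \<in> B" "y = a \<otimes> q \<otimes> a'"
        and e: "e \<in> B" "e' \<in> B" "z = e \<otimes> q \<otimes> e'"
        using dcosE[OF _ s'W q] by metis
      have "q \<otimes> (a' \<otimes> e) \<otimes> q \<in> P"
        using S_conj_dcos[OF s' q q, of "a' \<otimes> e"] a e by (auto simp: P_def)
      then have "a \<otimes> (q \<otimes> (a' \<otimes> e) \<otimes> q) \<otimes> e' \<in> P"
        using dcos_mult[OF _ s'W] a e by (auto simp: P_def)
      also have "a \<otimes> (q \<otimes> (a' \<otimes> e) \<otimes> q) \<otimes> e' = y \<otimes> z"
        unfolding a(3) e(3) using a(1,2) e(1,2) qc by (simp add: m_assoc)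
      finally show ?thesis .
    qed
  qed
  have P_inv: "inv y \<in> P" if "y \<in> P" for y
    using that dcos_inv[OF _ s'W] weyl.S_inv[OF s'] by (auto simp: P_def)
  have P_B: "y \<in> P" if "y \<in> B" for y using that by (simp add: P_def)
  have P_s': "y \<in> P" if "y \<in> s'" for y using mem_dcos[OF s'W that] by (simp add: P_def)
  have P_T: "cj n0 t \<in> P" if "t \<in> T" for t using T_cj[OF n0N that] P_B by simp
  have P_s: "cj n0 y \<in> P" if "y \<in> s" for y
  proof -
    have "inv n0 \<otimes> y \<otimes> n0 \<in> s'"
      unfolding s'_def using W_mult_mem[OF W_mult_mem[OF W_inv_mem[OF longest_closed n0] that] n0] .
    then show ?thesis using P_s' by (simp add: cj_def)
  qed
  \<comment> \<open>Conjugation by n0 is conjugation by m, which takes y into U, followed by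
    conjugation by an element of s'.\<close>
  have P_X: "cj n0 y \<in> P" if y: "y \<in> U" "cj m y \<in> U" for y
  proof -
    have "inv n0 \<otimes> inv n \<otimes> n0 \<in> s'"
      unfolding s'_def
      using W_mult_mem[OF W_mult_mem[OF W_inv_mem[OF longest_closed n0] S_inv_mem[OF s n]] n0] .
    then have k: "cj n0 (inv n) \<in> P" using P_s' by (simp add: cj_def)
    have "m \<otimes> cj n0 (inv n) = n0" by (simp add: m_def cj_def m_assoc) (simp flip: m_assoc)
    then have "cj n0 y = cj (cj n0 (inv n)) (cj m y)" using y by (simp add: cj_cj)
    also have "\<dots> \<in> P" unfolding cj_def[of "cj n0 (inv n)"]
      using P_mult P_inv k P_B U_mem_B[OF y(2)] by blast
    finally show ?thesis .
  qed
  have "u = inv (x1 \<otimes> h1) \<otimes> x' \<otimes> inv (r \<otimes> h2 \<otimes> x2 \<otimes> k2)"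
    unfolding x'_eq by (simp add: m_assoc inv_mult_group) (simp flip: m_assoc)
  then have "cj n0 u = inv (cj n0 x1 \<otimes> cj n0 h1) \<otimes> cj n0 x' \<otimes>
      inv (cj n0 r \<otimes> cj n0 h2 \<otimes> cj n0 x2 \<otimes> cj n0 k2)"
    using x'c by (simp add: cj_mult cj_inv)
  also have "\<dots> \<in> P"
    by (intro P_mult P_inv P_X[OF x1(1,4)] P_X[OF x2(1,4)] P_T[OF x1(2)] P_T[OF u2(2)]
      P_T[OF x2(2)] P_s[OF r] P_B[OF U_mem_B[OF x'0]])
  finally have uP: "cj n0 u \<in> P" .
  \<comment> \<open>As u lies in nUn^-1, the product of n^-1 n0 and n0^-1 u n0 lies in Bsw0B. An
    element of Bs'B as second factor would lead to Bw0B instead, because s w0 s' = w0 is longer than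
    s w0.\<close>
  have "cj n0 u \<notin> dcos s'"
  proof
    assume "cj n0 u \<in> dcos s'"
    moreover obtain q where q: "q \<in> s'" using s'W by (auto intro: W_nonempty)
    ultimately obtain e e' where e: "e \<in> B" "e' \<in> B" "cj n0 u = e \<otimes> q \<otimes> e'"
      using dcosE[OF _ s'W q] by blast
    have qc: "q \<in> carrier G" using S_mem_N[OF s' q] by simp
    have l: "inv n \<otimes> n0 \<in> s \<otimes>\<^bsub>W\<^esub> longest" using W_mult_mem[OF S_inv_mem[OF s n] n0] .
    have sws': "s \<otimes>\<^bsub>W\<^esub> longest \<otimes>\<^bsub>W\<^esub> s' = longest"
      unfolding s'_def using sW longest_closed s
      by (simp add: weyl.m_assoc flip: weyl.m_assoc[of longest "inv\<^bsub>W\<^esub> longest"])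
    have "s' \<otimes>\<^bsub>W\<^esub> inv\<^bsub>W\<^esub> (s \<otimes>\<^bsub>W\<^esub> longest) = inv\<^bsub>W\<^esub> (s \<otimes>\<^bsub>W\<^esub> longest \<otimes>\<^bsub>W\<^esub> s')"
      using swW s'W weyl.inv_mult_group weyl.S_inv[OF s'] by simp
    then have "s' \<otimes>\<^bsub>W\<^esub> inv\<^bsub>W\<^esub> (s \<otimes>\<^bsub>W\<^esub> longest) = inv\<^bsub>W\<^esub> longest" using sws' by simp
    then have "longer s' (inv\<^bsub>W\<^esub> (s \<otimes>\<^bsub>W\<^esub> longest))"
      using weyl.Q_iff[OF s'] lsw swW longest_closed weyl.wlen_inv by simp
    then have "(inv n \<otimes> n0) \<otimes> e \<otimes> q \<in> dcos longest"
      using longer_right[OF s' q swW l e(1)] sws' by simp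
    then have "(inv n \<otimes> n0) \<otimes> e \<otimes> q \<otimes> e' \<in> dcos longest"
      using dcos_mult(2)[OF _ longest_closed e(2)] by blast
    also have "(inv n \<otimes> n0) \<otimes> e \<otimes> q \<otimes> e' = (inv n \<otimes> n0) \<otimes> cj n0 u"
      unfolding e(3) using e(1,2) qc by (simp add: m_assoc)
    also have "\<dots> = cj n u \<otimes> (inv n \<otimes> n0)"
      by (simp add: cj_def m_assoc) (simp flip: m_assoc)
    finally have "cj n u \<otimes> (inv n \<otimes> n0) \<in> dcos longest" .
    moreover have "cj n u \<otimes> (inv n \<otimes> n0) \<in> dcos (s \<otimes>\<^bsub>W\<^esub> longest)"
      using dcos_mult(1)[OF mem_dcos[OF swW l] swW] unU U_mem_B by blast
    ultimately show False
      using bruhat[OF swW longest_closed] W_mult_neq[OF s longest_closed] by blast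
  qed
  then have "cj n0 u \<in> B" using uP by (simp add: P_def)
  then have "u \<in> T" using cj_longest_in_T[OF n0] uU U_mem_B by blast
  then have "u = \<one>" using U_inter_T uU by blast
  \<comment> \<open>With u gone, the relation for x' is solved for r, and every factor lies in the
    generated subgroup.\<close>
  then have "r = inv (x1 \<otimes> h1) \<otimes> x' \<otimes> inv (h2 \<otimes> x2 \<otimes> k2)"
    unfolding x'_eq by (simp add: m_assoc inv_mult_group) (simp flip: m_assoc)
  moreover have "?X \<subseteq> carrier G" using X_iff by auto
  then have "subgroup ?K G"
    using coset_conj_subset[OF sW, of ?X] by (intro generate_is_subgroup) auto
  moreover have "x' \<in> ?K" "x1 \<in> ?K" "x2 \<in> ?K" "h1 \<in> ?K" "h2 \<in> ?K" "k2 \<in> ?K"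
    using x'K x1 x2 u2 X_iff by (auto intro: generate.incl)
  ultimately have "r \<in> ?K" by (auto intro: subgroup.m_closed subgroup.m_inv_closed)
  then show ?thesis using r by blast
qed

section \<open>Levi subgroups contain their Weyl groups and parabolic subgroups\<close>

lemma root_subgroup_carrier: "root_subgroup \<alpha> \<subseteq> carrier G"
proof -
  have "coset_conj (word ss) (simple_root_subgroup s) \<subseteq> carrier G" if "ss \<in> lists S" "s \<in> S" for ss s
    using that by (intro coset_conj_subset) (auto simp: simple_root_subgroup_def word_def weyl.wprod_def[symmetric])
  then show ?thesis unfolding root_subgroup_def by blast
qed

lemma std_levi_subgroup: "subgroup (std_levi J) G"
  unfolding std_levi_def using root_subgroup_carrier by (intro generate_is_subgroup) auto

text \<open>The empty word and the word s give the root subgroups of the simple root and of its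
  image under s, the two that occur in the rank one statement. It yields one representative of s,
  and T yields the rest of the coset.\<close>

lemma S_subset_std_levi:
  assumes "s \<in> J" "J \<subseteq> S"
  shows "s \<subseteq> std_levi J"
proof -
  have s: "s \<in> S" using assms by blast
  have T: "T \<subseteq> std_levi J" unfolding std_levi_def by (auto intro: generate.incl)
  have rs: "coset_conj (word ss) (simple_root_subgroup s) \<subseteq> std_levi J" if "ss \<in> lists J" for ss
  proof -
    have "root_of ss s \<in> roots J" using that assms(1) by (auto simp: roots_def)
    moreover have "coset_conj (word ss) (simple_root_subgroup s) \<subseteq> root_subgroup (root_of ss s)"
      using that assms s unfolding root_subgroup_def by blast
    ultimately show ?thesis unfolding std_levi_def by (auto intro: generate.incl)
  qed
  have "simple_root_subgroup s \<subseteq> coset_conj (word []) (simple_root_subgroup s)"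
  proof
    fix x assume x: "x \<in> simple_root_subgroup s"
    then have "x \<in> conj_set G \<one> (simple_root_subgroup s)"
      by (intro mem_conj_set_cj) (auto simp: simple_root_subgroup_def)
    moreover have "\<one> \<in> word []" by (simp add: word_def W_one)
    ultimately show "x \<in> coset_conj (word []) (simple_root_subgroup s)"
      unfolding coset_conj_def by blast
  qed
  moreover have "word [s] = s" using s by (simp add: word_def)
  ultimately have "T \<union> simple_root_subgroup s \<union> coset_conj s (simple_root_subgroup s) \<subseteq> std_levi J"
    using T rs[of "[]"] rs[of "[s]"] assms(1) by auto
  then have "generate G (T \<union> simple_root_subgroup s \<union> coset_conj s (simple_root_subgroup s)) \<subseteq> std_levi J"
    using generate_subgroup_incl std_levi_subgroup by blast
  then obtain r where r: "r \<in> s" "r \<in> std_levi J" using S_meets_rank_one[OF s] by blast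
  show ?thesis
  proof
    fix x assume "x \<in> s"
    then have "x \<in> T #> r" using W_eq[OF S_mem_W[OF s] r(1)] by simp
    then show "x \<in> std_levi J"
      using T r(2) subgroup.m_closed[OF std_levi_subgroup] by (auto simp: r_coset_def)
  qed
qed

lemma N_sub_subset_std_levi:
  assumes "I \<subseteq> J" "J \<subseteq> S"
  shows "N_sub I \<subseteq> std_levi J"
proof -
  have "w \<subseteq> std_levi J" if "w \<in> generate W I" for w
    using that
  proof induction
    case one
    then show ?case unfolding std_levi_def W_one by (auto intro: generate.incl)
  next
    case (incl s)
    then show ?case using S_subset_std_levi assms by blast
  next
    case (inv s)
    then show ?case using S_subset_std_levi[of s J] weyl.S_inv[of s] assms by auto
  next
    case (eng v w)
    then show ?case
      using subgroup.m_closed[OF std_levi_subgroup[of J]] by (blast elim!: W_mult_memE)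
  qed
  then show ?thesis unfolding N_sub_def by blast
qed

text \<open>This makes induction from a parabolic subgroup inside M meaningful.\<close>

lemma parabolic_subset:
  assumes "Q \<in> parabolics M"
  shows "Q \<subseteq> M"
proof -
  obtain n I J where Q: "n \<in> N" "I \<subseteq> J" "J \<subseteq> S" "M = conj_set G n (std_levi J)"
    "Q = conj_set G n ((B \<inter> std_levi J) <#> N_sub I <#> (B \<inter> std_levi J))"
    using assms unfolding parabolics_def by blast
  have "(B \<inter> std_levi J) <#> N_sub I <#> (B \<inter> std_levi J) \<subseteq> std_levi J"
    using subgroup.m_closed[OF std_levi_subgroup] N_sub_subset_std_levi[OF Q(2,3)]
    by (auto simp: set_mult_def)
  then show ?thesis unfolding Q(4,5) conj_set_eq by blast
qed

lemma levi_subgroup: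
  assumes "M \<in> levis"
  shows "subgroup M G"
  using assms conj_subgroup std_levi_subgroup unfolding levis_def by force

end

section \<open>Finite-dimensional vector spaces\<close>

text \<open>Linear combinations built one summand at a time, with repetitions allowed, so that rule
  induction applies. \<open>fin_dim_iff\<close> connects them with the coefficient functions of
  \<open>fin_dim\<close>.\<close>

inductive_set lspan :: "('k, 'c) ring_scheme \<Rightarrow> ('k, 'v, 'd) module_scheme \<Rightarrow> 'v set \<Rightarrow> 'v set"
  for k :: "('k, 'c) ring_scheme" and V :: "('k, 'v, 'd) module_scheme" and E :: "'v set"
  where
    lspan_zero: "\<zero>\<^bsub>V\<^esub> \<in> lspan k V E"
  | lspan_step: "\<lbrakk>c \<in> carrier k; e \<in> E; v \<in> lspan k V E\<rbrakk> \<Longrightarrow> c \<odot>\<^bsub>V\<^esub> e \<oplus>\<^bsub>V\<^esub> v \<in> lspan k V E"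

text \<open>Stated for subsets of the carrier, so that a subspace needs no record of its own; the
  generators must come from the subset itself.\<close>

definition fin_gen :: "('k, 'c) ring_scheme \<Rightarrow> ('k, 'v, 'd) module_scheme \<Rightarrow> 'v set \<Rightarrow> bool"
  where "fin_gen k V W \<longleftrightarrow> (\<exists>E. finite E \<and> E \<subseteq> W \<and> W \<subseteq> lspan k V E)"

lemma lspan_mono: "E \<subseteq> F \<Longrightarrow> lspan k V E \<subseteq> lspan k V F"
proof
  fix v assume "E \<subseteq> F" "v \<in> lspan k V E"
  from this(2,1) show "v \<in> lspan k V F"
    by induction (auto intro: lspan.intros)
qed

context module
begin

lemma lspan_closed: "E \<subseteq> carrier M \<Longrightarrow> v \<in> lspan R M E \<Longrightarrow> v \<in> carrier M"
  by (rotate_tac, induction rule: lspan.induct) auto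

lemma lspan_add:
  assumes E: "E \<subseteq> carrier M" and "v \<in> lspan R M E" "w \<in> lspan R M E"
  shows "v \<oplus>\<^bsub>M\<^esub> w \<in> lspan R M E"
  using assms(2)
proof induction
  case lspan_zero
  then show ?case using assms lspan_closed by simp
next
  case (lspan_step c e v)
  have "c \<odot>\<^bsub>M\<^esub> e \<oplus>\<^bsub>M\<^esub> (v \<oplus>\<^bsub>M\<^esub> w) \<in> lspan R M E"
    using lspan_step by (intro lspan.intros)
  moreover have "e \<in> carrier M" "v \<in> carrier M" "w \<in> carrier M"
    using lspan_step E lspan_closed assms(3) by auto
  ultimately show ?case using lspan_step by (simp add: M.a_assoc)
qed

lemma lspan_smult:
  assumes E: "E \<subseteq> carrier M" and "v \<in> lspan R M E" "a \<in> carrier R"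
  shows "a \<odot>\<^bsub>M\<^esub> v \<in> lspan R M E"
  using assms(2)
proof induction
  case lspan_zero
  then show ?case using assms(3) lspan.lspan_zero by simp
next
  case (lspan_step c e v)
  have "(a \<otimes> c) \<odot>\<^bsub>M\<^esub> e \<oplus>\<^bsub>M\<^esub> a \<odot>\<^bsub>M\<^esub> v \<in> lspan R M E"
    using lspan_step assms(3) by (intro lspan.intros) auto
  moreover have "e \<in> carrier M" "v \<in> carrier M"
    using lspan_step E lspan_closed by auto
  ultimately show ?case using lspan_step assms(3) by (simp add: smult_r_distr smult_assoc1)
qed

lemma finsum_in_lspan:
  assumes "finite F" "F \<subseteq> E" "E \<subseteq> carrier M" "c \<in> F \<rightarrow> carrier R"
  shows "(\<Oplus>\<^bsub>M\<^esub>e \<in> F. c e \<odot>\<^bsub>M\<^esub> e) \<in> lspan R M E"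
  using assms
proof (induction F rule: finite_induct)
  case empty
  then show ?case by (simp add: lspan_zero)
next
  case (insert e F)
  then have "(\<Oplus>\<^bsub>M\<^esub>e \<in> insert e F. c e \<odot>\<^bsub>M\<^esub> e) = c e \<odot>\<^bsub>M\<^esub> e \<oplus>\<^bsub>M\<^esub> (\<Oplus>\<^bsub>M\<^esub>e \<in> F. c e \<odot>\<^bsub>M\<^esub> e)"
    by (intro M.finsum_insert) auto
  then show ?case using insert by (auto intro: lspan_step)
qed

lemma lspan_finsum:
  assumes "finite E" "E \<subseteq> carrier M" "v \<in> lspan R M E"
  shows "\<exists>c \<in> E \<rightarrow> carrier R. v = (\<Oplus>\<^bsub>M\<^esub>e \<in> E. c e \<odot>\<^bsub>M\<^esub> e)"
  using assms(3)
proof induction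
  case lspan_zero
  have "(\<Oplus>\<^bsub>M\<^esub>e \<in> E. \<zero> \<odot>\<^bsub>M\<^esub> e) = (\<Oplus>\<^bsub>M\<^esub>e \<in> E. \<zero>\<^bsub>M\<^esub>)"
    using assms(2) by (intro M.finsum_cong') auto
  then have "\<zero>\<^bsub>M\<^esub> = (\<Oplus>\<^bsub>M\<^esub>e \<in> E. \<zero> \<odot>\<^bsub>M\<^esub> e)" by simp
  then show ?case by (intro bexI[of _ "\<lambda>_. \<zero>"]) auto
next
  case (lspan_step a e v)
  then obtain c where c: "c \<in> E \<rightarrow> carrier R" "v = (\<Oplus>\<^bsub>M\<^esub>e \<in> E. c e \<odot>\<^bsub>M\<^esub> e)" by blast
  \<comment> \<open>A coefficient function lists each generator once, so the coefficient of a
    repeated generator is added to the old one.\<close>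
  define c' where "c' = c(e := a \<oplus> c e)"
  have c': "c' \<in> E \<rightarrow> carrier R" using c(1) lspan_step(1,2) by (auto simp: c'_def Pi_iff)
  have E_eq: "insert e (E - {e}) = E" using lspan_step by auto
  have split: "(\<Oplus>\<^bsub>M\<^esub>x \<in> E. b x \<odot>\<^bsub>M\<^esub> x) = b e \<odot>\<^bsub>M\<^esub> e \<oplus>\<^bsub>M\<^esub> (\<Oplus>\<^bsub>M\<^esub>x \<in> E - {e}. b x \<odot>\<^bsub>M\<^esub> x)"
    if "b \<in> E \<rightarrow> carrier R" for b
    using M.finsum_insert[of "E - {e}" e "\<lambda>x. b x \<odot>\<^bsub>M\<^esub> x"] that assms(1,2) lspan_step(2)
    unfolding E_eq by (auto simp: Pi_iff)
  have rest: "(\<Oplus>\<^bsub>M\<^esub>x \<in> E - {e}. c' x \<odot>\<^bsub>M\<^esub> x) = (\<Oplus>\<^bsub>M\<^esub>x \<in> E - {e}. c x \<odot>\<^bsub>M\<^esub> x)"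
    using c(1) assms(2) by (intro M.finsum_cong') (auto simp: c'_def)
  have "e \<in> carrier M" "c e \<in> carrier R" using lspan_step c assms(2) by auto
  moreover have "(\<Oplus>\<^bsub>M\<^esub>x \<in> E - {e}. c x \<odot>\<^bsub>M\<^esub> x) \<in> carrier M"
    using c(1) assms(2) by (intro M.finsum_closed) auto
  ultimately have "a \<odot>\<^bsub>M\<^esub> e \<oplus>\<^bsub>M\<^esub> v = (\<Oplus>\<^bsub>M\<^esub>x \<in> E. c' x \<odot>\<^bsub>M\<^esub> x)"
    unfolding split[OF c'] c(2) split[OF c(1)] rest
    using lspan_step(1) by (simp add: c'_def smult_l_distr M.a_assoc)
  then show ?case using c' by blast
qed

lemma fin_dim_iff: "fin_dim R M \<longleftrightarrow> fin_gen R M (carrier M)"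
proof
  assume "fin_dim R M"
  then obtain E where E: "finite E" "E \<subseteq> carrier M"
    "\<forall>v \<in> carrier M. \<exists>c \<in> E \<rightarrow> carrier R. v = (\<Oplus>\<^bsub>M\<^esub>e \<in> E. c e \<odot>\<^bsub>M\<^esub> e)"
    unfolding fin_dim_def by blast
  then have "carrier M \<subseteq> lspan R M E" using finsum_in_lspan[OF E(1) subset_refl E(2)] by fastforce
  then show "fin_gen R M (carrier M)" using E unfolding fin_gen_def by blast
next
  assume "fin_gen R M (carrier M)"
  then show "fin_dim R M" using lspan_finsum unfolding fin_gen_def fin_dim_def by (meson subsetD)
qed

end

text \<open>Removing the generator e replaces W by W \<inter> span E. If this loses anything, one
  vector w1 of W with nonzero coefficient at e makes up for it, since a multiple of w1 clears that
  coefficient in any other vector.\<close>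

lemma subspace_fin_gen:
  assumes "field k" "module k V" "finite E" "E \<subseteq> carrier V" "submodule W k V" "W \<subseteq> lspan k V E"
  shows "fin_gen k V W"
  using assms(3-)
proof (induction E arbitrary: W rule: finite_induct)
  interpret k: field k by fact
  interpret V: module k V by fact
  case empty
  have "v = \<zero>\<^bsub>V\<^esub>" if "v \<in> lspan k V {}" for v using that by cases auto
  then have "W \<subseteq> lspan k V {}" using empty by blast
  then show ?case unfolding fin_gen_def by blast
next
  interpret k: field k by fact
  interpret V: module k V by fact
  case (insert e E)
  have E: "E \<subseteq> carrier V" and e: "e \<in> carrier V" using insert.prems by auto
  note W = V.submoduleE[OF insert.prems(2)]
  have coeff: "\<exists>a \<in> carrier k. \<exists>x \<in> lspan k V E. v = a \<odot>\<^bsub>V\<^esub> e \<oplus>\<^bsub>V\<^esub> x" if "v \<in> lspan k V (insert e E)" for v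
    using that
  proof (induction v)
    case lspan_zero
    show ?case using e by (intro bexI[of _ "\<zero>\<^bsub>k\<^esub>"] bexI[of _ "\<zero>\<^bsub>V\<^esub>"]) (auto intro: lspan.lspan_zero)
  next
    case (lspan_step c f v)
    then obtain a x where x: "a \<in> carrier k" "x \<in> lspan k V E" "v = a \<odot>\<^bsub>V\<^esub> e \<oplus>\<^bsub>V\<^esub> x" by blast
    have xc: "x \<in> carrier V" using V.lspan_closed E x by blast
    show ?case
    proof (cases "f = e")
      case True
      have "c \<odot>\<^bsub>V\<^esub> f \<oplus>\<^bsub>V\<^esub> v = (c \<oplus>\<^bsub>k\<^esub> a) \<odot>\<^bsub>V\<^esub> e \<oplus>\<^bsub>V\<^esub> x"
        using x xc lspan_step e True by (simp add: V.smult_l_distr V.M.a_assoc)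
      then show ?thesis using x lspan_step by blast
    next
      case False
      then have f: "f \<in> E" "f \<in> carrier V" using lspan_step E by auto
      have "c \<odot>\<^bsub>V\<^esub> f \<oplus>\<^bsub>V\<^esub> v = a \<odot>\<^bsub>V\<^esub> e \<oplus>\<^bsub>V\<^esub> (c \<odot>\<^bsub>V\<^esub> f \<oplus>\<^bsub>V\<^esub> x)"
        using x xc lspan_step(1) e f by (simp add: V.M.a_lcomm)
      then show ?thesis using x lspan_step(1) f lspan.lspan_step[of c k f E x V] by blast
    qed
  qed
  define W' where "W' = W \<inter> lspan k V E"
  have W': "submodule W' k V"
  proof (rule V.submoduleI)
    show "W' \<subseteq> carrier V" using W by (auto simp: W'_def)
    show "\<zero>\<^bsub>V\<^esub> \<in> W'"
      using subgroup.one_closed[OF submodule.axioms(1)[OF insert.prems(2)]]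
      by (simp add: W'_def lspan_zero)
    show "\<ominus>\<^bsub>V\<^esub> a \<in> W'" if "a \<in> W'" for a
    proof -
      have a: "a \<in> W" "a \<in> lspan k V E" "a \<in> carrier V" using that W by (auto simp: W'_def)
      have "\<ominus>\<^bsub>V\<^esub> a = (\<ominus>\<^bsub>k\<^esub> \<one>\<^bsub>k\<^esub>) \<odot>\<^bsub>V\<^esub> a" using a by (simp add: V.smult_l_minus)
      then have "\<ominus>\<^bsub>V\<^esub> a \<in> lspan k V E" using V.lspan_smult[OF E a(2), of "\<ominus>\<^bsub>k\<^esub> \<one>\<^bsub>k\<^esub>"] by simp
      then show ?thesis using a W by (simp add: W'_def)
    qed
    show "a \<oplus>\<^bsub>V\<^esub> b \<in> W'" if "a \<in> W'" "b \<in> W'" for a b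
      using that W V.lspan_add[OF E] by (auto simp: W'_def)
    show "a \<odot>\<^bsub>V\<^esub> x \<in> W'" if "a \<in> carrier k" "x \<in> W'" for a x
      using that W V.lspan_smult[OF E] by (auto simp: W'_def)
  qed
  have "fin_gen k V W'" using insert.IH[OF E W'] by (simp add: W'_def)
  then obtain F where F: "finite F" "F \<subseteq> W'" "W' \<subseteq> lspan k V F" unfolding fin_gen_def by blast
  have Fc: "F \<subseteq> carrier V" using F W by (auto simp: W'_def)
  show ?case
  proof (cases "W = W'")
    case True
    then show ?thesis using F unfolding fin_gen_def by blast
  next
    case False
    then obtain w1 where w1: "w1 \<in> W" "w1 \<notin> lspan k V E" unfolding W'_def by blast
    then obtain a x where ax: "a \<in> carrier k" "x \<in> lspan k V E" "w1 = a \<odot>\<^bsub>V\<^esub> e \<oplus>\<^bsub>V\<^esub> x"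
      using coeff insert.prems(3) by blast
    have xc: "x \<in> carrier V" using V.lspan_closed E ax by blast
    have w1c: "w1 \<in> carrier V" using w1 W by blast
    have "a \<noteq> \<zero>\<^bsub>k\<^esub>" using ax w1(2) e xc by auto
    then have au: "a \<in> Units k" using ax(1) k.field_Units by simp
    have G: "insert w1 F \<subseteq> carrier V" using w1c Fc by simp
    have "w \<in> lspan k V (insert w1 F)" if w: "w \<in> W" for w
    proof -
      obtain b y where bd: "b \<in> carrier k" "y \<in> lspan k V E" "w = b \<odot>\<^bsub>V\<^esub> e \<oplus>\<^bsub>V\<^esub> y"
        using coeff insert.prems(3) w by blast
      have yc: "y \<in> carrier V" using V.lspan_closed E bd by blast
      \<comment> \<open>The ratio of the coefficients of w and w1 at e, so that e cancels in w - c
        w1.\<close>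
      define c where "c = b \<otimes>\<^bsub>k\<^esub> inv\<^bsub>k\<^esub> a"
      have c: "c \<in> carrier k" "c \<otimes>\<^bsub>k\<^esub> a = b"
        using bd(1) au k.Units_closed k.Units_inv_closed by (auto simp: c_def k.m_assoc)
      define d where "d = y \<oplus>\<^bsub>V\<^esub> (\<ominus>\<^bsub>k\<^esub> c) \<odot>\<^bsub>V\<^esub> x"
      have d: "d \<in> lspan k V E"
        unfolding d_def using V.lspan_add V.lspan_smult E bd ax c by simp
      have dc: "d \<in> carrier V" using V.lspan_closed E d by blast
      have "c \<odot>\<^bsub>V\<^esub> w1 \<oplus>\<^bsub>V\<^esub> d = b \<odot>\<^bsub>V\<^esub> e \<oplus>\<^bsub>V\<^esub> (c \<odot>\<^bsub>V\<^esub> x \<oplus>\<^bsub>V\<^esub> (y \<oplus>\<^bsub>V\<^esub> (\<ominus>\<^bsub>k\<^esub> c) \<odot>\<^bsub>V\<^esub> x))"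
        unfolding d_def ax(3) using c ax(1) bd(1) e xc yc
        by (simp add: V.smult_r_distr V.M.a_assoc flip: V.smult_assoc1)
      also have "c \<odot>\<^bsub>V\<^esub> x \<oplus>\<^bsub>V\<^esub> (y \<oplus>\<^bsub>V\<^esub> (\<ominus>\<^bsub>k\<^esub> c) \<odot>\<^bsub>V\<^esub> x) = y"
        using c xc yc by (simp add: V.smult_l_minus V.M.a_lcomm[of _ y] V.M.r_neg)
      finally have w_eq: "w = c \<odot>\<^bsub>V\<^esub> w1 \<oplus>\<^bsub>V\<^esub> d" using bd by simp
      have "d = w \<oplus>\<^bsub>V\<^esub> (\<ominus>\<^bsub>k\<^esub> c) \<odot>\<^bsub>V\<^esub> w1"
        unfolding w_eq using c w1c dc
        by (simp add: V.smult_l_minus V.M.a_ac V.M.r_neg V.M.r_neg1 V.M.r_neg2)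
      then have "d \<in> W" using W w w1 c by simp
      then have "d \<in> lspan k V F" using F d by (auto simp: W'_def)
      then have "d \<in> lspan k V (insert w1 F)" using lspan_mono[of F "insert w1 F"] by blast
      then show ?thesis unfolding w_eq using c by (intro lspan_step) auto
    qed
    then show ?thesis using F w1 unfolding fin_gen_def W'_def
      by (intro exI[of _ "insert w1 F"]) auto
  qed
qed

text \<open>Nothing is required outside W, so evaluation maps and their restrictions to kernels can
  be treated without changing functions or records.\<close>

definition linear_on :: "('k, 'c) ring_scheme \<Rightarrow> ('k, 'v, 'd) module_scheme
    \<Rightarrow> ('k, 'w, 'e) module_scheme \<Rightarrow> 'v set \<Rightarrow> ('v \<Rightarrow> 'w) \<Rightarrow> bool"
  where "linear_on k V V' W f \<longleftrightarrow> f \<in> W \<rightarrow> carrier V' \<and>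
    (\<forall>v \<in> W. \<forall>w \<in> W. f (v \<oplus>\<^bsub>V\<^esub> w) = f v \<oplus>\<^bsub>V'\<^esub> f w) \<and>
    (\<forall>c \<in> carrier k. \<forall>v \<in> W. f (c \<odot>\<^bsub>V\<^esub> v) = c \<odot>\<^bsub>V'\<^esub> f v)"

lemma linear_on_subset: "linear_on k V V' W f \<Longrightarrow> W' \<subseteq> W \<Longrightarrow> linear_on k V V' W' f"
  unfolding linear_on_def by blast

context
  fixes k :: "('k, 'c) ring_scheme" and V :: "('k, 'v, 'd) module_scheme"
    and V' :: "('k, 'w, 'e) module_scheme" and W f
  assumes field_k: "field k" and mod_V: "module k V" and mod_V': "module k V'"
    and sub_W: "submodule W k V" and lin: "linear_on k V V' W f"
begin

interpretation k: field k by (rule field_k)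
interpretation V: module k V by (rule mod_V)
interpretation V': module k V' by (rule mod_V')

lemma submodule_facts:
  "W \<subseteq> carrier V" "\<zero>\<^bsub>V\<^esub> \<in> W" "v \<in> W \<Longrightarrow> \<ominus>\<^bsub>V\<^esub> v \<in> W" "\<lbrakk>v \<in> W; w \<in> W\<rbrakk> \<Longrightarrow> v \<oplus>\<^bsub>V\<^esub> w \<in> W"
  "\<lbrakk>c \<in> carrier k; v \<in> W\<rbrakk> \<Longrightarrow> c \<odot>\<^bsub>V\<^esub> v \<in> W"
  using V.submoduleE[OF sub_W] subgroup.one_closed[OF submodule.axioms(1)[OF sub_W]] by auto

lemma linear_on_facts:
  "v \<in> W \<Longrightarrow> f v \<in> carrier V'" "\<lbrakk>v \<in> W; w \<in> W\<rbrakk> \<Longrightarrow> f (v \<oplus>\<^bsub>V\<^esub> w) = f v \<oplus>\<^bsub>V'\<^esub> f w"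
  "\<lbrakk>c \<in> carrier k; v \<in> W\<rbrakk> \<Longrightarrow> f (c \<odot>\<^bsub>V\<^esub> v) = c \<odot>\<^bsub>V'\<^esub> f v"
  using lin unfolding linear_on_def by auto

lemma linear_on_zero: "f \<zero>\<^bsub>V\<^esub> = \<zero>\<^bsub>V'\<^esub>"
  using linear_on_facts(3)[OF k.zero_closed submodule_facts(2)] submodule_facts(2)
    linear_on_facts(1)[OF submodule_facts(2)] by simp

lemma linear_on_minus: "v \<in> W \<Longrightarrow> f (\<ominus>\<^bsub>V\<^esub> v) = \<ominus>\<^bsub>V'\<^esub> f v"
  using linear_on_facts(2)[of v "\<ominus>\<^bsub>V\<^esub> v"] submodule_facts linear_on_facts(1) linear_on_zero
    V'.M.minus_equality[of "f (\<ominus>\<^bsub>V\<^esub> v)" "f v"] V.M.r_neg[of v] V'.M.a_comm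
  by (metis subsetD)

lemma image_submodule: "submodule (f ` W) k V'"
proof (rule V'.submoduleI)
  show "f ` W \<subseteq> carrier V'" using linear_on_facts by blast
  show "\<zero>\<^bsub>V'\<^esub> \<in> f ` W" using linear_on_zero[symmetric] submodule_facts(2) by (rule image_eqI)
  show "\<ominus>\<^bsub>V'\<^esub> a \<in> f ` W" if a: "a \<in> f ` W" for a
  proof -
    obtain v where "v \<in> W" "a = f v" using a by blast
    then have "\<ominus>\<^bsub>V'\<^esub> a = f (\<ominus>\<^bsub>V\<^esub> v)" "\<ominus>\<^bsub>V\<^esub> v \<in> W"
      by (simp_all add: linear_on_minus submodule_facts)
    then show ?thesis by blast
  qed
  show "a \<oplus>\<^bsub>V'\<^esub> b \<in> f ` W" if ab: "a \<in> f ` W" "b \<in> f ` W" for a b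
  proof -
    obtain v w where "v \<in> W" "w \<in> W" "a = f v" "b = f w" using ab by blast
    then have "a \<oplus>\<^bsub>V'\<^esub> b = f (v \<oplus>\<^bsub>V\<^esub> w)" "v \<oplus>\<^bsub>V\<^esub> w \<in> W"
      by (simp_all add: linear_on_facts submodule_facts)
    then show ?thesis by blast
  qed
  show "a \<odot>\<^bsub>V'\<^esub> x \<in> f ` W" if ax: "a \<in> carrier k" "x \<in> f ` W" for a x
  proof -
    obtain v where "v \<in> W" "x = f v" using ax by blast
    then have "a \<odot>\<^bsub>V'\<^esub> x = f (a \<odot>\<^bsub>V\<^esub> v)" "a \<odot>\<^bsub>V\<^esub> v \<in> W"
      using ax(1) by (simp_all add: linear_on_facts submodule_facts)
    then show ?thesis by blast
  qed
qed

lemma kernel_submodule: "submodule {w \<in> W. f w = \<zero>\<^bsub>V'\<^esub>} k V"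
  using submodule_facts linear_on_facts linear_on_zero linear_on_minus
  by (intro V.submoduleI) auto

text \<open>Lifts of generators of the image together with generators of the kernel suffice: any w
  differs from a combination of the lifts by a vector of the kernel.\<close>

lemma fin_gen_extension:
  assumes "fin_gen k V' (f ` W)" "fin_gen k V {w \<in> W. f w = \<zero>\<^bsub>V'\<^esub>}"
  shows "fin_gen k V W"
proof -
  obtain E' where E': "finite E'" "E' \<subseteq> f ` W" "f ` W \<subseteq> lspan k V' E'"
    using assms(1) unfolding fin_gen_def by blast
  then obtain E where E: "E \<subseteq> W" "finite E" "E' = f ` E" by (meson finite_subset_image)
  obtain F where F: "finite F" "F \<subseteq> {w \<in> W. f w = \<zero>\<^bsub>V'\<^esub>}" "{w \<in> W. f w = \<zero>\<^bsub>V'\<^esub>} \<subseteq> lspan k V F"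
    using assms(2) unfolding fin_gen_def by blast
  have EF: "E \<union> F \<subseteq> carrier V" using E F submodule_facts by blast
  have lift: "\<exists>w \<in> lspan k V E \<inter> W. f w = x" if "x \<in> lspan k V' (f ` E)" for x
    using that
  proof induction
    case lspan_zero
    show ?case using linear_on_zero submodule_facts(2) by (intro bexI[of _ "\<zero>\<^bsub>V\<^esub>"]) (auto intro: lspan.intros)
  next
    case (lspan_step c e' v)
    then obtain w where w: "w \<in> lspan k V E" "w \<in> W" "f w = v" by blast
    obtain e where e: "e \<in> E" "e' = f e" "e \<in> W" using lspan_step E by blast
    have "f (c \<odot>\<^bsub>V\<^esub> e \<oplus>\<^bsub>V\<^esub> w) = c \<odot>\<^bsub>V'\<^esub> e' \<oplus>\<^bsub>V'\<^esub> v"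
      using w e lspan_step(1) submodule_facts linear_on_facts by simp
    then show ?case using w e lspan_step(1) submodule_facts(4,5)
      by (intro bexI[of _ "c \<odot>\<^bsub>V\<^esub> e \<oplus>\<^bsub>V\<^esub> w"]) (auto intro: lspan.intros)
  qed
  have "w \<in> lspan k V (E \<union> F)" if w: "w \<in> W" for w
  proof -
    have "f w \<in> lspan k V' (f ` E)" using E' E w by blast
    then obtain v where v: "v \<in> lspan k V E" "v \<in> W" "f v = f w" using lift by blast
    have wv: "w \<in> carrier V" "v \<in> carrier V" using w v submodule_facts by auto
    have "f (w \<oplus>\<^bsub>V\<^esub> \<ominus>\<^bsub>V\<^esub> v) = f w \<oplus>\<^bsub>V'\<^esub> \<ominus>\<^bsub>V'\<^esub> f v"
      using w v by (simp add: linear_on_facts(2) linear_on_minus submodule_facts(3))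
    then have "f (w \<oplus>\<^bsub>V\<^esub> \<ominus>\<^bsub>V\<^esub> v) = \<zero>\<^bsub>V'\<^esub>"
      using v(3) linear_on_facts(1)[OF w] by (simp add: V'.M.r_neg)
    then have "w \<oplus>\<^bsub>V\<^esub> \<ominus>\<^bsub>V\<^esub> v \<in> lspan k V F" using F(3) w v submodule_facts by blast
    then have "(w \<oplus>\<^bsub>V\<^esub> \<ominus>\<^bsub>V\<^esub> v) \<oplus>\<^bsub>V\<^esub> v \<in> lspan k V (E \<union> F)"
      using subsetD[OF lspan_mono[of E "E \<union> F" k V] v(1)]
        subsetD[OF lspan_mono[of F "E \<union> F" k V]] by - (rule V.lspan_add[OF EF], simp_all)
    then show ?thesis using wv by (simp add: V.M.a_assoc V.M.l_neg)
  qed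
  then show ?thesis unfolding fin_gen_def using E F by (intro exI[of _ "E \<union> F"]) auto
qed

end

text \<open>The image under one of the maps is a subspace of a finite-dimensional space, and on its
  kernel the remaining maps still separate points. Hom spaces, induced modules and fixed points are
  all treated this way.\<close>

lemma fin_gen_jointly_injective:
  assumes "field k" "module k V" "module k V'" "fin_dim k V'"
    and "finite I" "submodule W k V" "\<And>i. i \<in> I \<Longrightarrow> linear_on k V V' W (f i)"
    and "\<And>w. w \<in> W \<Longrightarrow> (\<And>i. i \<in> I \<Longrightarrow> f i w = \<zero>\<^bsub>V'\<^esub>) \<Longrightarrow> w = \<zero>\<^bsub>V\<^esub>"
  shows "fin_gen k V W"
  using assms(5-)
proof (induction I arbitrary: W rule: finite_induct)
  case empty
  interpret V: module k V by fact
  have "W \<subseteq> {\<zero>\<^bsub>V\<^esub>}" using empty by blast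
  then show ?case unfolding fin_gen_def using lspan_zero[of V k "{}"] by blast
next
  case (insert i I)
  interpret V': module k V' by fact
  let ?K = "{w \<in> W. f i w = \<zero>\<^bsub>V'\<^esub>}"
  note lin = insert.prems(2)[of i, simplified]
  obtain E where "finite E" "E \<subseteq> carrier V'" "carrier V' \<subseteq> lspan k V' E"
    using assms(4) V'.fin_dim_iff unfolding fin_gen_def by blast
  moreover have "submodule (f i ` W) k V'"
    using image_submodule[OF assms(1-3) insert.prems(1) lin] .
  moreover from this have "f i ` W \<subseteq> carrier V'" using V'.submoduleE(1) by blast
  ultimately have "fin_gen k V' (f i ` W)" using subspace_fin_gen[OF assms(1,3)] by (meson order_trans)
  moreover have "fin_gen k V ?K"
  proof (rule insert.IH)
    show "submodule ?K k V" using kernel_submodule[OF assms(1-3) insert.prems(1) lin] .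
    show "linear_on k V V' ?K (f j)" if "j \<in> I" for j
      using insert.prems(2)[of j] that by (auto intro: linear_on_subset)
    show "w = \<zero>\<^bsub>V\<^esub>" if "w \<in> ?K" "\<And>j. j \<in> I \<Longrightarrow> f j w = \<zero>\<^bsub>V'\<^esub>" for w
      using insert.prems(3)[of w] that by auto
  qed
  ultimately show ?case using fin_gen_extension[OF assms(1-3) insert.prems(1) lin] by blast
qed

lemma fin_dim_jointly_injective:
  assumes "field k" "module k V" "module k V'" "fin_dim k V'"
    and "finite I" "\<And>i. i \<in> I \<Longrightarrow> linear_on k V V' (carrier V) (f i)"
    and "\<And>v. v \<in> carrier V \<Longrightarrow> (\<And>i. i \<in> I \<Longrightarrow> f i v = \<zero>\<^bsub>V'\<^esub>) \<Longrightarrow> v = \<zero>\<^bsub>V\<^esub>"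
  shows "fin_dim k V"
proof -
  interpret V: module k V by fact
  have "fin_gen k V (carrier V)"
    by (rule fin_gen_jointly_injective[OF assms(1-5) V.carrier_is_submodule assms(6,7)])
  then show ?thesis using V.fin_dim_iff by blast
qed

section \<open>Categories of modules\<close>

text \<open>The comparison goes through \<open>lspan\<close>, whose rules mention only zero,
  addition and scalar multiplication; the two records may have different extension types.\<close>

lemma fin_dim_cong:
  assumes "module k V" "module k V'" "carrier V' = carrier V"
    "zero V' = zero V" "add V' = add V" "smult V' = smult V"
  shows "fin_dim k V' \<longleftrightarrow> fin_dim k V"
proof -
  have "v \<in> lspan k V E" if "v \<in> lspan k V' E" for v E
    using that by induction (simp_all add: assms lspan.intros)
  moreover have "v \<in> lspan k V' E" if "v \<in> lspan k V E" for v E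
    using that
  proof induction
    case lspan_zero
    show ?case using lspan.lspan_zero[of V' k E] by (simp add: assms)
  next
    case (lspan_step c e v)
    then show ?case using lspan.lspan_step[of c k e E v V'] by (simp add: assms)
  qed
  ultimately have "lspan k V' E = lspan k V E" for E by blast
  then show ?thesis
    using module.fin_dim_iff[OF assms(1)] module.fin_dim_iff[OF assms(2)] assms(3)
    by (simp add: fin_gen_def)
qed

lemma fctr_comp_is_functor:
  assumes "is_functor C D F" "is_functor D E F'"
  shows "is_functor C E (F' \<circ>F F)"
proof -
  interpret F: is_functor C D F by fact
  interpret F': is_functor D E F' by fact
  show ?thesis
    by unfold_locales
      (auto simp: fctr_comp_def F.FObj_closed F'.FObj_closed F.FArr_closed F'.FArr_closed
        F.FArr_Idn F'.FArr_Idn F.FArr_Cmp F'.FArr_Cmp)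
qed

text \<open>Both module categories compose extensional maps of carriers, so the unit and
  associativity laws are proved once for both.\<close>

lemma concrete_category:
  fixes C :: "(('v, 'r) partial_object_scheme, 'v \<Rightarrow> 'v) cat"
  assumes Cmp: "Cmp C = (\<lambda>U V W g f. compose (carrier U) g f)"
    and Idn: "Idn C = (\<lambda>V. restrict id (carrier V))"
    and maps: "\<And>U V f. f \<in> Arr C U V \<Longrightarrow> f \<in> carrier U \<rightarrow>\<^sub>E carrier V"
    and ident: "\<And>V. V \<in> Obj C \<Longrightarrow> restrict id (carrier V) \<in> Arr C V V"
    and comp: "\<And>U V W f g. \<lbrakk>U \<in> Obj C; V \<in> Obj C; W \<in> Obj C; f \<in> Arr C U V; g \<in> Arr C V W\<rbrakk>
      \<Longrightarrow> compose (carrier U) g f \<in> Arr C U W"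
  shows "category C"
proof
  fix a b f assume f: "f \<in> Arr C a b"
  show "Cmp C a a b f (Idn C a) = f"
    using PiE_mem[OF maps[OF f]] PiE_arb[OF maps[OF f]]
    by (simp add: Cmp Idn fun_eq_iff compose_def)
  show "Cmp C a b b (Idn C b) f = f"
    using PiE_mem[OF maps[OF f]] PiE_arb[OF maps[OF f]]
    by (simp add: Cmp Idn fun_eq_iff compose_def)
next
  fix a b c d f g h assume "f \<in> Arr C a b"
  then show "Cmp C a c d h (Cmp C a b c g f) = Cmp C a b d (Cmp C b c d h g) f"
    using PiE_mem[OF maps] by (auto simp: Cmp fun_eq_iff compose_def)
qed (auto simp: Cmp Idn ident comp)

section \<open>Homomorphisms and isomorphisms of modules\<close>

lemma lin_mapsD:
  assumes "f \<in> lin_maps k V W"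
  shows "f \<in> carrier V \<rightarrow>\<^sub>E carrier W"
    and "v \<in> carrier V \<Longrightarrow> f v \<in> carrier W"
    and "\<lbrakk>v \<in> carrier V; w \<in> carrier V\<rbrakk> \<Longrightarrow> f (v \<oplus>\<^bsub>V\<^esub> w) = f v \<oplus>\<^bsub>W\<^esub> f w"
    and "\<lbrakk>c \<in> carrier k; v \<in> carrier V\<rbrakk> \<Longrightarrow> f (c \<odot>\<^bsub>V\<^esub> v) = c \<odot>\<^bsub>W\<^esub> f v"
  using assms by (auto simp: lin_maps_def)

lemma lin_maps_zero:
  assumes "module k V" "module k W" "f \<in> lin_maps k V W"
  shows "f \<zero>\<^bsub>V\<^esub> = \<zero>\<^bsub>W\<^esub>"
proof -
  interpret V: module k V by fact
  interpret W: module k W by fact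
  have "f (\<zero>\<^bsub>k\<^esub> \<odot>\<^bsub>V\<^esub> \<zero>\<^bsub>V\<^esub>) = \<zero>\<^bsub>k\<^esub> \<odot>\<^bsub>W\<^esub> f \<zero>\<^bsub>V\<^esub>" using lin_mapsD(4)[OF assms(3) V.R.zero_closed V.M.zero_closed] .
  then show ?thesis using lin_mapsD(2)[OF assms(3)] by simp
qed

lemma lin_maps_compose:
  assumes "module k U" "f \<in> lin_maps k U V" "g \<in> lin_maps k V W"
  shows "compose (carrier U) g f \<in> lin_maps k U W"
proof -
  interpret U: module k U by fact
  show ?thesis
    using lin_mapsD[OF assms(2)] lin_mapsD(2-)[OF assms(3)]
    by (simp add: lin_maps_def compose_def)
qed

lemma lin_maps_id:
  assumes "module k V"
  shows "restrict id (carrier V) \<in> lin_maps k V V"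
proof -
  interpret V: module k V by fact
  show ?thesis by (auto simp: lin_maps_def)
qed

lemma lin_maps_inverse:
  assumes V: "module k V" and f: "f \<in> lin_maps k V W" and bij: "bij_betw f (carrier V) (carrier W)"
  shows "restrict (inv_into (carrier V) f) (carrier W) \<in> lin_maps k W V"
    (is "?g \<in> _")
proof -
  interpret V: module k V by fact
  have gc: "inv_into (carrier V) f w \<in> carrier V" and fg: "f (inv_into (carrier V) f w) = w"
    if "w \<in> carrier W" for w
    using that bij by (auto simp: bij_betw_def inv_into_into f_inv_into_f)
  have gf: "inv_into (carrier V) f (f v) = v" if "v \<in> carrier V" for v
    using that bij by (simp add: bij_betw_inv_into_left)
  have "w \<oplus>\<^bsub>W\<^esub> w' = f (?g w \<oplus>\<^bsub>V\<^esub> ?g w')" if "w \<in> carrier W" "w' \<in> carrier W" for w w'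
    using that lin_mapsD(3)[OF f] gc fg by simp
  moreover have "c \<odot>\<^bsub>W\<^esub> w = f (c \<odot>\<^bsub>V\<^esub> ?g w)" if "c \<in> carrier k" "w \<in> carrier W" for c w
    using that lin_mapsD(4)[OF f] gc fg by simp
  ultimately show ?thesis
    using gc gf lin_mapsD(2)[OF f] unfolding lin_maps_def by (auto simp: restrict_def)
qed

lemma kG_homD:
  assumes "f \<in> kG_hom k G V W"
  shows "f \<in> lin_maps k V W"
    and "\<lbrakk>g \<in> carrier G; v \<in> carrier V\<rbrakk> \<Longrightarrow> f (act V g v) = act W g (f v)"
  using assms by (auto simp: kG_hom_def)

lemmas kG_hom_lin = lin_mapsD[OF kG_homD(1)]

lemma kG_hom_eqI:
  assumes "f \<in> kG_hom k G V W" "f' \<in> kG_hom k G V W" "\<And>v. v \<in> carrier V \<Longrightarrow> f v = f' v"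
  shows "f = f'"
  using assms kG_hom_lin(1) by (metis PiE_ext)

lemma kG_hom_compose:
  assumes "kG_module k G U" "f \<in> kG_hom k G U V" "g \<in> kG_hom k G V W"
  shows "compose (carrier U) g f \<in> kG_hom k G U W"
proof -
  interpret U: kG_module k G U by fact
  show ?thesis
    using lin_maps_compose[OF U.module_axioms] kG_homD[OF assms(2)] kG_homD[OF assms(3)]
      kG_hom_lin(2)[OF assms(2)] U.act_closed
    by (simp add: kG_hom_def compose_def)
qed

lemma kG_hom_id:
  assumes "kG_module k G V"
  shows "restrict id (carrier V) \<in> kG_hom k G V V"
proof -
  interpret V: kG_module k G V by fact
  show ?thesis using lin_maps_id[OF V.module_axioms] V.act_closed by (simp add: kG_hom_def)
qed

lemma kG_hom_inverse:
  assumes V: "kG_module k G V" and f: "f \<in> kG_hom k G V W"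
    and bij: "bij_betw f (carrier V) (carrier W)"
  shows "restrict (inv_into (carrier V) f) (carrier W) \<in> kG_hom k G W V"
proof -
  interpret V: kG_module k G V by fact
  have "inv_into (carrier V) f (act W g w) = act V g (inv_into (carrier V) f w)"
    and "act W g w \<in> carrier W" if "g \<in> carrier G" "w \<in> carrier W" for g w
  proof -
    have v: "inv_into (carrier V) f w \<in> carrier V" "f (inv_into (carrier V) f w) = w"
      using that bij by (auto simp: bij_betw_def inv_into_into f_inv_into_f)
    then have eq: "act W g w = f (act V g (inv_into (carrier V) f w))"
      using kG_homD(2)[OF f that(1)] by metis
    then show "inv_into (carrier V) f (act W g w) = act V g (inv_into (carrier V) f w)"
      using v that bij V.act_closed by (simp add: bij_betw_inv_into_left)
    show "act W g w \<in> carrier W" using eq v V.act_closed kG_hom_lin(2)[OF f] that by simp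
  qed
  then show ?thesis
    using lin_maps_inverse[OF V.module_axioms kG_homD(1)[OF f] bij] by (simp add: kG_hom_def)
qed

lemma kG_mod_category: "category (kG_mod k G)"
  by (rule concrete_category)
    (auto simp: kG_mod_def kG_hom_lin(1) intro: kG_hom_id kG_hom_compose)

lemma rmod_homD:
  assumes "f \<in> rmod_hom k A V W"
  shows "f \<in> lin_maps k V W"
    and "\<lbrakk>a \<in> carrier A; v \<in> carrier V\<rbrakk> \<Longrightarrow> f (ract V v a) = ract W (f v) a"
  using assms by (auto simp: rmod_hom_def)

lemma rmod_hom_compose:
  assumes "right_module k A U" "f \<in> rmod_hom k A U V" "g \<in> rmod_hom k A V W"
  shows "compose (carrier U) g f \<in> rmod_hom k A U W"
proof -
  interpret U: right_module k A U by fact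
  show ?thesis
    using lin_maps_compose[OF U.module_axioms] rmod_homD[OF assms(2)] rmod_homD[OF assms(3)]
      lin_mapsD(2)[OF rmod_homD(1)[OF assms(2)]] U.ract_closed
    by (simp add: rmod_hom_def compose_def)
qed

lemma rmod_hom_id:
  assumes "right_module k A V"
  shows "restrict id (carrier V) \<in> rmod_hom k A V V"
proof -
  interpret V: right_module k A V by fact
  show ?thesis using lin_maps_id[OF V.module_axioms] V.ract_closed by (simp add: rmod_hom_def)
qed

lemma mod_cat_category: "category (mod_cat k A)"
  by (rule concrete_category)
    (auto simp: mod_cat_def lin_mapsD(1)[OF rmod_homD(1)] intro: rmod_hom_id rmod_hom_compose)

text \<open>Reduces invertibility of the adjunction to bijectivity.\<close>

lemma bij_rmod_hom_is_iso:
  assumes "right_module k A V" "f \<in> rmod_hom k A V W" "bij_betw f (carrier V) (carrier W)"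
  shows "is_iso (mod_cat k A) V W f"
proof -
  interpret V: right_module k A V by fact
  let ?g = "restrict (inv_into (carrier V) f) (carrier W)"
  have "inv_into (carrier V) f (ract W w a) = ract V (inv_into (carrier V) f w) a"
    and "ract W w a \<in> carrier W" if "a \<in> carrier A" "w \<in> carrier W" for a w
  proof -
    have v: "inv_into (carrier V) f w \<in> carrier V" "f (inv_into (carrier V) f w) = w"
      using that assms(3) by (auto simp: bij_betw_def inv_into_into f_inv_into_f)
    then have eq: "ract W w a = f (ract V (inv_into (carrier V) f w) a)"
      using rmod_homD(2)[OF assms(2) that(1)] by metis
    then show "inv_into (carrier V) f (ract W w a) = ract V (inv_into (carrier V) f w) a"
      using v that assms(3) V.ract_closed by (simp add: bij_betw_inv_into_left)
    show "ract W w a \<in> carrier W"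
      using eq v V.ract_closed lin_mapsD(2)[OF rmod_homD(1)[OF assms(2)]] that by simp
  qed
  then have "?g \<in> rmod_hom k A W V"
    using lin_maps_inverse[OF V.module_axioms rmod_homD(1)[OF assms(2)] assms(3)]
    by (simp add: rmod_hom_def)
  moreover have "compose (carrier V) ?g f = restrict id (carrier V)"
    "compose (carrier W) f ?g = restrict id (carrier W)"
    using assms(3) bij_betwE[OF assms(3)]
    by (auto simp: fun_eq_iff compose_def bij_betw_inv_into_left bij_betw_inv_into_right)
  ultimately show ?thesis
    using assms(2) unfolding is_iso_def mod_cat_def by auto
qed

section \<open>The functor Hom(Y, -)\<close>

lemma Hom_functor_sel [simp]:
  "carrier (FObj (Hom_functor k G Y) V) = kG_hom k G Y V"
  "zero (FObj (Hom_functor k G Y) V) = (\<lambda>y \<in> carrier Y. \<zero>\<^bsub>V\<^esub>)"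
  "add (FObj (Hom_functor k G Y) V) = (\<lambda>f f'. \<lambda>y \<in> carrier Y. f y \<oplus>\<^bsub>V\<^esub> f' y)"
  "smult (FObj (Hom_functor k G Y) V) = (\<lambda>c f. \<lambda>y \<in> carrier Y. c \<odot>\<^bsub>V\<^esub> f y)"
  "ract (FObj (Hom_functor k G Y) V) = (\<lambda>f h. compose (carrier Y) f h)"
  "FArr (Hom_functor k G Y) V W t = (\<lambda>f \<in> kG_hom k G Y V. compose (carrier Y) t f)"
  by (simp_all add: Hom_functor_def)

lemma End_alg_sel [simp]:
  "carrier (End_alg k G Y) = kG_hom k G Y Y"
  "monoid.mult (End_alg k G Y) = compose (carrier Y)"
  "one (End_alg k G Y) = restrict id (carrier Y)"
  "zero (End_alg k G Y) = (\<lambda>y \<in> carrier Y. \<zero>\<^bsub>Y\<^esub>)"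
  "add (End_alg k G Y) = (\<lambda>f f'. \<lambda>y \<in> carrier Y. f y \<oplus>\<^bsub>Y\<^esub> f' y)"
  "smult (End_alg k G Y) = (\<lambda>c f. \<lambda>y \<in> carrier Y. c \<odot>\<^bsub>Y\<^esub> f y)"
  by (simp_all add: End_alg_def)

context
  fixes k :: "('k, 'c) ring_scheme" and G :: "('g, 'b) monoid_scheme"
    and Y :: "('k, 'g, 'y) gmodule"
  assumes field_k: "field k" and mod_Y: "kG_module k G Y"
begin

interpretation k: field k by (rule field_k)
interpretation Y: kG_module k G Y by (rule mod_Y)

lemma kG_hom_add:
  assumes "kG_module k G V" "f \<in> kG_hom k G Y V" "f' \<in> kG_hom k G Y V"
  shows "(\<lambda>y \<in> carrier Y. f y \<oplus>\<^bsub>V\<^esub> f' y) \<in> kG_hom k G Y V"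
proof -
  interpret V: kG_module k G V by fact
  show ?thesis
    using kG_hom_lin(2-4)[OF assms(2)] kG_hom_lin(2-4)[OF assms(3)]
      kG_homD(2)[OF assms(2)] kG_homD(2)[OF assms(3)] Y.act_closed
    by (auto simp: kG_hom_def lin_maps_def V.M.a_ac V.smult_r_distr V.act_add)
qed

lemma kG_hom_smult:
  assumes "kG_module k G V" "f \<in> kG_hom k G Y V" "c \<in> carrier k"
  shows "(\<lambda>y \<in> carrier Y. c \<odot>\<^bsub>V\<^esub> f y) \<in> kG_hom k G Y V"
proof -
  interpret V: kG_module k G V by fact
  \<comment> \<open>A scalar multiple of a linear map is linear because k is commutative.\<close>
  have "c \<odot>\<^bsub>V\<^esub> (d \<odot>\<^bsub>V\<^esub> v) = d \<odot>\<^bsub>V\<^esub> (c \<odot>\<^bsub>V\<^esub> v)" if "d \<in> carrier k" "v \<in> carrier V" for d v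
    using that assms(3) by (metis V.smult_assoc1 k.m_comm)
  then show ?thesis
    using kG_hom_lin(2-4)[OF assms(2)] kG_homD(2)[OF assms(2)] Y.act_closed assms(3)
    by (auto simp: kG_hom_def lin_maps_def V.smult_r_distr V.act_smult)
qed

lemma kG_hom_const_zero:
  assumes "kG_module k G V"
  shows "(\<lambda>y \<in> carrier Y. \<zero>\<^bsub>V\<^esub>) \<in> kG_hom k G Y V"
proof -
  interpret V: kG_module k G V by fact
  have "act V g \<zero>\<^bsub>V\<^esub> = \<zero>\<^bsub>V\<^esub>" if "g \<in> carrier G" for g
    using V.act_smult[OF that k.zero_closed V.M.zero_closed] V.act_closed[OF that V.M.zero_closed] by simp
  then show ?thesis
    using Y.act_closed by (auto simp: kG_hom_def lin_maps_def)
qed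

lemma Hom_module:
  assumes V: "kG_module k G V"
  shows "module k (FObj (Hom_functor k G Y) V)"
proof -
  interpret V: kG_module k G V by fact
  note [simp] = kG_hom_lin(2)
  have arb: "f y = undefined" if "f \<in> kG_hom k G Y V" "y \<notin> carrier Y" for f y
    using kG_hom_lin(1)[OF that(1)] that(2) by (rule PiE_arb)
  have neg: "\<exists>h \<in> kG_hom k G Y V. \<forall>y. y \<in> carrier Y \<longrightarrow> f y \<oplus>\<^bsub>V\<^esub> h y = \<zero>\<^bsub>V\<^esub>"
    if "f \<in> kG_hom k G Y V" for f
    using that kG_hom_smult[OF V that, of "\<ominus>\<^bsub>k\<^esub> \<one>\<^bsub>k\<^esub>"]
    by (intro bexI[of _ "\<lambda>y \<in> carrier Y. (\<ominus>\<^bsub>k\<^esub> \<one>\<^bsub>k\<^esub>) \<odot>\<^bsub>V\<^esub> f y"])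
      (auto simp: V.smult_l_minus V.M.r_neg)
  show ?thesis
  proof (rule moduleI)
    show "abelian_group (FObj (Hom_functor k G Y) V)"
      by (rule abelian_groupI)
        (auto simp: kG_hom_add[OF V] kG_hom_const_zero[OF V] V.M.a_ac fun_eq_iff arb neg)
  qed (auto simp: k.cring_axioms kG_hom_smult[OF V] fun_eq_iff arb
      V.smult_l_distr V.smult_r_distr V.smult_assoc1 intro: k.is_cring)
qed

text \<open>The evaluations at finitely many generators of Y take values in V and vanish together
  only on the zero map.\<close>

lemma Hom_fin_dim:
  assumes V: "kG_module k G V"
  shows "fin_dim k (FObj (Hom_functor k G Y) V)"
proof -
  interpret V: kG_module k G V by fact
  obtain E where E: "finite E" "E \<subseteq> carrier Y" "carrier Y \<subseteq> lspan k Y E"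
    using Y.fin_dim unfolding Y.fin_dim_iff fin_gen_def by blast
  show ?thesis
  proof (rule fin_dim_jointly_injective[OF field_k Hom_module[OF V] V.module_axioms V.fin_dim E(1)])
    fix e assume "e \<in> E"
    then have "e \<in> carrier Y" using E(2) by blast
    then show "linear_on k (FObj (Hom_functor k G Y) V) V (carrier (FObj (Hom_functor k G Y) V)) (\<lambda>f. f e)"
      by (simp add: linear_on_def kG_hom_lin(2))
  next
    fix f assume f: "f \<in> carrier (FObj (Hom_functor k G Y) V)"
      and zero: "\<And>e. e \<in> E \<Longrightarrow> f e = \<zero>\<^bsub>V\<^esub>"
    then have fh: "f \<in> kG_hom k G Y V" by simp
    have fz: "f v = \<zero>\<^bsub>V\<^esub>" if "v \<in> lspan k Y E" for v
      using that
    proof induction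
      case lspan_zero
      show ?case using lin_maps_zero[OF Y.module_axioms V.module_axioms kG_homD(1)[OF fh]] .
    next
      case (lspan_step c e v)
      then have "v \<in> carrier Y" "e \<in> carrier Y" using Y.lspan_closed[OF E(2)] E(2) by auto
      then show ?case using lspan_step zero kG_hom_lin(3,4)[OF fh] by simp
    qed
    have "f = (\<lambda>y \<in> carrier Y. \<zero>\<^bsub>V\<^esub>)"
      using fz E(3) by (intro kG_hom_eqI[OF fh kG_hom_const_zero[OF V]]) auto
    then show "f = \<zero>\<^bsub>FObj (Hom_functor k G Y) V\<^esub>" by simp
  qed
qed

lemma Hom_right_module:
  assumes V: "kG_module k G V"
  shows "right_module k (End_alg k G Y) (FObj (Hom_functor k G Y) V)"
proof -
  interpret V: kG_module k G V by fact
  interpret H: module k "FObj (Hom_functor k G Y) V" using V by (rule Hom_module)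
  have arb: "f y = undefined" if "f \<in> kG_hom k G Y V" "y \<notin> carrier Y" for f y
    using kG_hom_lin(1)[OF that(1)] that(2) by (rule PiE_arb)
  show ?thesis
  proof
    show "fin_dim k (FObj (Hom_functor k G Y) V)" using V by (rule Hom_fin_dim)
  qed (use kG_hom_compose[OF mod_Y] in
      \<open>simp_all add: kG_hom_lin(2-4) arb compose_def fun_eq_iff\<close>)
qed

lemma Hom_functor_map:
  assumes V: "kG_module k G V" and t: "t \<in> kG_hom k G V W"
  shows "FArr (Hom_functor k G Y) V W t \<in>
    rmod_hom k (End_alg k G Y) (FObj (Hom_functor k G Y) V) (FObj (Hom_functor k G Y) W)"
  using kG_hom_compose[OF mod_Y _ t] kG_hom_compose[OF mod_Y, of _ Y _ V] kG_hom_lin[OF t]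
    kG_hom_add[OF V] kG_hom_smult[OF V]
  by (simp add: rmod_hom_def lin_maps_def compose_def fun_eq_iff kG_hom_lin(2) cong: if_cong)

lemma Hom_functor_is_functor:
  "is_functor (kG_mod k G) (mod_cat k (End_alg k G Y)) (Hom_functor k G Y)"
proof -
  interpret C: category "kG_mod k G" by (rule kG_mod_category)
  interpret D: category "mod_cat k (End_alg k G Y)" by (rule mod_cat_category)
  have arb: "f y = undefined" if "f \<in> kG_hom k G Y V" "y \<notin> carrier Y" for f y V
    using kG_hom_lin(1)[OF that(1)] that(2) by (rule PiE_arb)
  show ?thesis
  proof
    fix V assume "V \<in> Obj (kG_mod k G)"
    then have V: "kG_module k G V" by (simp add: kG_mod_def)
    then show "FObj (Hom_functor k G Y) V \<in> Obj (mod_cat k (End_alg k G Y))"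
      by (simp add: mod_cat_def Hom_right_module)
    show "FArr (Hom_functor k G Y) V V (Idn (kG_mod k G) V) =
      Idn (mod_cat k (End_alg k G Y)) (FObj (Hom_functor k G Y) V)"
      by (auto simp: kG_mod_def mod_cat_def fun_eq_iff compose_def kG_hom_lin(2) arb)
    fix W f assume "f \<in> Arr (kG_mod k G) V W"
    then have f: "f \<in> kG_hom k G V W" by (simp add: kG_mod_def)
    then show "FArr (Hom_functor k G Y) V W f \<in>
      Arr (mod_cat k (End_alg k G Y)) (FObj (Hom_functor k G Y) V) (FObj (Hom_functor k G Y) W)"
      using Hom_functor_map[OF V f] by (simp add: mod_cat_def)
    fix X g assume "g \<in> Arr (kG_mod k G) W X"
    then have g: "g \<in> kG_hom k G W X" by (simp add: kG_mod_def)
    show "FArr (Hom_functor k G Y) V X (Cmp (kG_mod k G) V W X g f) =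
      Cmp (mod_cat k (End_alg k G Y)) (FObj (Hom_functor k G Y) V) (FObj (Hom_functor k G Y) W)
        (FObj (Hom_functor k G Y) X) (FArr (Hom_functor k G Y) W X g) (FArr (Hom_functor k G Y) V W f)"
      using kG_hom_compose[OF mod_Y _ f]
      by (auto simp: kG_mod_def mod_cat_def fun_eq_iff compose_def[of "kG_hom k G Y V"])
        (auto simp: compose_def kG_hom_lin(2))
  qed
qed

end

section \<open>Restriction of right modules along algebra homomorphisms\<close>

lemma Res_functor_sel [simp]:
  "carrier (FObj (Res_functor \<iota>) V) = carrier V"
  "zero (FObj (Res_functor \<iota>) V) = zero V"
  "add (FObj (Res_functor \<iota>) V) = add V"
  "smult (FObj (Res_functor \<iota>) V) = smult V"
  "ract (FObj (Res_functor \<iota>) V) = (\<lambda>v a. ract V v (\<iota> a))"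
  "FArr (Res_functor \<iota>) V W t = t"
  by (simp_all add: Res_functor_def)

locale algebra_hom =
  fixes k :: "('k, 'c) ring_scheme" and A :: "('k, 'a) module" and A' :: "('k, 'b) module" and \<iota>
  assumes closed: "a \<in> carrier A \<Longrightarrow> \<iota> a \<in> carrier A'"
    and add: "\<lbrakk>a \<in> carrier A; b \<in> carrier A\<rbrakk> \<Longrightarrow> \<iota> (a \<oplus>\<^bsub>A\<^esub> b) = \<iota> a \<oplus>\<^bsub>A'\<^esub> \<iota> b"
    and smult: "\<lbrakk>c \<in> carrier k; a \<in> carrier A\<rbrakk> \<Longrightarrow> \<iota> (c \<odot>\<^bsub>A\<^esub> a) = c \<odot>\<^bsub>A'\<^esub> \<iota> a"
    and mult: "\<lbrakk>a \<in> carrier A; b \<in> carrier A\<rbrakk> \<Longrightarrow> \<iota> (a \<otimes>\<^bsub>A\<^esub> b) = \<iota> a \<otimes>\<^bsub>A'\<^esub> \<iota> b"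
    and one: "\<iota> \<one>\<^bsub>A\<^esub> = \<one>\<^bsub>A'\<^esub>"
begin

lemma Res_right_module:
  assumes "right_module k A' V"
  shows "right_module k A (FObj (Res_functor \<iota>) V)"
proof -
  interpret V: right_module k A' V by fact
  have "module k (FObj (Res_functor \<iota>) V)"
  proof (rule moduleI)
    show "abelian_group (FObj (Res_functor \<iota>) V)"
      by (rule abelian_groupI) (auto simp: V.M.a_ac intro: V.M.l_neg V.M.a_inv_closed)
  qed (auto simp: V.smult_l_distr V.smult_r_distr V.smult_assoc1 intro: V.R.is_cring)
  then interpret R: module k "FObj (Res_functor \<iota>) V" .
  have "fin_dim k (FObj (Res_functor \<iota>) V)"
    using fin_dim_cong[OF V.module_axioms R.module_axioms] V.fin_dim by simp
  then show ?thesis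
    by unfold_locales
      (auto simp: closed add smult mult one V.ract_closed V.ract_add_left V.ract_add_right
        V.ract_smult_left V.ract_smult_right V.ract_one V.ract_mult)
qed

lemma Res_functor_is_functor: "is_functor (mod_cat k A') (mod_cat k A) (Res_functor \<iota>)"
proof -
  interpret C: category "mod_cat k A'" by (rule mod_cat_category)
  interpret D: category "mod_cat k A" by (rule mod_cat_category)
  show ?thesis
    by unfold_locales
      (auto simp: mod_cat_def Res_right_module rmod_hom_def lin_maps_def closed)
qed

end

section \<open>Parabolic subgroups and induced modules\<close>

lemma kG_moduleI:
  assumes "module k V" "group G" "fin_dim k V"
    and "\<And>g v. \<lbrakk>g \<in> carrier G; v \<in> carrier V\<rbrakk> \<Longrightarrow> act V g v \<in> carrier V"
    and "\<And>g v w. \<lbrakk>g \<in> carrier G; v \<in> carrier V; w \<in> carrier V\<rbrakk>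
      \<Longrightarrow> act V g (v \<oplus>\<^bsub>V\<^esub> w) = act V g v \<oplus>\<^bsub>V\<^esub> act V g w"
    and "\<And>g c v. \<lbrakk>g \<in> carrier G; c \<in> carrier k; v \<in> carrier V\<rbrakk>
      \<Longrightarrow> act V g (c \<odot>\<^bsub>V\<^esub> v) = c \<odot>\<^bsub>V\<^esub> act V g v"
    and "\<And>v. v \<in> carrier V \<Longrightarrow> act V \<one>\<^bsub>G\<^esub> v = v"
    and "\<And>g h v. \<lbrakk>g \<in> carrier G; h \<in> carrier G; v \<in> carrier V\<rbrakk>
      \<Longrightarrow> act V (g \<otimes>\<^bsub>G\<^esub> h) v = act V g (act V h v)"
  shows "kG_module k G V"
  using assms by (intro kG_module.intro kG_module_axioms.intro)

lemma (in kG_module) act_zero: "g \<in> carrier G \<Longrightarrow> act V g \<zero>\<^bsub>V\<^esub> = \<zero>\<^bsub>V\<^esub>"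
  using act_smult[of g "\<zero>\<^bsub>k\<^esub>" "\<zero>\<^bsub>V\<^esub>"] act_closed[of g "\<zero>\<^bsub>V\<^esub>"] by simp

lemma lin_maps_finsum:
  assumes "module k V" "module k W" "F \<in> lin_maps k V W" "finite A" "h \<in> A \<rightarrow> carrier V"
  shows "F (\<Oplus>\<^bsub>V\<^esub>t \<in> A. h t) = (\<Oplus>\<^bsub>W\<^esub>t \<in> A. F (h t))"
  using assms(4,5)
proof (induction A rule: finite_induct)
  interpret V: module k V by fact
  interpret W: module k W by fact
  case empty
  then show ?case using lin_maps_zero[OF assms(1-3)] by simp
next
  interpret V: module k V by fact
  interpret W: module k W by fact
  case (insert a A)
  have h: "h a \<in> carrier V" "h \<in> A \<rightarrow> carrier V" using insert.prems by auto
  then have Fh: "(\<lambda>t. F (h t)) \<in> A \<rightarrow> carrier W" "F (h a) \<in> carrier W"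
    using lin_mapsD(2)[OF assms(3)] by auto
  have "F (\<Oplus>\<^bsub>V\<^esub>t \<in> insert a A. h t) = F (h a \<oplus>\<^bsub>V\<^esub> (\<Oplus>\<^bsub>V\<^esub>t \<in> A. h t))"
    using insert.hyps h by (simp add: V.M.finsum_insert)
  also have "\<dots> = F (h a) \<oplus>\<^bsub>W\<^esub> F (\<Oplus>\<^bsub>V\<^esub>t \<in> A. h t)"
    using h by (intro lin_mapsD(3)[OF assms(3)] V.M.finsum_closed)
  also have "\<dots> = (\<Oplus>\<^bsub>W\<^esub>t \<in> insert a A. F (h t))"
    using insert.hyps Fh insert.IH[OF h(2)] by (simp add: W.M.finsum_insert)
  finally show ?case .
qed

text \<open>The semidirect decomposition of P into L and the normal subgroup V, isolated from its
  origin in a BN-pair; in the application V is the p-core of P.\<close>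

locale levi_parabolic = group G for G :: "('g, 'b) monoid_scheme" (structure) +
  fixes P L V :: "'g set"
  assumes P_subgroup: "subgroup P G" and L_subgroup: "subgroup L G" and V_subgroup: "subgroup V G"
    and P_eq: "P = L <#> V"
    and conj_V: "\<lbrakk>g \<in> P; v \<in> V\<rbrakk> \<Longrightarrow> inv g \<otimes> v \<otimes> g \<in> V"
    and L_inter_V: "L \<inter> V = {\<one>}"
begin

interpretation L: subgroup L G by (rule L_subgroup)
interpretation V: subgroup V G by (rule V_subgroup)

lemma P_cases:
  assumes "g \<in> P"
  obtains l v where "l \<in> L" "v \<in> V" "g = l \<otimes> v"
  using assms unfolding P_eq set_mult_def by blast

lemma mult_in_P: "\<lbrakk>l \<in> L; v \<in> V\<rbrakk> \<Longrightarrow> l \<otimes> v \<in> P"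
  unfolding P_eq set_mult_def by blast

lemma L_subset_P: "L \<subseteq> P"
  using mult_in_P[of _ \<one>] by force

lemma V_subset_P: "V \<subseteq> P"
  using mult_in_P[of \<one>] by force

text \<open>The projection onto L along V, written as in \<open>inflate\<close> so that
  \<open>act_inflate\<close> holds by unfolding.\<close>

definition proj :: "'g \<Rightarrow> 'g"
  where "proj g = (THE l. l \<in> L \<and> g \<in> l <# V)"

lemma proj_mult_V:
  assumes "l \<in> L" "v \<in> V"
  shows "proj (l \<otimes> v) = l"
  unfolding proj_def
proof (rule the_equality)
  show "l \<in> L \<and> l \<otimes> v \<in> l <# V" using assms by (auto simp: l_coset_def)
next
  fix l' assume l': "l' \<in> L \<and> l \<otimes> v \<in> l' <# V"
  then obtain v' where v': "v' \<in> V" "l \<otimes> v = l' \<otimes> v'" by (auto simp: l_coset_def)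
  have c: "l \<in> carrier G" "l' \<in> carrier G" "v \<in> carrier G" "v' \<in> carrier G"
    using assms l' v' by auto
  have "inv l' \<otimes> l = inv l' \<otimes> (l \<otimes> v) \<otimes> inv v" using c by (simp add: m_assoc)
  also have "\<dots> = v' \<otimes> inv v" unfolding v'(2) using c by (simp flip: m_assoc)
  finally have eq: "inv l' \<otimes> l = v' \<otimes> inv v" .
  moreover have "inv l' \<otimes> l \<in> L" using assms(1) l' by simp
  moreover have "v' \<otimes> inv v \<in> V" using assms(2) v' by simp
  ultimately have "inv l' \<otimes> l \<in> L \<inter> V" by simp
  then have "inv l' \<otimes> l = \<one>" using L_inter_V by blast
  then show "l' = l" using c by (metis inv_equality inv_inv inv_closed)
qed

lemma proj_closed: "g \<in> P \<Longrightarrow> proj g \<in> L"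
  by (erule P_cases) (simp add: proj_mult_V)

lemma proj_L: "l \<in> L \<Longrightarrow> proj l = l"
  using proj_mult_V[of l \<one>] by simp

lemma proj_V: "v \<in> V \<Longrightarrow> proj v = \<one>"
  using proj_mult_V[of \<one> v] by simp

text \<open>L normalizes V, so v m = m (m^-1 v m) moves the V-part to the right.\<close>

lemma proj_mult:
  assumes "g \<in> P" "h \<in> P"
  shows "proj (g \<otimes> h) = proj g \<otimes> proj h"
proof -
  obtain l v where g: "l \<in> L" "v \<in> V" "g = l \<otimes> v" using assms(1) by (rule P_cases)
  obtain m w where h: "m \<in> L" "w \<in> V" "h = m \<otimes> w" using assms(2) by (rule P_cases)
  have "inv m \<otimes> v \<otimes> m \<in> V" using conj_V g(2) h(1) L_subset_P by blast
  then have "proj ((l \<otimes> m) \<otimes> ((inv m \<otimes> v \<otimes> m) \<otimes> w)) = l \<otimes> m"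
    using g h by (intro proj_mult_V) auto
  moreover have "(l \<otimes> m) \<otimes> ((inv m \<otimes> v \<otimes> m) \<otimes> w) = g \<otimes> h"
    using g h by (simp add: m_assoc) (simp flip: m_assoc)
  ultimately show ?thesis using g h by (simp add: proj_mult_V)
qed

end

text \<open>That Q is a subgroup has to be extracted from the definitions: either some normal
  p-subgroup of Q exists, and normality presupposes a group, or the core is trivial and Q =
  L.\<close>

lemma levi_complement_parabolic:
  assumes "group G" "Q \<subseteq> carrier G" "levi_complement G p Q L"
  shows "levi_parabolic G Q L (p_core G p Q)"
proof -
  interpret group G by fact
  let ?A = "{A. A \<lhd> G\<lparr>carrier := Q\<rparr> \<and> (\<exists>n. card A = p ^ n)}"
  let ?V = "p_core G p Q"
  have L: "subgroup L G" "L \<subseteq> Q" "L \<inter> ?V = {\<one>\<^bsub>G\<^esub>}" "Q = L <#>\<^bsub>G\<^esub> ?V"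
    using assms(3) unfolding levi_complement_def by auto
  have Q: "subgroup Q G"
  proof (cases "?A = {}")
    case True
    then have "\<Union> ?A = {}" by blast
    then have "?V = {\<one>\<^bsub>G\<^esub>}" unfolding p_core_def using generate_empty by metis
    then have "Q = L" using L(1,4) subgroup.subset[OF L(1)]
      by (auto simp: set_mult_def subset_iff)
    then show ?thesis using L by simp
  next
    case False
    then have "group (G\<lparr>carrier := Q\<rparr>)" unfolding normal_def by blast
    then show ?thesis using assms(2) by (rule group_incl_imp_subgroup[rotated])
  qed
  have A: "A \<subseteq> Q" "\<And>g a. \<lbrakk>g \<in> Q; a \<in> A\<rbrakk> \<Longrightarrow> inv\<^bsub>G\<^esub> g \<otimes>\<^bsub>G\<^esub> a \<otimes>\<^bsub>G\<^esub> g \<in> A" if "A \<in> ?A" for A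
  proof -
    have n: "A \<lhd> G\<lparr>carrier := Q\<rparr>" using that by blast
    show "A \<subseteq> Q" using subgroup.subset[OF normal_imp_subgroup[OF n]] by simp
    fix g a assume "g \<in> Q" "a \<in> A"
    then show "inv\<^bsub>G\<^esub> g \<otimes>\<^bsub>G\<^esub> a \<otimes>\<^bsub>G\<^esub> g \<in> A"
      using normal.inv_op_closed1[OF n, of g a] m_inv_consistent[OF Q, of g] by simp
  qed
  have gen: "\<Union> ?A \<subseteq> carrier G" using A(1) assms(2) by blast
  have V: "subgroup ?V G" unfolding p_core_def using gen by (rule generate_is_subgroup)
  have "inv\<^bsub>G\<^esub> g \<otimes>\<^bsub>G\<^esub> v \<otimes>\<^bsub>G\<^esub> g \<in> ?V" if g: "g \<in> Q" and v: "v \<in> ?V" for g v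
    using v unfolding p_core_def
  proof induction
    case one
    then show ?case using g assms(2) by (auto simp: generate.one)
  next
    case (incl h)
    then show ?case using A(2) g by (blast intro: generate.incl)
  next
    case (inv h)
    then obtain A where A': "A \<in> ?A" "h \<in> A" by blast
    then have n: "A \<lhd> G\<lparr>carrier := Q\<rparr>" by blast
    have "inv\<^bsub>G\<^esub> h \<in> A"
      using subgroup.m_inv_closed[OF normal_imp_subgroup[OF n] A'(2)] m_inv_consistent[OF Q, of h]
        A(1)[OF A'(1)] A'(2) by auto
    then show ?case using A(2)[OF A'(1) g] A'(1) by (blast intro: generate.incl)
  next
    case (eng h1 h2)
    have c: "g \<in> carrier G" "h1 \<in> carrier G" "h2 \<in> carrier G"
      using g assms(2) eng generate_in_carrier[OF gen] by auto
    have "inv\<^bsub>G\<^esub> g \<otimes>\<^bsub>G\<^esub> (h1 \<otimes>\<^bsub>G\<^esub> h2) \<otimes>\<^bsub>G\<^esub> g =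
      (inv\<^bsub>G\<^esub> g \<otimes>\<^bsub>G\<^esub> h1 \<otimes>\<^bsub>G\<^esub> g) \<otimes>\<^bsub>G\<^esub> (inv\<^bsub>G\<^esub> g \<otimes>\<^bsub>G\<^esub> h2 \<otimes>\<^bsub>G\<^esub> g)"
      using c by (simp add: m_assoc) (simp flip: m_assoc)
    then show ?case using eng by (auto intro: generate.eng)
  qed
  then show ?thesis
    using Q L V assms(1) by (intro levi_parabolic.intro levi_parabolic_axioms.intro) auto
qed

section \<open>Inflation from a Levi complement\<close>

lemma inflate_sel [simp]:
  "carrier (inflate G p Q L X) = carrier X" "zero (inflate G p Q L X) = zero X"
  "add (inflate G p Q L X) = add X" "smult (inflate G p Q L X) = smult X"
  by (simp_all add: inflate_def)

lemma (in levi_parabolic) act_inflate: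
  assumes "V = p_core G p P"
  shows "act (inflate G p P L X) g = act X (proj g)"
  unfolding inflate_def proj_def assms[symmetric] by simp

lemma inflate_module:
  assumes "levi_parabolic G Q L (p_core G p Q)" "kG_module k (G\<lparr>carrier := L\<rparr>) X"
  shows "kG_module k (G\<lparr>carrier := Q\<rparr>) (inflate G p Q L X)"
proof -
  interpret levi_parabolic G Q L "p_core G p Q" by fact
  interpret X: kG_module k "G\<lparr>carrier := L\<rparr>" X by fact
  have "module k (inflate G p Q L X)"
  proof (rule moduleI)
    show "abelian_group (inflate G p Q L X)"
      by (rule abelian_groupI) (auto simp: X.M.a_ac intro: X.M.l_neg X.M.a_inv_closed)
  qed (auto simp: X.smult_l_distr X.smult_r_distr X.smult_assoc1 intro: X.R.is_cring)
  moreover from this have "fin_dim k (inflate G p Q L X)"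
    using fin_dim_cong[OF X.module_axioms, of "inflate G p Q L X"] X.fin_dim by simp
  moreover have "proj \<one>\<^bsub>G\<^esub> = \<one>\<^bsub>G\<^esub>" using proj_L subgroup.one_closed[OF L_subgroup] by blast
  ultimately show ?thesis
    using subgroup_imp_group[OF P_subgroup] proj_closed proj_mult X.act_one
    by (intro kG_moduleI)
      (auto simp: act_inflate X.act_closed X.act_add X.act_smult X.act_mult[simplified])
qed

lemma (in levi_parabolic) inflate_hom:
  assumes "V = p_core G p P" "h \<in> kG_hom k (G\<lparr>carrier := L\<rparr>) X Y"
  shows "h \<in> kG_hom k (G\<lparr>carrier := P\<rparr>) (inflate G p P L X) (inflate G p P L Y)"
  using kG_homD[OF assms(2)] proj_closed
  by (auto simp: kG_hom_def lin_maps_def act_inflate[OF assms(1)])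

section \<open>Induced modules and Frobenius reciprocity\<close>

lemma ind_module_sel [simp]:
  "carrier (ind_module G P X) = {f \<in> carrier G \<rightarrow>\<^sub>E carrier X.
      \<forall>g \<in> carrier G. \<forall>q \<in> P. f (g \<otimes>\<^bsub>G\<^esub> q) = act X (inv\<^bsub>G\<^esub> q) (f g)}"
  "zero (ind_module G P X) = (\<lambda>g \<in> carrier G. \<zero>\<^bsub>X\<^esub>)"
  "add (ind_module G P X) = (\<lambda>f f'. \<lambda>g \<in> carrier G. f g \<oplus>\<^bsub>X\<^esub> f' g)"
  "smult (ind_module G P X) = (\<lambda>c f. \<lambda>g \<in> carrier G. c \<odot>\<^bsub>X\<^esub> f g)"
  "act (ind_module G P X) = (\<lambda>x f. \<lambda>g \<in> carrier G. f (inv\<^bsub>G\<^esub> x \<otimes>\<^bsub>G\<^esub> g))"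
  by (simp_all add: ind_module_def)

locale induction_data = group G for G :: "('g, 'b) monoid_scheme" (structure) +
  fixes k :: "('k, 'c) ring_scheme" and P :: "'g set" and X :: "('k, 'g, 'x) gmodule"
  assumes finite_G: "finite (carrier G)" and field_k: "field k"
    and P_subgroup: "subgroup P G" and mod_X: "kG_module k (G\<lparr>carrier := P\<rparr>) X"
begin

interpretation k: field k by (rule field_k)
interpretation X: kG_module k "G\<lparr>carrier := P\<rparr>" X by (rule mod_X)
interpretation P: subgroup P G by (rule P_subgroup)

abbreviation I where "I \<equiv> ind_module G P X"

lemmas X_act = X.act_closed[simplified] X.act_add[simplified] X.act_smult[simplified]
  X.act_one[simplified] X.act_zero[simplified]

lemma X_act_mult: "\<lbrakk>g \<in> P; h \<in> P; x \<in> carrier X\<rbrakk> \<Longrightarrow> act X (g \<otimes> h) x = act X g (act X h x)"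
  using X.act_mult by simp

lemma ind_closed: "f \<in> carrier I \<Longrightarrow> g \<in> carrier G \<Longrightarrow> f g \<in> carrier X"
  by auto

lemma ind_arb: "f \<in> carrier I \<Longrightarrow> g \<notin> carrier G \<Longrightarrow> f g = undefined"
  by (simp add: PiE_iff extensional_def)

lemma ind_right: "\<lbrakk>f \<in> carrier I; g \<in> carrier G; q \<in> P\<rbrakk> \<Longrightarrow> f (g \<otimes> q) = act X (inv q) (f g)"
  by auto

lemma indI:
  "\<lbrakk>\<And>g. g \<in> carrier G \<Longrightarrow> f g \<in> carrier X; \<And>g. g \<notin> carrier G \<Longrightarrow> f g = undefined;
    \<And>g q. \<lbrakk>g \<in> carrier G; q \<in> P\<rbrakk> \<Longrightarrow> f (g \<otimes> q) = act X (inv q) (f g)\<rbrakk> \<Longrightarrow> f \<in> carrier I"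
  by (auto simp: PiE_def extensional_def)

lemma ind_eqI:
  assumes "f \<in> carrier I" "f' \<in> carrier I" "\<And>g. g \<in> carrier G \<Longrightarrow> f g = f' g"
  shows "f = f'"
  using assms ind_arb by (metis ext)

lemma ind_zero_closed: "\<zero>\<^bsub>I\<^esub> \<in> carrier I"
  by (rule indI) (auto simp: X_act)

lemma ind_add_closed: "\<lbrakk>f \<in> carrier I; f' \<in> carrier I\<rbrakk> \<Longrightarrow> f \<oplus>\<^bsub>I\<^esub> f' \<in> carrier I"
  by (rule indI) (auto simp: X_act ind_closed ind_right simp del: ind_module_sel(1))

lemma ind_smult_closed: "\<lbrakk>c \<in> carrier k; f \<in> carrier I\<rbrakk> \<Longrightarrow> c \<odot>\<^bsub>I\<^esub> f \<in> carrier I"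
  by (rule indI) (auto simp: X_act ind_closed ind_right simp del: ind_module_sel(1))

lemma ind_act_closed: "\<lbrakk>x \<in> carrier G; f \<in> carrier I\<rbrakk> \<Longrightarrow> act I x f \<in> carrier I"
proof (rule indI)
  note [simp del] = ind_module_sel(1)
  assume x: "x \<in> carrier G" and f: "f \<in> carrier I"
  show "act I x f g \<in> carrier X" if "g \<in> carrier G" for g
    using that x f by (simp add: ind_closed)
  show "act I x f (g \<otimes> q) = act X (inv q) (act I x f g)" if "g \<in> carrier G" "q \<in> P" for g q
    using that x ind_right[OF f, of "inv x \<otimes> g" q] by (simp add: m_assoc)
qed simp

lemma ind_is_module: "module k I"
proof (rule moduleI)
  note [simp del] = ind_module_sel(1)
  note [simp] = ind_closed ind_arb
  show "cring k" by (rule k.is_cring)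
  show "abelian_group I"
  proof (rule abelian_groupI)
    fix f assume f: "f \<in> carrier I"
    have "(\<ominus>\<^bsub>k\<^esub> \<one>\<^bsub>k\<^esub>) \<odot>\<^bsub>I\<^esub> f \<oplus>\<^bsub>I\<^esub> f = \<zero>\<^bsub>I\<^esub>"
      using f by (auto simp: fun_eq_iff X.smult_l_minus X.M.l_neg)
    moreover have "(\<ominus>\<^bsub>k\<^esub> \<one>\<^bsub>k\<^esub>) \<odot>\<^bsub>I\<^esub> f \<in> carrier I" using f by (intro ind_smult_closed) auto
    ultimately show "\<exists>h \<in> carrier I. h \<oplus>\<^bsub>I\<^esub> f = \<zero>\<^bsub>I\<^esub>" by blast
    show "\<zero>\<^bsub>I\<^esub> \<oplus>\<^bsub>I\<^esub> f = f" using f by (auto simp: fun_eq_iff)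
  next
    fix f f' assume "f \<in> carrier I" "f' \<in> carrier I"
    then show "f \<oplus>\<^bsub>I\<^esub> f' = f' \<oplus>\<^bsub>I\<^esub> f" by (auto simp: fun_eq_iff X.M.a_comm)
    fix f'' assume "f'' \<in> carrier I"
    with \<open>f \<in> carrier I\<close> \<open>f' \<in> carrier I\<close>
    show "f \<oplus>\<^bsub>I\<^esub> f' \<oplus>\<^bsub>I\<^esub> f'' = f \<oplus>\<^bsub>I\<^esub> (f' \<oplus>\<^bsub>I\<^esub> f'')" by (auto simp: fun_eq_iff X.M.a_assoc)
  qed (use ind_zero_closed ind_add_closed in auto)
  show "c \<odot>\<^bsub>I\<^esub> f \<in> carrier I" if "c \<in> carrier k" "f \<in> carrier I" for c f
    using that by (rule ind_smult_closed)
qed (auto simp: fun_eq_iff ind_closed ind_arb X.smult_l_distr X.smult_r_distr X.smult_assoc1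
    simp del: ind_module_sel(1))

lemma ind_kG_module: "kG_module k G I"
proof (rule kG_moduleI)
  note [simp del] = ind_module_sel(1)
  note [simp] = ind_closed ind_arb
  show "module k I" by (rule ind_is_module)
  show "group G" by (rule is_group)
  \<comment> \<open>Evaluation at the elements of G embeds the induced module into finitely many
    copies of X.\<close>
  show "fin_dim k I"
  proof (rule fin_dim_jointly_injective[OF field_k ind_is_module X.module_axioms X.fin_dim finite_G])
    show "linear_on k I X (carrier I) (\<lambda>f. f g)" if "g \<in> carrier G" for g
      using that by (simp add: linear_on_def)
    fix f assume f: "f \<in> carrier I" and zero: "\<And>g. g \<in> carrier G \<Longrightarrow> f g = \<zero>\<^bsub>X\<^esub>"
    show "f = \<zero>\<^bsub>I\<^esub>" by (rule ind_eqI[OF f ind_zero_closed]) (simp add: zero)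
  qed
  show "act I x f \<in> carrier I" if "x \<in> carrier G" "f \<in> carrier I" for x f
    using that by (rule ind_act_closed)
  show "act I \<one> f = f" if "f \<in> carrier I" for f
    using that by (auto simp: fun_eq_iff)
  show "act I (g \<otimes> h) f = act I g (act I h f)"
    if "g \<in> carrier G" "h \<in> carrier G" "f \<in> carrier I" for g h f
    using that by (auto simp: fun_eq_iff inv_mult_group m_assoc)
qed (auto simp: fun_eq_iff)

text \<open>\<open>unit_fun x\<close> corresponds to the tensor \<open>1 \<otimes> x\<close>.\<close>

definition unit_fun :: "'x \<Rightarrow> 'g \<Rightarrow> 'x"
  where "unit_fun x = (\<lambda>g \<in> carrier G. if g \<in> P then act X (inv g) x else \<zero>\<^bsub>X\<^esub>)"

lemma mult_P_iff: "\<lbrakk>g \<in> carrier G; q \<in> P\<rbrakk> \<Longrightarrow> g \<otimes> q \<in> P \<longleftrightarrow> g \<in> P"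
proof
  assume g: "g \<in> carrier G" and q: "q \<in> P" and "g \<otimes> q \<in> P"
  then have "g \<otimes> q \<otimes> inv q \<in> P" by blast
  then show "g \<in> P" using g q by (simp add: m_assoc)
qed auto

lemma unit_fun_closed: "x \<in> carrier X \<Longrightarrow> unit_fun x \<in> carrier I"
  by (rule indI) (auto simp: unit_fun_def mult_P_iff X_act X_act_mult inv_mult_group)

lemma unit_fun_add:
  "\<lbrakk>x \<in> carrier X; y \<in> carrier X\<rbrakk> \<Longrightarrow> unit_fun (x \<oplus>\<^bsub>X\<^esub> y) = unit_fun x \<oplus>\<^bsub>I\<^esub> unit_fun y"
  by (auto simp: unit_fun_def fun_eq_iff X_act)

lemma unit_fun_smult:
  "\<lbrakk>c \<in> carrier k; x \<in> carrier X\<rbrakk> \<Longrightarrow> unit_fun (c \<odot>\<^bsub>X\<^esub> x) = c \<odot>\<^bsub>I\<^esub> unit_fun x"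
  by (auto simp: unit_fun_def fun_eq_iff X_act)

lemma unit_fun_act:
  assumes "q \<in> P" "x \<in> carrier X"
  shows "unit_fun (act X q x) = act I q (unit_fun x)"
proof -
  have "inv q \<otimes> g \<in> P \<longleftrightarrow> g \<in> P" if "g \<in> carrier G" for g
  proof
    assume "inv q \<otimes> g \<in> P"
    then have "q \<otimes> (inv q \<otimes> g) \<in> P" using assms by blast
    then show "g \<in> P" using that assms by (simp flip: m_assoc)
  qed (use assms in auto)
  then show ?thesis
    using assms by (auto simp: unit_fun_def fun_eq_iff inv_mult_group X_act_mult)
qed

text \<open>The choice is made from the coset g P and not from g, so it is constant on cosets
  (\<open>rep_cong\<close>) and its values form a transversal.\<close>

definition rep :: "'g \<Rightarrow> 'g"
  where "rep g = (SOME h. h \<in> g <# P)"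

lemma rep_mem: "g \<in> carrier G \<Longrightarrow> rep g \<in> g <# P"
  unfolding rep_def by (rule someI[of _ g]) (auto simp: l_coset_def intro!: bexI[of _ \<one>])

lemma rep_closed: "g \<in> carrier G \<Longrightarrow> rep g \<in> carrier G"
  using rep_mem[of g] by (auto simp: l_coset_def)

lemma rep_cong: "\<lbrakk>g \<in> carrier G; q \<in> P\<rbrakk> \<Longrightarrow> rep (g \<otimes> q) = rep g"
proof -
  assume g: "g \<in> carrier G" and q: "q \<in> P"
  have "g \<otimes> q <# P = g <# (q <# P)" using g q P.subset by (simp add: lcos_m_assoc)
  also have "q <# P = P" using coset_join3[OF _ P_subgroup q] q by simp
  finally show ?thesis by (simp add: rep_def)
qed

lemma rep_split:
  assumes "g \<in> carrier G"
  obtains q where "q \<in> P" "rep g = g \<otimes> q"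
  using rep_mem[OF assms] by (auto simp: l_coset_def)

definition transv :: "'g set"
  where "transv = rep ` carrier G"

lemma finite_transv: "finite transv"
  using finite_G by (simp add: transv_def)

lemma transv_closed: "t \<in> transv \<Longrightarrow> t \<in> carrier G"
  using rep_closed by (auto simp: transv_def)

lemma rep_transv: "t \<in> transv \<Longrightarrow> rep t = t"
proof -
  assume "t \<in> transv"
  then obtain g where g: "g \<in> carrier G" "t = rep g" by (auto simp: transv_def)
  obtain q where "q \<in> P" "rep g = g \<otimes> q" using rep_split[OF g(1)] by blast
  then show ?thesis using rep_cong[OF g(1)] g(2) by metis
qed

lemma transv_iff:
  assumes "g \<in> carrier G" "t \<in> transv"
  shows "inv t \<otimes> g \<in> P \<longleftrightarrow> rep g = t"
proof
  have t: "t \<in> carrier G" using transv_closed assms by simp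
  assume "inv t \<otimes> g \<in> P"
  then have "rep (t \<otimes> (inv t \<otimes> g)) = rep t" using rep_cong t by blast
  then show "rep g = t" using t assms rep_transv by (simp flip: m_assoc)
next
  assume r: "rep g = t"
  obtain q where q: "q \<in> P" "rep g = g \<otimes> q" using rep_split[OF assms(1)] by blast
  have "inv t \<otimes> g = inv q" using q assms(1) by (simp add: r[symmetric] inv_mult_group m_assoc)
  then show "inv t \<otimes> g \<in> P" using q by simp
qed

lemma finsum_ind_apply:
  assumes "finite A" "h \<in> A \<rightarrow> carrier I" "g \<in> carrier G"
  shows "(\<Oplus>\<^bsub>I\<^esub>t \<in> A. h t) g = (\<Oplus>\<^bsub>X\<^esub>t \<in> A. h t g)"
  using assms(1,2)
proof (induction A rule: finite_induct)
  interpret I: kG_module k G I by (rule ind_kG_module)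
  case empty
  then show ?case using assms(3) by simp
next
  interpret I: kG_module k G I by (rule ind_kG_module)
  case (insert a A)
  have h: "h a \<in> carrier I" "h \<in> A \<rightarrow> carrier I" using insert.prems by auto
  then have hX: "(\<lambda>t. h t g) \<in> A \<rightarrow> carrier X" "h a g \<in> carrier X"
    using ind_closed[OF _ assms(3)] by (auto simp del: ind_module_sel(1))
  have "(\<Oplus>\<^bsub>I\<^esub>t \<in> insert a A. h t) = h a \<oplus>\<^bsub>I\<^esub> (\<Oplus>\<^bsub>I\<^esub>t \<in> A. h t)"
    using insert.hyps h by (intro I.M.finsum_insert)
  moreover have "(\<Oplus>\<^bsub>X\<^esub>t \<in> insert a A. h t g) = h a g \<oplus>\<^bsub>X\<^esub> (\<Oplus>\<^bsub>X\<^esub>t \<in> A. h t g)"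
    using insert.hyps hX by (intro X.M.finsum_insert)
  ultimately show ?case using insert.IH[OF h(2)] assms(3) by simp
qed

text \<open>At g the summand of t vanishes unless t represents g P, and for that t the equivariance
  of f returns f(g).\<close>

lemma ind_expand:
  assumes f: "f \<in> carrier I"
  shows "f = (\<Oplus>\<^bsub>I\<^esub>t \<in> transv. act I t (unit_fun (f t)))"
proof -
  interpret I: kG_module k G I by (rule ind_kG_module)
  note [simp del] = ind_module_sel(1)
  have h: "(\<lambda>t. act I t (unit_fun (f t))) \<in> transv \<rightarrow> carrier I"
    using ind_act_closed unit_fun_closed ind_closed[OF f] transv_closed by blast
  show ?thesis
  proof (rule ind_eqI[OF f])
    show "(\<Oplus>\<^bsub>I\<^esub>t \<in> transv. act I t (unit_fun (f t))) \<in> carrier I"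
      using h by (rule I.M.finsum_closed)
    fix g assume g: "g \<in> carrier G"
    have term_eq: "act I t (unit_fun (f t)) g = (if rep g = t then f g else \<zero>\<^bsub>X\<^esub>)" if t: "t \<in> transv" for t
    proof -
      have tc: "t \<in> carrier G" using t by (rule transv_closed)
      have "f (t \<otimes> (inv t \<otimes> g)) = act X (inv (inv t \<otimes> g)) (f t)" if "inv t \<otimes> g \<in> P"
        using ind_right[OF f tc that] .
      then show ?thesis
        using g tc transv_iff[OF g t] by (simp add: unit_fun_def flip: m_assoc)
    qed
    have "(\<Oplus>\<^bsub>I\<^esub>t \<in> transv. act I t (unit_fun (f t))) g
      = (\<Oplus>\<^bsub>X\<^esub>t \<in> transv. act I t (unit_fun (f t)) g)"
      using finite_transv h g by (rule finsum_ind_apply)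
    also have "\<dots> = (\<Oplus>\<^bsub>X\<^esub>t \<in> transv. if rep g = t then f g else \<zero>\<^bsub>X\<^esub>)"
      using term_eq ind_closed[OF f g] by (intro X.M.finsum_cong') auto
    also have "\<dots> = f g"
      using X.M.finsum_singleton[of "rep g" transv "\<lambda>_. f g"] finite_transv g ind_closed[OF f g]
      by (simp add: transv_def)
    finally show "f g = (\<Oplus>\<^bsub>I\<^esub>t \<in> transv. act I t (unit_fun (f t))) g" ..
  qed
qed

text \<open>The translates of unit functions span, by \<open>ind_expand\<close>. This is the
  uniqueness half of Frobenius reciprocity.\<close>

lemma ind_hom_eqI:
  assumes V: "kG_module k G V" and F: "F \<in> kG_hom k G I V" and F': "F' \<in> kG_hom k G I V"
    and eq: "\<And>x. x \<in> carrier X \<Longrightarrow> F (unit_fun x) = F' (unit_fun x)"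
  shows "F = F'"
proof (rule kG_hom_eqI[OF F F'])
  interpret V: kG_module k G V by fact
  fix f assume f: "f \<in> carrier I"
  have h: "(\<lambda>t. act I t (unit_fun (f t))) \<in> transv \<rightarrow> carrier I"
    using ind_act_closed unit_fun_closed ind_closed[OF f] transv_closed by blast
  have "F (act I t (unit_fun (f t))) = F' (act I t (unit_fun (f t)))" if "t \<in> transv" for t
    using kG_homD(2)[OF F] kG_homD(2)[OF F'] unit_fun_closed eq ind_closed[OF f] transv_closed[OF that]
    by (simp del: ind_module_sel)
  moreover have "F' (act I t (unit_fun (f t))) \<in> carrier V" if "t \<in> transv" for t
    using h that kG_hom_lin(2)[OF F'] by blast
  ultimately have "(\<Oplus>\<^bsub>V\<^esub>t \<in> transv. F (act I t (unit_fun (f t)))) = (\<Oplus>\<^bsub>V\<^esub>t \<in> transv. F' (act I t (unit_fun (f t))))"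
    by (intro V.M.finsum_cong') auto
  then show "F f = F' f"
    using lin_maps_finsum[OF ind_is_module V.module_axioms kG_homD(1)[OF F] finite_transv h]
      lin_maps_finsum[OF ind_is_module V.module_axioms kG_homD(1)[OF F'] finite_transv h]
      ind_expand[OF f] by simp
qed

text \<open>Forced by \<open>ind_expand\<close>: a homomorphism that takes the value \<psi>(x) at
  the unit function of x can have no other value at f. By \<open>extend_term_right\<close> the
  summands depend only on the cosets.\<close>

definition extend :: "('k, 'g, 'v) gmodule \<Rightarrow> ('x \<Rightarrow> 'v) \<Rightarrow> ('g \<Rightarrow> 'x) \<Rightarrow> 'v"
  where "extend V \<psi> = (\<lambda>f \<in> carrier I. \<Oplus>\<^bsub>V\<^esub>t \<in> transv. act V t (\<psi> (f t)))"

context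
  fixes V :: "('k, 'g, 'v) gmodule" and \<psi>
  assumes mod_V: "kG_module k G V" and psi: "\<psi> \<in> kG_hom k (G\<lparr>carrier := P\<rparr>) X V"
begin

interpretation V: kG_module k G V by (rule mod_V)

lemma psi_facts:
  "x \<in> carrier X \<Longrightarrow> \<psi> x \<in> carrier V"
  "\<lbrakk>q \<in> P; x \<in> carrier X\<rbrakk> \<Longrightarrow> \<psi> (act X q x) = act V q (\<psi> x)"
  using kG_hom_lin(2)[OF psi] kG_homD(2)[OF psi] by auto

lemma extend_term_closed:
  "\<lbrakk>f \<in> carrier I; g \<in> carrier G\<rbrakk> \<Longrightarrow> act V g (\<psi> (f g)) \<in> carrier V"
  by (simp add: V.act_closed psi_facts ind_closed del: ind_module_sel)

lemma extend_term_right: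
  assumes "f \<in> carrier I" "g \<in> carrier G" "q \<in> P"
  shows "act V (g \<otimes> q) (\<psi> (f (g \<otimes> q))) = act V g (\<psi> (f g))"
proof -
  have "\<psi> (f (g \<otimes> q)) = act V (inv q) (\<psi> (f g))"
    using ind_right[OF assms] psi_facts(2) ind_closed[OF assms(1,2)] assms(3) by simp
  moreover have "\<psi> (f g) \<in> carrier V" using psi_facts(1) ind_closed[OF assms(1,2)] .
  ultimately have "act V (g \<otimes> q) (\<psi> (f (g \<otimes> q))) = act V ((g \<otimes> q) \<otimes> inv q) (\<psi> (f g))"
    using assms by (simp add: V.act_mult)
  then show ?thesis using assms by (simp add: m_assoc)
qed

text \<open>Sending t to the representative of x^-1 t permutes the transversal. As each summand
  depends only on its coset, this reindexing turns the sum for the translate of f into x applied to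
  the sum for f.\<close>

lemma extend_act:
  assumes x: "x \<in> carrier G" and f: "f \<in> carrier I"
  shows "extend V \<psi> (act I x f) = act V x (extend V \<psi> f)"
proof -
  let ?c = "\<lambda>g. act V x (act V g (\<psi> (f g)))"
  let ?\<sigma> = "\<lambda>t. rep (inv x \<otimes> t)"
  have \<sigma>: "?\<sigma> ` transv \<subseteq> transv" using x transv_closed by (auto simp: transv_def)
  have inj: "inj_on ?\<sigma> transv"
  proof
    fix t t' assume t: "t \<in> transv" "t' \<in> transv" and eq: "?\<sigma> t = ?\<sigma> t'"
    have tc: "t \<in> carrier G" "t' \<in> carrier G" using t transv_closed by auto
    obtain q where q: "q \<in> P" "?\<sigma> t = inv x \<otimes> t \<otimes> q" using rep_split[of "inv x \<otimes> t"] x tc by auto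
    obtain q' where q': "q' \<in> P" "?\<sigma> t' = inv x \<otimes> t' \<otimes> q'" using rep_split[of "inv x \<otimes> t'"] x tc by auto
    have "inv x \<otimes> (t \<otimes> q) = inv x \<otimes> (t' \<otimes> q')" using q q' eq x tc by (simp add: m_assoc)
    then have "t \<otimes> q = t' \<otimes> q'" using x tc q q' by simp
    then have "rep t = rep t'" using rep_cong[OF tc(1) q(1)] rep_cong[OF tc(2) q'(1)] by simp
    then show "t = t'" using rep_transv t by simp
  qed
  have surj: "?\<sigma> ` transv = transv" using endo_inj_surj[OF finite_transv \<sigma> inj] .
  have c_rep: "?c (rep g) = ?c g" if g: "g \<in> carrier G" for g
  proof -
    obtain q where "q \<in> P" "rep g = g \<otimes> q" using rep_split[OF g] by blast
    then show ?thesis using extend_term_right[OF f g] by simp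
  qed
  have c_closed: "?c \<in> carrier G \<rightarrow> carrier V"
    using V.act_closed[OF x] extend_term_closed[OF f] by blast
  have "act V t (\<psi> (act I x f t)) = ?c (?\<sigma> t)" if t: "t \<in> transv" for t
  proof -
    have tc: "t \<in> carrier G" using transv_closed t .
    have "?c (inv x \<otimes> t) = act V (x \<otimes> (inv x \<otimes> t)) (\<psi> (f (inv x \<otimes> t)))"
      using x tc psi_facts(1) ind_closed[OF f] by (subst V.act_mult) auto
    also have "\<dots> = act V t (\<psi> (act I x f t))" using x tc by (simp flip: m_assoc)
    finally show ?thesis using c_rep x tc by simp
  qed
  then have "(\<Oplus>\<^bsub>V\<^esub>t \<in> transv. act V t (\<psi> (act I x f t))) = (\<Oplus>\<^bsub>V\<^esub>t \<in> transv. ?c (?\<sigma> t))"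
    using c_closed rep_closed x transv_closed by (intro V.M.finsum_cong') (auto simp: Pi_iff)
  also have "\<dots> = (\<Oplus>\<^bsub>V\<^esub>t \<in> ?\<sigma> ` transv. ?c t)"
    using c_closed \<sigma> transv_closed inj by (intro V.M.finsum_reindex[symmetric]) (auto simp: Pi_iff)
  also have "\<dots> = (\<Oplus>\<^bsub>V\<^esub>t \<in> transv. ?c t)" unfolding surj ..
  also have "\<dots> = act V x (\<Oplus>\<^bsub>V\<^esub>t \<in> transv. act V t (\<psi> (f t)))"
  proof -
    have "restrict (act V x) (carrier V) \<in> lin_maps k V V"
      using x by (auto simp: lin_maps_def V.act_closed V.act_add V.act_smult)
    from lin_maps_finsum[OF V.module_axioms V.module_axioms this finite_transv,
      of "\<lambda>t. act V t (\<psi> (f t))"]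
    have "act V x (\<Oplus>\<^bsub>V\<^esub>t \<in> transv. act V t (\<psi> (f t)))
      = (\<Oplus>\<^bsub>V\<^esub>t \<in> transv. restrict (act V x) (carrier V) (act V t (\<psi> (f t))))"
      using extend_term_closed[OF f] transv_closed V.M.finsum_closed[of "\<lambda>t. act V t (\<psi> (f t))" transv]
      by (simp add: Pi_iff)
    also have "\<dots> = (\<Oplus>\<^bsub>V\<^esub>t \<in> transv. ?c t)"
      using extend_term_closed[OF f] c_closed transv_closed
      by (intro V.M.finsum_cong') (auto simp: Pi_iff)
    finally show ?thesis ..
  qed
  finally show ?thesis using f ind_act_closed[OF x f] by (simp add: extend_def del: ind_module_sel)
qed

lemma extend_hom: "extend V \<psi> \<in> kG_hom k G I V"
proof -
  interpret I: kG_module k G I by (rule ind_kG_module)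
  note [simp del] = ind_module_sel(1)
  have closed: "(\<lambda>t. act V t (\<psi> (f t))) \<in> transv \<rightarrow> carrier V" if "f \<in> carrier I" for f
    using extend_term_closed[OF that] transv_closed by blast
  have add: "act V t (\<psi> ((f \<oplus>\<^bsub>I\<^esub> f') t)) = act V t (\<psi> (f t)) \<oplus>\<^bsub>V\<^esub> act V t (\<psi> (f' t))"
    if "f \<in> carrier I" "f' \<in> carrier I" "t \<in> transv" for f f' t
    using that transv_closed by (simp add: kG_hom_lin(3)[OF psi] V.act_add psi_facts ind_closed)
  have smult: "act V t (\<psi> ((c \<odot>\<^bsub>I\<^esub> f) t)) = c \<odot>\<^bsub>V\<^esub> act V t (\<psi> (f t))"
    if "c \<in> carrier k" "f \<in> carrier I" "t \<in> transv" for c f t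
    using that transv_closed by (simp add: kG_hom_lin(4)[OF psi] V.act_smult psi_facts ind_closed)
  have "extend V \<psi> (f \<oplus>\<^bsub>I\<^esub> f') = extend V \<psi> f \<oplus>\<^bsub>V\<^esub> extend V \<psi> f'"
    if f: "f \<in> carrier I" "f' \<in> carrier I" for f f'
  proof -
    have "(\<Oplus>\<^bsub>V\<^esub>t \<in> transv. act V t (\<psi> ((f \<oplus>\<^bsub>I\<^esub> f') t)))
      = (\<Oplus>\<^bsub>V\<^esub>t \<in> transv. act V t (\<psi> (f t)) \<oplus>\<^bsub>V\<^esub> act V t (\<psi> (f' t)))"
      using add[OF f] closed[OF f(1)] closed[OF f(2)] by (intro V.M.finsum_cong') (auto simp: Pi_iff)
    also have "\<dots> = (\<Oplus>\<^bsub>V\<^esub>t \<in> transv. act V t (\<psi> (f t))) \<oplus>\<^bsub>V\<^esub> (\<Oplus>\<^bsub>V\<^esub>t \<in> transv. act V t (\<psi> (f' t)))"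
      using closed f by (intro V.M.finsum_addf)
    finally show ?thesis using f ind_add_closed[OF f] by (simp add: extend_def)
  qed
  moreover have "extend V \<psi> (c \<odot>\<^bsub>I\<^esub> f) = c \<odot>\<^bsub>V\<^esub> extend V \<psi> f"
    if c: "c \<in> carrier k" and f: "f \<in> carrier I" for c f
  proof -
    have "(\<Oplus>\<^bsub>V\<^esub>t \<in> transv. act V t (\<psi> ((c \<odot>\<^bsub>I\<^esub> f) t)))
      = (\<Oplus>\<^bsub>V\<^esub>t \<in> transv. c \<odot>\<^bsub>V\<^esub> act V t (\<psi> (f t)))"
      using smult[OF c f] closed[OF f] c by (intro V.M.finsum_cong') (auto simp: Pi_iff)
    also have "\<dots> = c \<odot>\<^bsub>V\<^esub> (\<Oplus>\<^bsub>V\<^esub>t \<in> transv. act V t (\<psi> (f t)))"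
      using closed[OF f] c finite_transv by (intro V.finsum_smult_ldistr[symmetric])
    finally show ?thesis using f ind_smult_closed[OF c f] by (simp add: extend_def)
  qed
  moreover have "extend V \<psi> \<in> carrier I \<rightarrow>\<^sub>E carrier V"
    using closed V.M.finsum_closed unfolding extend_def by auto
  ultimately show ?thesis using extend_act by (simp add: kG_hom_def lin_maps_def del: ind_module_sel)
qed

lemma extend_unit_fun:
  assumes x: "x \<in> carrier X"
  shows "extend V \<psi> (unit_fun x) = \<psi> x"
proof -
  \<comment> \<open>Only the summand of the coset P survives. Its representative need not be 1, but
    lies in P and cancels against the action inside \<open>unit_fun\<close>.\<close>
  have term_eq: "act V t (\<psi> (unit_fun x t)) = (if rep \<one> = t then \<psi> x else \<zero>\<^bsub>V\<^esub>)" if t: "t \<in> transv" for t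
  proof -
    have tc: "t \<in> carrier G" using t by (rule transv_closed)
    have "t \<in> P \<longleftrightarrow> inv t \<in> P" using tc P.m_inv_closed[of t] P.m_inv_closed[of "inv t"] by auto
    then have iff: "t \<in> P \<longleftrightarrow> rep \<one> = t" using transv_iff[OF one_closed t] tc by simp
    show ?thesis
    proof (cases "t \<in> P")
      case True
      then have "act V t (\<psi> (act X (inv t) x)) = act V (t \<otimes> inv t) (\<psi> x)"
        using x tc psi_facts True V.act_mult[of t "inv t" "\<psi> x"] by simp
      then show ?thesis using True iff tc x psi_facts(1) by (simp add: unit_fun_def V.act_one)
    next
      case False
      then show ?thesis
        using iff tc lin_maps_zero[OF X.module_axioms V.module_axioms kG_homD(1)[OF psi]]
        by (simp add: unit_fun_def V.act_zero)
    qed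
  qed
  have "extend V \<psi> (unit_fun x) = (\<Oplus>\<^bsub>V\<^esub>t \<in> transv. act V t (\<psi> (unit_fun x t)))"
    using unit_fun_closed[OF x] by (simp add: extend_def)
  also have "\<dots> = (\<Oplus>\<^bsub>V\<^esub>t \<in> transv. if rep \<one> = t then \<psi> x else \<zero>\<^bsub>V\<^esub>)"
    using term_eq psi_facts(1)[OF x] by (intro V.M.finsum_cong') auto
  also have "\<dots> = \<psi> x"
    using V.M.finsum_singleton[of "rep \<one>" transv "\<lambda>_. \<psi> x"] finite_transv psi_facts(1)[OF x]
    by (simp add: transv_def)
  finally show ?thesis .
qed

end

lemma unit_fun_hom:
  assumes V: "kG_module k G V" and F: "F \<in> kG_hom k G I V"
  shows "(\<lambda>x \<in> carrier X. F (unit_fun x)) \<in> kG_hom k (G\<lparr>carrier := P\<rparr>) X V"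
proof -
  interpret V: kG_module k G V by fact
  show ?thesis
    using unit_fun_closed kG_hom_lin(2-4)[OF F] kG_homD(2)[OF F]
    by (simp add: kG_hom_def lin_maps_def unit_fun_add unit_fun_smult unit_fun_act X_act
        del: ind_module_sel)
qed

lemma frobenius_reciprocity:
  assumes V: "kG_module k G V"
  shows "bij_betw (\<lambda>F. \<lambda>x \<in> carrier X. F (unit_fun x))
    (kG_hom k G I V) (kG_hom k (G\<lparr>carrier := P\<rparr>) X V)"
proof (rule bij_betwI[where g = "extend V"])
  show "(\<lambda>F. \<lambda>x \<in> carrier X. F (unit_fun x)) \<in> kG_hom k G I V \<rightarrow> kG_hom k (G\<lparr>carrier := P\<rparr>) X V"
    using unit_fun_hom[OF V] by blast
  show "extend V \<in> kG_hom k (G\<lparr>carrier := P\<rparr>) X V \<rightarrow> kG_hom k G I V"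
    using extend_hom[OF V] by blast
  fix F assume F: "F \<in> kG_hom k G I V"
  show "extend V (\<lambda>x \<in> carrier X. F (unit_fun x)) = F"
    using extend_unit_fun[OF V unit_fun_hom[OF V F]]
    by (intro ind_hom_eqI[OF V extend_hom[OF V unit_fun_hom[OF V F]] F]) simp
next
  fix \<psi> assume psi: "\<psi> \<in> kG_hom k (G\<lparr>carrier := P\<rparr>) X V"
  show "(\<lambda>x \<in> carrier X. extend V \<psi> (unit_fun x)) = \<psi>"
    using PiE_arb[OF kG_hom_lin(1)[OF psi]] extend_unit_fun[OF V psi] by (auto simp: fun_eq_iff)
qed

end

section \<open>The adjunction\<close>

lemma HC_res_sel [simp]:
  "carrier (FObj (HC_res G p P N M) V) = {v \<in> carrier V. \<forall>u \<in> p_core G p (P N M). act V u v = v}"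
  "zero (FObj (HC_res G p P N M) V) = zero V"
  "add (FObj (HC_res G p P N M) V) = add V"
  "smult (FObj (HC_res G p P N M) V) = smult V"
  "act (FObj (HC_res G p P N M) V) = act V"
  "FArr (HC_res G p P N M) V W t =
    restrict t {v \<in> carrier V. \<forall>u \<in> p_core G p (P N M). act V u v = v}"
  by (simp_all add: HC_res_def Let_def)

text \<open>The fixed points are stable under M because M normalizes the radical: u l = l (l^-1 u
  l).\<close>

lemma HC_res_module:
  assumes "field k" "levi_parabolic G (P N M) M (p_core G p (P N M))" "kG_module k G V"
  shows "kG_module k (G\<lparr>carrier := M\<rparr>) (FObj (HC_res G p P N M) V)"
proof -
  interpret k: field k by fact
  interpret LP: levi_parabolic G "P N M" M "p_core G p (P N M)" by fact
  interpret V: kG_module k G V by fact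
  let ?U = "p_core G p (P N M)"
  let ?F = "{v \<in> carrier V. \<forall>u \<in> ?U. act V u v = v}"
  let ?V = "FObj (HC_res G p P N M) V"
  have Uc: "u \<in> carrier G" if "u \<in> ?U" for u
    using subgroup.mem_carrier[OF LP.V_subgroup that] .
  have Mc: "l \<in> carrier G" if "l \<in> M" for l
    using subgroup.mem_carrier[OF LP.L_subgroup that] .
  have neg: "act V u (\<ominus>\<^bsub>V\<^esub> v) = \<ominus>\<^bsub>V\<^esub> act V u v" if "u \<in> carrier G" "v \<in> carrier V" for u v
  proof -
    have "\<ominus>\<^bsub>V\<^esub> w = (\<ominus>\<^bsub>k\<^esub> \<one>\<^bsub>k\<^esub>) \<odot>\<^bsub>V\<^esub> w" if "w \<in> carrier V" for w using that by (simp add: V.smult_l_minus)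
    then show ?thesis using that V.act_smult[of u "\<ominus>\<^bsub>k\<^esub> \<one>\<^bsub>k\<^esub>" v] V.act_closed by simp
  qed
  have sub: "submodule ?F k V"
    by (rule V.submoduleI) (auto simp: V.act_add V.act_smult V.act_zero neg Uc)
  have V_eq: "?V = V\<lparr>carrier := ?F\<rparr>" by (simp add: HC_res_def Let_def)
  have mod: "module k ?V" unfolding V_eq
    using submodule.submodule_is_module[OF sub V.module_axioms] .
  \<comment> \<open>A single map suffices here, the inclusion into V.\<close>
  have "fin_dim k ?V"
    by (rule fin_dim_jointly_injective[OF assms(1) mod V.module_axioms V.fin_dim, of "{()}" "\<lambda>_ v. v"])
      (auto simp: linear_on_def)
  moreover have "act V l v \<in> ?F" if l: "l \<in> M" and v: "v \<in> ?F" for l v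
  proof -
    have vc: "v \<in> carrier V" using v by simp
    have "act V u (act V l v) = act V l v" if u: "u \<in> ?U" for u
    proof -
      have "inv\<^bsub>G\<^esub> l \<otimes>\<^bsub>G\<^esub> u \<otimes>\<^bsub>G\<^esub> l \<in> ?U" using LP.conj_V u l LP.L_subset_P by blast
      then have "act V (l \<otimes>\<^bsub>G\<^esub> (inv\<^bsub>G\<^esub> l \<otimes>\<^bsub>G\<^esub> u \<otimes>\<^bsub>G\<^esub> l)) v = act V l v"
        using v l Uc Mc by (subst V.act_mult) auto
      also have "l \<otimes>\<^bsub>G\<^esub> (inv\<^bsub>G\<^esub> l \<otimes>\<^bsub>G\<^esub> u \<otimes>\<^bsub>G\<^esub> l) = u \<otimes>\<^bsub>G\<^esub> l"
        using Uc[OF u] Mc[OF l] by (simp add: LP.m_assoc) (simp flip: LP.m_assoc)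
      finally show ?thesis using Uc[OF u] Mc[OF l] vc by (simp add: V.act_mult)
    qed
    then show ?thesis using l v Mc V.act_closed by simp
  qed
  ultimately show ?thesis
    using mod LP.subgroup_imp_group[OF LP.L_subgroup] Mc
    by (intro kG_moduleI) (auto simp: V.act_add V.act_smult V.act_one V.act_mult)
qed

lemma HC_res_is_functor:
  assumes "field k" "levi_parabolic G (P N M) M (p_core G p (P N M))"
  shows "is_functor (kG_mod k G) (kG_mod k (G\<lparr>carrier := M\<rparr>)) (HC_res G p P N M)"
proof -
  interpret LP: levi_parabolic G "P N M" M "p_core G p (P N M)" by fact
  interpret C: category "kG_mod k G" by (rule kG_mod_category)
  interpret D: category "kG_mod k (G\<lparr>carrier := M\<rparr>)" by (rule kG_mod_category)
  have Uc: "u \<in> carrier G" if "u \<in> p_core G p (P N M)" for u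
    using subgroup.mem_carrier[OF LP.V_subgroup that] .
  have Mc: "l \<in> carrier G" if "l \<in> M" for l
    using subgroup.mem_carrier[OF LP.L_subgroup that] .
  show ?thesis
  proof
    fix V assume "V \<in> Obj (kG_mod k G)"
    then have V: "kG_module k G V" by (simp add: kG_mod_def)
    interpret V: kG_module k G V by (rule V)
    note V' = HC_res_module[where P = P and N = N and M = M, OF assms V]
    interpret V': kG_module k "G\<lparr>carrier := M\<rparr>" "FObj (HC_res G p P N M) V" by (rule V')
    show "FObj (HC_res G p P N M) V \<in> Obj (kG_mod k (G\<lparr>carrier := M\<rparr>))"
      using V' by (simp add: kG_mod_def)
    show "FArr (HC_res G p P N M) V V (Idn (kG_mod k G) V) =
      Idn (kG_mod k (G\<lparr>carrier := M\<rparr>)) (FObj (HC_res G p P N M) V)"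
      by (auto simp: kG_mod_def fun_eq_iff)
    fix W f assume W: "W \<in> Obj (kG_mod k G)" and "f \<in> Arr (kG_mod k G) V W"
    then have f: "f \<in> kG_hom k G V W" by (simp add: kG_mod_def)
    have fixed: "act W u (f v) = f v" if "v \<in> carrier V" "u \<in> p_core G p (P N M)" "act V u v = v" for u v
      using kG_homD(2)[OF f Uc[OF that(2)] that(1)] that(3) by simp
    show "FArr (HC_res G p P N M) V W f \<in> Arr (kG_mod k (G\<lparr>carrier := M\<rparr>))
      (FObj (HC_res G p P N M) V) (FObj (HC_res G p P N M) W)"
      using kG_hom_lin(2-4)[OF f] kG_homD(2)[OF f] fixed Mc
        V'.act_closed V'.M.a_closed V'.smult_closed
      by (simp add: kG_mod_def kG_hom_def lin_maps_def)
    fix X g assume "g \<in> Arr (kG_mod k G) W X"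
    show "FArr (HC_res G p P N M) V X (Cmp (kG_mod k G) V W X g f) =
      Cmp (kG_mod k (G\<lparr>carrier := M\<rparr>)) (FObj (HC_res G p P N M) V) (FObj (HC_res G p P N M) W)
        (FObj (HC_res G p P N M) X) (FArr (HC_res G p P N M) W X g) (FArr (HC_res G p P N M) V W f)"
      using kG_hom_lin(2)[OF f] fixed by (simp add: kG_mod_def fun_eq_iff compose_def)
  qed
qed

section \<open>Endomorphisms of induced modules\<close>

context induction_data
begin

lemma ind_map:
  assumes t: "t \<in> kG_hom k (G\<lparr>carrier := P\<rparr>) X X"
  shows "f \<in> carrier I \<Longrightarrow> compose (carrier G) t f \<in> carrier I"
    and "(\<lambda>f \<in> carrier I. compose (carrier G) t f) \<in> kG_hom k G I I"
proof -
  note [simp del] = ind_module_sel(1)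
  interpret I: kG_module k G I by (rule ind_kG_module)
  interpret P: subgroup P G by (rule P_subgroup)
  show closed: "compose (carrier G) t f \<in> carrier I" if f: "f \<in> carrier I" for f
  proof (rule indI)
    show "compose (carrier G) t f (g \<otimes> q) = act X (inv q) (compose (carrier G) t f g)"
      if "g \<in> carrier G" "q \<in> P" for g q
      using that ind_right[OF f that] kG_homD(2)[OF t, of "inv q" "f g"] ind_closed[OF f]
      by (simp add: compose_def)
  qed (use f ind_closed kG_hom_lin(2)[OF t] in \<open>auto simp: compose_def\<close>)
  have 1: "compose (carrier G) t (f \<oplus>\<^bsub>I\<^esub> f') = compose (carrier G) t f \<oplus>\<^bsub>I\<^esub> compose (carrier G) t f'"
    if "f \<in> carrier I" "f' \<in> carrier I" for f f'
    using that by (auto simp: fun_eq_iff compose_def kG_hom_lin(3)[OF t] ind_closed)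
  have 2: "compose (carrier G) t (c \<odot>\<^bsub>I\<^esub> f) = c \<odot>\<^bsub>I\<^esub> compose (carrier G) t f"
    if "c \<in> carrier k" "f \<in> carrier I" for c f
    using that by (auto simp: fun_eq_iff compose_def kG_hom_lin(4)[OF t] ind_closed)
  have 3: "compose (carrier G) t (act I x f) = act I x (compose (carrier G) t f)"
    if "x \<in> carrier G" for x f
    using that by (auto simp: fun_eq_iff compose_def)
  show "(\<lambda>f \<in> carrier I. compose (carrier G) t f) \<in> kG_hom k G I I"
    using closed 1 2 3 I.act_closed I.M.a_closed I.smult_closed
    by (simp add: kG_hom_def lin_maps_def del: ind_module_sel)
qed

text \<open>In tensor notation R(t)(1 \<otimes> x) = 1 \<otimes> t(x); compatibility of the
  adjunction with End(Z) rests on this.\<close>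

lemma compose_unit_fun:
  assumes "t \<in> kG_hom k (G\<lparr>carrier := P\<rparr>) X X" "x \<in> carrier X"
  shows "compose (carrier G) t (unit_fun x) = unit_fun (t x)"
proof -
  interpret X: kG_module k "G\<lparr>carrier := P\<rparr>" X by (rule mod_X)
  have "t \<zero>\<^bsub>X\<^esub> = \<zero>\<^bsub>X\<^esub>"
    using lin_maps_zero[OF X.module_axioms X.module_axioms kG_homD(1)[OF assms(1)]] .
  moreover have "inv g \<in> P" if "g \<in> P" for g using that subgroup.m_inv_closed[OF P_subgroup] by blast
  ultimately show ?thesis
    using kG_homD(2)[OF assms(1)] assms(2) by (auto simp: compose_def unit_fun_def fun_eq_iff)
qed

end

text \<open>L and X no longer occur: Y is any module with an isomorphism \<phi> from the module
  induced from Z, so transitivity of Harish-Chandra induction is contained in \<phi>.\<close>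

locale harish_chandra =
  LP: levi_parabolic G "P (carrier G) M" M "p_core G p (P (carrier G) M)"
  for G :: "('g, 'b) monoid_scheme" (structure) and p P M +
  fixes k :: "('k, 'c) ring_scheme" and Z :: "('k, 'g, 'z) gmodule"
    and Y :: "('k, 'g, 'z) gmodule" and \<phi> :: "('g \<Rightarrow> 'z) \<Rightarrow> 'z"
  assumes fin_G: "finite (carrier G)" and k_field: "field k"
    and mod_Z: "kG_module k (G\<lparr>carrier := M\<rparr>) Z" and mod_Y: "kG_module k G Y"
    and phi: "\<phi> \<in> kG_iso k G (FObj (HC_ind G p P (carrier G) M) Z) Y"
begin

abbreviation Q where "Q \<equiv> P (carrier G) M"
abbreviation IZ where "IZ \<equiv> inflate G p Q M Z"
abbreviation res where "res \<equiv> FObj (HC_res G p P (carrier G) M)"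
abbreviation \<iota> where "\<iota> \<equiv> End_embedding (HC_ind G p P (carrier G) M) Z Y \<phi>"

sublocale D: induction_data G k Q IZ
  using fin_G k_field LP.P_subgroup inflate_module[OF LP.levi_parabolic_axioms mod_Z] LP.is_group
  by (intro induction_data.intro induction_data_axioms.intro)

interpretation Y: kG_module k G Y by (rule mod_Y)
interpretation Z: kG_module k "G\<lparr>carrier := M\<rparr>" Z by (rule mod_Z)
interpretation DI: kG_module k G D.I by (rule D.ind_kG_module)

lemma HC_ind_eq:
  "FObj (HC_ind G p P (carrier G) M) Z = D.I"
  "FArr (HC_ind G p P (carrier G) M) Z Z h = (\<lambda>f \<in> carrier D.I. compose (carrier G) h f)"
  by (simp_all add: HC_ind_def del: ind_module_sel)

lemma phi_hom: "\<phi> \<in> kG_hom k G D.I Y" and phi_bij: "bij_betw \<phi> (carrier D.I) (carrier Y)"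
  using phi by (auto simp: kG_iso_def HC_ind_eq simp del: ind_module_sel)

lemma phi_inv_hom: "restrict (inv_into (carrier D.I) \<phi>) (carrier Y) \<in> kG_hom k G Y D.I"
  using kG_hom_inverse[OF D.ind_kG_module phi_hom phi_bij] .

lemma phi_cases:
  assumes "y \<in> carrier Y"
  obtains f where "f \<in> carrier D.I" "y = \<phi> f"
  using assms phi_bij by (auto simp: bij_betw_def simp del: ind_module_sel)

lemma End_Z_inflate:
  "h \<in> carrier (End_alg k (G\<lparr>carrier := M\<rparr>) Z) \<Longrightarrow> h \<in> kG_hom k (G\<lparr>carrier := Q\<rparr>) IZ IZ"
  using LP.inflate_hom[OF refl] by simp

text \<open>The inverse of \<phi> in \<open>End_embedding\<close> cancels on \<phi>(f). Every
  element of Y has this form, so identities for the embedding are checked there, through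
  \<open>embedding_eqI\<close>.\<close>

lemma embedding_phi:
  assumes "f \<in> carrier D.I"
  shows "\<iota> h (\<phi> f) = \<phi> (compose (carrier G) h f)"
  using assms phi_bij kG_hom_lin(2)[OF phi_hom assms]
  by (simp add: End_embedding_def HC_ind_eq bij_betw_inv_into_left del: ind_module_sel)

lemma embedding_hom:
  assumes "h \<in> carrier (End_alg k (G\<lparr>carrier := M\<rparr>) Z)"
  shows "\<iota> h \<in> kG_hom k G Y Y"
proof -
  have "\<iota> h = compose (carrier Y) \<phi> (compose (carrier Y) (\<lambda>f \<in> carrier D.I. compose (carrier G) h f)
      (restrict (inv_into (carrier D.I) \<phi>) (carrier Y)))"
    by (simp add: fun_eq_iff End_embedding_def HC_ind_eq compose_def[of "carrier Y"] del: ind_module_sel)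
  then show ?thesis
    using kG_hom_compose[OF mod_Y kG_hom_compose[OF mod_Y phi_inv_hom
        D.ind_map(2)[OF End_Z_inflate[OF assms]]] phi_hom] by simp
qed

lemma embedding_eqI:
  assumes "h \<in> carrier (End_alg k (G\<lparr>carrier := M\<rparr>) Z)" "e \<in> kG_hom k G Y Y"
    and "\<And>f. f \<in> carrier D.I \<Longrightarrow> \<phi> (compose (carrier G) h f) = e (\<phi> f)"
  shows "\<iota> h = e"
proof (rule kG_hom_eqI[OF embedding_hom[OF assms(1)] assms(2)])
  fix y assume "y \<in> carrier Y"
  then obtain f where f: "f \<in> carrier D.I" "y = \<phi> f" by (rule phi_cases)
  show "\<iota> h y = e y" unfolding f(2) embedding_phi[OF f(1)] using assms(3) f(1) by blast
qed

sublocale \<iota>: algebra_hom k "End_alg k (G\<lparr>carrier := M\<rparr>) Z" "End_alg k G Y" \<iota>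
proof
  note [simp del] = ind_module_sel(1)
  let ?E = "End_alg k (G\<lparr>carrier := M\<rparr>) Z"
  have IZ: "f g \<in> carrier Z" if "f \<in> carrier D.I" "g \<in> carrier G" for f g
    using D.ind_closed[OF that] by simp
  note im = D.ind_map(1)[OF End_Z_inflate]
  show "\<iota> a \<in> carrier (End_alg k G Y)" if "a \<in> carrier ?E" for a
    using embedding_hom[OF that] by simp
  show "\<iota> (a \<oplus>\<^bsub>?E\<^esub> b) = \<iota> a \<oplus>\<^bsub>End_alg k G Y\<^esub> \<iota> b" if ab: "a \<in> carrier ?E" "b \<in> carrier ?E" for a b
  proof (rule embedding_eqI)
    show "a \<oplus>\<^bsub>?E\<^esub> b \<in> carrier ?E" using kG_hom_add[OF k_field mod_Z mod_Z] ab by simp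
    show "\<iota> a \<oplus>\<^bsub>End_alg k G Y\<^esub> \<iota> b \<in> kG_hom k G Y Y"
      using kG_hom_add[OF k_field mod_Y mod_Y] embedding_hom ab by simp
    fix f assume f: "f \<in> carrier D.I"
    have "compose (carrier G) (a \<oplus>\<^bsub>?E\<^esub> b) f = compose (carrier G) a f \<oplus>\<^bsub>D.I\<^esub> compose (carrier G) b f"
      using IZ[OF f] by (simp add: fun_eq_iff compose_def)
    then show "\<phi> (compose (carrier G) (a \<oplus>\<^bsub>?E\<^esub> b) f) = (\<iota> a \<oplus>\<^bsub>End_alg k G Y\<^esub> \<iota> b) (\<phi> f)"
      using im[OF ab(1) f] im[OF ab(2) f] embedding_phi[OF f] kG_hom_lin(2,3)[OF phi_hom] f
      by (simp del: ind_module_sel)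
  qed
  show "\<iota> (c \<odot>\<^bsub>?E\<^esub> a) = c \<odot>\<^bsub>End_alg k G Y\<^esub> \<iota> a" if c: "c \<in> carrier k" and a: "a \<in> carrier ?E" for c a
  proof (rule embedding_eqI)
    show "c \<odot>\<^bsub>?E\<^esub> a \<in> carrier ?E" using kG_hom_smult[OF k_field mod_Z mod_Z] a c by simp
    show "c \<odot>\<^bsub>End_alg k G Y\<^esub> \<iota> a \<in> kG_hom k G Y Y"
      using kG_hom_smult[OF k_field mod_Y mod_Y] embedding_hom a c by simp
    fix f assume f: "f \<in> carrier D.I"
    have "compose (carrier G) (c \<odot>\<^bsub>?E\<^esub> a) f = c \<odot>\<^bsub>D.I\<^esub> compose (carrier G) a f"
      using IZ[OF f] by (simp add: fun_eq_iff compose_def)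
    then show "\<phi> (compose (carrier G) (c \<odot>\<^bsub>?E\<^esub> a) f) = (c \<odot>\<^bsub>End_alg k G Y\<^esub> \<iota> a) (\<phi> f)"
      using im[OF a f] embedding_phi[OF f] kG_hom_lin(2,4)[OF phi_hom] f c
      by (simp del: ind_module_sel)
  qed
  show "\<iota> (a \<otimes>\<^bsub>?E\<^esub> b) = \<iota> a \<otimes>\<^bsub>End_alg k G Y\<^esub> \<iota> b" if ab: "a \<in> carrier ?E" "b \<in> carrier ?E" for a b
  proof (rule embedding_eqI)
    show "a \<otimes>\<^bsub>?E\<^esub> b \<in> carrier ?E" using kG_hom_compose[OF mod_Z] ab by simp
    show "\<iota> a \<otimes>\<^bsub>End_alg k G Y\<^esub> \<iota> b \<in> kG_hom k G Y Y"
      using kG_hom_compose[OF mod_Y embedding_hom[OF ab(2)] embedding_hom[OF ab(1)]] by simp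
    fix f assume f: "f \<in> carrier D.I"
    have "compose (carrier G) (a \<otimes>\<^bsub>?E\<^esub> b) f = compose (carrier G) a (compose (carrier G) b f)"
      using IZ[OF f] by (simp add: fun_eq_iff compose_def)
    then show "\<phi> (compose (carrier G) (a \<otimes>\<^bsub>?E\<^esub> b) f) = (\<iota> a \<otimes>\<^bsub>End_alg k G Y\<^esub> \<iota> b) (\<phi> f)"
      using im[OF ab(2) f] embedding_phi[OF f] embedding_phi[OF im[OF ab(2) f]]
        kG_hom_lin(2)[OF phi_hom f]
      by (simp add: compose_eq)
  qed
  show "\<iota> \<one>\<^bsub>?E\<^esub> = \<one>\<^bsub>End_alg k G Y\<^esub>"
  proof (rule embedding_eqI)
    show "\<one>\<^bsub>?E\<^esub> \<in> carrier ?E" using kG_hom_id[OF mod_Z] by simp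
    show "\<one>\<^bsub>End_alg k G Y\<^esub> \<in> kG_hom k G Y Y" using kG_hom_id[OF mod_Y] by simp
    fix f assume f: "f \<in> carrier D.I"
    have "compose (carrier G) \<one>\<^bsub>?E\<^esub> f = f"
      using IZ[OF f] D.ind_arb[OF f] by (simp add: fun_eq_iff compose_def)
    then show "\<phi> (compose (carrier G) \<one>\<^bsub>?E\<^esub> f) = \<one>\<^bsub>End_alg k G Y\<^esub> (\<phi> f)"
      using kG_hom_lin(2)[OF phi_hom f] by simp
  qed
qed

text \<open>Equivariance under Q splits into equivariance under M and under the radical. The radical
  acts trivially on the inflated module, so the second condition says that all values are fixed
  points. The two sets of maps coincide, and no isomorphism has to be carried along.\<close>

lemma hom_inflate_eq_hom_res:
  assumes V: "kG_module k G V"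
  shows "kG_hom k (G\<lparr>carrier := Q\<rparr>) IZ V = kG_hom k (G\<lparr>carrier := M\<rparr>) Z (res V)"
proof -
  interpret V: kG_module k G V by fact
  note act_IZ = LP.act_inflate[OF refl]
  show ?thesis
  proof (intro equalityI subsetI)
    fix \<psi> assume psi: "\<psi> \<in> kG_hom k (G\<lparr>carrier := Q\<rparr>) IZ V"
    have act: "\<psi> (act Z (LP.proj g) z) = act V g (\<psi> z)" if "g \<in> Q" "z \<in> carrier Z" for g z
      using kG_homD(2)[OF psi, of g z] that by (simp add: act_IZ)
    have "act V u (\<psi> z) = \<psi> z" if "u \<in> p_core G p Q" "z \<in> carrier Z" for u z
      using act[of u z] that LP.V_subset_P LP.proj_V Z.act_one by auto
    moreover have "\<psi> (act Z l z) = act V l (\<psi> z)" if "l \<in> M" "z \<in> carrier Z" for l z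
      using act[of l z] that LP.L_subset_P LP.proj_L by auto
    ultimately show "\<psi> \<in> kG_hom k (G\<lparr>carrier := M\<rparr>) Z (res V)"
      using kG_hom_lin[OF psi] by (auto simp: kG_hom_def lin_maps_def)
  next
    fix \<psi> assume psi: "\<psi> \<in> kG_hom k (G\<lparr>carrier := M\<rparr>) Z (res V)"
    have "\<psi> (act Z (LP.proj g) z) = act V g (\<psi> z)" if g: "g \<in> Q" and z: "z \<in> carrier Z" for g z
    proof -
      obtain l u where lu: "l \<in> M" "u \<in> p_core G p Q" "g = l \<otimes> u" using g by (rule LP.P_cases)
      have c: "l \<in> carrier G" "u \<in> carrier G"
        using lu subgroup.mem_carrier[OF LP.L_subgroup] subgroup.mem_carrier[OF LP.V_subgroup] by auto
      have pz: "\<psi> z \<in> carrier V" "act V u (\<psi> z) = \<psi> z"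
        using kG_hom_lin(2)[OF psi z] lu by auto
      have "\<psi> (act Z l z) = act V l (\<psi> z)" using kG_homD(2)[OF psi, of l z] lu z by simp
      also have "\<dots> = act V g (\<psi> z)" using lu(3) c pz by (simp add: V.act_mult)
      finally show ?thesis using LP.proj_mult_V lu by simp
    qed
    then show "\<psi> \<in> kG_hom k (G\<lparr>carrier := Q\<rparr>) IZ V"
      using kG_hom_lin[OF psi] by (auto simp: kG_hom_def lin_maps_def act_IZ)
  qed
qed

text \<open>The outer restriction makes this an arrow of \<open>mod_cat\<close>, whose maps are
  extensional; the inner one does the same for its values.\<close>

definition adj :: "('k, 'g, 'v) gmodule \<Rightarrow> ('z \<Rightarrow> 'v) \<Rightarrow> 'z \<Rightarrow> 'v"
  where "adj V = (\<lambda>f \<in> kG_hom k G Y V. \<lambda>z \<in> carrier Z. f (\<phi> (D.unit_fun z)))"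

lemma phi_unit_fun: "z \<in> carrier Z \<Longrightarrow> \<phi> (D.unit_fun z) \<in> carrier Y"
  using kG_hom_lin(2)[OF phi_hom] D.unit_fun_closed[of z] by (simp del: ind_module_sel)

lemma precompose_phi_bij:
  assumes V: "kG_module k G V"
  shows "bij_betw (\<lambda>f. compose (carrier D.I) f \<phi>) (kG_hom k G Y V) (kG_hom k G D.I V)"
proof (rule bij_betwI[where g = "\<lambda>F. compose (carrier Y) F
    (restrict (inv_into (carrier D.I) \<phi>) (carrier Y))"])
  note [simp del] = ind_module_sel
  show "(\<lambda>f. compose (carrier D.I) f \<phi>) \<in> kG_hom k G Y V \<rightarrow> kG_hom k G D.I V"
    using kG_hom_compose[OF D.ind_kG_module phi_hom] by blast
  show "(\<lambda>F. compose (carrier Y) F (restrict (inv_into (carrier D.I) \<phi>) (carrier Y)))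
      \<in> kG_hom k G D.I V \<rightarrow> kG_hom k G Y V"
    using kG_hom_compose[OF mod_Y phi_inv_hom] by blast
  have inv: "inv_into (carrier D.I) \<phi> y \<in> carrier D.I" if "y \<in> carrier Y" for y
    using that phi_bij by (auto simp: bij_betw_def inv_into_into)
  show "compose (carrier Y) (compose (carrier D.I) f \<phi>)
      (restrict (inv_into (carrier D.I) \<phi>) (carrier Y)) = f" if f: "f \<in> kG_hom k G Y V" for f
    using PiE_arb[OF kG_hom_lin(1)[OF f]] inv bij_betw_inv_into_right[OF phi_bij]
    by (auto simp: fun_eq_iff compose_def)
  show "compose (carrier D.I) (compose (carrier Y) F
      (restrict (inv_into (carrier D.I) \<phi>) (carrier Y))) \<phi> = F" if F: "F \<in> kG_hom k G D.I V" for F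
    using PiE_arb[OF kG_hom_lin(1)[OF F]] kG_hom_lin(2)[OF phi_hom] bij_betw_inv_into_left[OF phi_bij]
    by (intro ext) (auto simp: compose_def)
qed

text \<open>A composite of three identifications: transport along \<phi>, Frobenius reciprocity, and
  \<open>hom_inflate_eq_hom_res\<close>.\<close>

lemma adj_bij:
  assumes V: "kG_module k G V"
  shows "bij_betw (adj V) (kG_hom k G Y V) (kG_hom k (G\<lparr>carrier := M\<rparr>) Z (res V))"
proof -
  have "bij_betw ((\<lambda>F. \<lambda>x \<in> carrier IZ. F (D.unit_fun x)) \<circ> (\<lambda>f. compose (carrier D.I) f \<phi>))
    (kG_hom k G Y V) (kG_hom k (G\<lparr>carrier := M\<rparr>) Z (res V))"
    using bij_betw_trans[OF precompose_phi_bij[OF V] D.frobenius_reciprocity[OF V]]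
    unfolding hom_inflate_eq_hom_res[OF V] .
  moreover have "((\<lambda>F. \<lambda>x \<in> carrier IZ. F (D.unit_fun x)) \<circ> (\<lambda>f. compose (carrier D.I) f \<phi>)) f = adj V f"
    if "f \<in> kG_hom k G Y V" for f
    using that D.unit_fun_closed by (auto simp: adj_def fun_eq_iff compose_eq simp del: ind_module_sel)
  ultimately show ?thesis using bij_betw_cong by blast
qed

text \<open>The right action is respected because h, embedded in End(Y), sends \<phi>(1 \<otimes> z)
  to \<phi>(1 \<otimes> h(z)).\<close>

lemma adj_rmod_hom:
  assumes V: "kG_module k G V"
  shows "adj V \<in> rmod_hom k (End_alg k (G\<lparr>carrier := M\<rparr>) Z)
    (FObj (Res_functor \<iota>) (FObj (Hom_functor k G Y) V))
    (FObj (Hom_functor k (G\<lparr>carrier := M\<rparr>) Z) (res V))"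
proof -
  have closed: "adj V f \<in> kG_hom k (G\<lparr>carrier := M\<rparr>) Z (res V)" if "f \<in> kG_hom k G Y V" for f
    using bij_betwE[OF adj_bij[OF V]] that by blast
  have "adj V (compose (carrier Y) f (\<iota> h)) = compose (carrier Z) (adj V f) h"
    if f: "f \<in> kG_hom k G Y V" and h: "h \<in> kG_hom k (G\<lparr>carrier := M\<rparr>) Z Z" for f h
  proof -
    have h': "h \<in> carrier (End_alg k (G\<lparr>carrier := M\<rparr>) Z)" using h by simp
    have "compose (carrier Y) f (\<iota> h) (\<phi> (D.unit_fun z)) = f (\<phi> (D.unit_fun (h z)))"
      if "z \<in> carrier Z" for z
      using that embedding_phi[of "D.unit_fun z" h] D.unit_fun_closed[of z] phi_unit_fun[OF that]
        D.compose_unit_fun[OF End_Z_inflate[OF h'], of z]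
      by (simp add: compose_eq del: ind_module_sel)
    then show ?thesis
      using f h kG_hom_compose[OF mod_Y embedding_hom[OF h'] f] kG_hom_lin(2)[OF h]
      by (auto simp: adj_def fun_eq_iff compose_def[of "carrier Z"])
  qed
  then show ?thesis
    using closed kG_hom_add[OF k_field mod_Y V] kG_hom_smult[OF k_field mod_Y V] phi_unit_fun
    by (simp add: rmod_hom_def lin_maps_def) (auto simp: adj_def fun_eq_iff)
qed

theorem Res_Hom_iso_Hom_HC_res:
  "naturally_isomorphic (kG_mod k G :: (('k, 'g, 'v) gmodule, 'v \<Rightarrow> 'v) cat)
    (mod_cat k (End_alg k (G\<lparr>carrier := M\<rparr>) Z))
    (Res_functor \<iota> \<circ>F Hom_functor k G Y)
    (Hom_functor k (G\<lparr>carrier := M\<rparr>) Z \<circ>F HC_res G p P (carrier G) M)"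
  (is "naturally_isomorphic ?C ?D ?F ?F'")
proof -
  have F: "is_functor ?C ?D ?F"
    using fctr_comp_is_functor[OF Hom_functor_is_functor[OF k_field mod_Y] \<iota>.Res_functor_is_functor] .
  have F': "is_functor ?C ?D ?F'"
    using fctr_comp_is_functor[OF HC_res_is_functor[where P = P and N = "carrier G" and M = M,
          OF k_field LP.levi_parabolic_axioms]
        Hom_functor_is_functor[OF k_field mod_Z]] .
  have "is_iso ?D (FObj ?F V) (FObj ?F' V) (adj V)" if "V \<in> Obj ?C" for V
  proof (rule bij_rmod_hom_is_iso)
    have V: "kG_module k G V" using that by (simp add: kG_mod_def)
    show "right_module k (End_alg k (G\<lparr>carrier := M\<rparr>) Z) (FObj ?F V)"
      using is_functor.FObj_closed[OF F that] by (simp add: mod_cat_def)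
    show "adj V \<in> rmod_hom k (End_alg k (G\<lparr>carrier := M\<rparr>) Z) (FObj ?F V) (FObj ?F' V)"
      using adj_rmod_hom[OF V] by (simp add: fctr_comp_def)
    show "bij_betw (adj V) (carrier (FObj ?F V)) (carrier (FObj ?F' V))"
      using adj_bij[OF V] by (simp add: fctr_comp_def)
  qed
  moreover have "Cmp ?D (FObj ?F V) (FObj ?F W) (FObj ?F' W) (adj W) (FArr ?F V W t) =
    Cmp ?D (FObj ?F V) (FObj ?F' V) (FObj ?F' W) (FArr ?F' V W t) (adj V)"
    if "V \<in> Obj ?C" "W \<in> Obj ?C" "t \<in> Arr ?C V W" for V W t
  proof -
    have V: "kG_module k G V" and t: "t \<in> kG_hom k G V W" using that by (simp_all add: kG_mod_def)
    have closed: "adj V f \<in> kG_hom k (G\<lparr>carrier := M\<rparr>) Z (res V)" if "f \<in> kG_hom k G Y V" for f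
      using bij_betwE[OF adj_bij[OF V]] that by blast
    \<comment> \<open>Restricting t to the fixed points changes nothing here, since the values of
      \<open>adj V f\<close> are fixed points; what remains is that both sides send z to
      t(f(\<phi>(1 \<otimes> z))).\<close>
    have "adj W (compose (carrier Y) t f) = compose (carrier Z) (FArr (HC_res G p P (carrier G) M) V W t) (adj V f)"
      if f: "f \<in> kG_hom k G Y V" for f
      using kG_hom_compose[OF mod_Y f t] kG_hom_lin(2)[OF closed[OF f]] f phi_unit_fun
      by (auto simp: fun_eq_iff compose_def adj_def)
    then show ?thesis using closed
      by (auto simp: mod_cat_def fctr_comp_def fun_eq_iff compose_def[of "kG_hom k G Y V"]
          simp del: HC_res_sel)
  qed
  ultimately show ?thesis using F F' unfolding naturally_isomorphic_def by blast
qed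

end

text \<open>Induction is formed in the group on M, so the parabolic subgroup must be a subgroup of
  M; in the application \<open>parabolic_subset\<close> supplies this.\<close>

lemma HC_ind_module:
  assumes "group G" "finite (carrier G)" "field k" "subgroup M G" "P M L \<subseteq> M"
    and "levi_parabolic G (P M L) L (p_core G p (P M L))" "kG_module k (G\<lparr>carrier := L\<rparr>) X"
  shows "kG_module k (G\<lparr>carrier := M\<rparr>) (FObj (HC_ind G p P M L) X)"
proof -
  interpret group G by fact
  interpret LP: levi_parabolic G "P M L" L "p_core G p (P M L)" by fact
  interpret M: group "G\<lparr>carrier := M\<rparr>" using assms(4) by (rule subgroup_imp_group)
  have "induction_data (G\<lparr>carrier := M\<rparr>) k (P M L) (inflate G p (P M L) L X)"
    using assms(2,3) finite_subset[OF subgroup.subset[OF assms(4)]] subgroup_incl[OF LP.P_subgroup assms(4,5)]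
      inflate_module[OF assms(6,7)] M.is_group
    by (intro induction_data.intro induction_data_axioms.intro) auto
  then show ?thesis using induction_data.ind_kG_module by (force simp: HC_ind_def)
qed

theorem proposition3p1:
  fixes G :: "('g, 'b) monoid_scheme" and k :: "('k, 'c) ring_scheme"
    and X :: "('k, 'g, 'x) gmodule"
  assumes "split_BN_pair_comm G B N S U p"
    and "field k" and "ring_char k \<noteq> p"
    and "\<And>K. subgroup K G \<Longrightarrow> splitting_field k (G\<lparr>carrier := K\<rparr>)"
    and "split_BN_pair.levi_system G B N S U \<L>"
    and "split_BN_pair.parabolic_choice G B N S U p \<L> P"
    and "weakly_cuspidal_pair k G p \<L> P L X"
    and "M \<in> \<L>" and "L \<subseteq> M"
    and "Y = FObj (HC_ind G p P (carrier G) L) X"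
    and "Z = FObj (HC_ind G p P M L) X"
    and "\<phi> \<in> kG_iso k G (FObj (HC_ind G p P (carrier G) M) Z) Y"
  shows "naturally_isomorphic
    (kG_mod k G :: (('k, 'g, 'v) gmodule, 'v \<Rightarrow> 'v) cat)
    (mod_cat k (End_alg k (G\<lparr>carrier := M\<rparr>) Z))
    (Res_functor (End_embedding (HC_ind G p P (carrier G) M) Z Y \<phi>) \<circ>F Hom_functor k G Y)
    (Hom_functor k (G\<lparr>carrier := M\<rparr>) Z \<circ>F HC_res G p P (carrier G) M)"
proof -
  interpret split_BN_pair_comm G B N S U p by fact
  have L: "L \<in> \<L>" and X: "kG_module k (G\<lparr>carrier := L\<rparr>) X"
    using assms(7) by (auto simp: weakly_cuspidal_pair_def simple_kG_module_def)
  have levi: "subgroup K G" if "K \<in> \<L>" for K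
    using that assms(5) levi_subgroup unfolding levi_system_def by blast
  have G: "carrier G \<in> \<L>" using assms(5) unfolding levi_system_def by blast
  \<comment> \<open>Stated for all pairs of the system because three are needed: (G, L) for Y, (M,
    L) for Z and (G, M) for the restriction functor.\<close>
  have par: "P K K' \<subseteq> K" and LP: "levi_parabolic G (P K K') K' (p_core G p (P K K'))"
    if "K \<in> \<L>" "K' \<in> \<L>" "K' \<subseteq> K" for K K'
  proof -
    have "P K K' \<in> parabolics K" and lc: "levi_complement G p (P K K') K'"
      using that assms(6) unfolding parabolic_choice_def by auto
    then show "P K K' \<subseteq> K" using parabolic_subset by blast
    then have "P K K' \<subseteq> carrier G" using subgroup.subset[OF levi[OF that(1)]] by blast
    then show "levi_parabolic G (P K K') K' (p_core G p (P K K'))"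
      using levi_complement_parabolic[OF is_group _ lc] by blast
  qed
  have sub: "L \<subseteq> carrier G" "M \<subseteq> carrier G" using subgroup.subset[OF levi] L assms(8) by auto
  have "kG_module k G Y"
    using HC_ind_module[where P = P and M = "carrier G" and L = L, OF is_group finite_G assms(2) levi[OF G] par[OF G L sub(1)] LP[OF G L sub(1)] X]
    unfolding assms(10) by simp
  moreover have "kG_module k (G\<lparr>carrier := M\<rparr>) Z"
    using HC_ind_module[where P = P and M = M and L = L, OF is_group finite_G assms(2) levi[OF assms(8)]
        par[OF assms(8) L assms(9)] LP[OF assms(8) L assms(9)] X]
    unfolding assms(11) .
  ultimately have "harish_chandra G p P M k Z Y \<phi>"
    using LP[OF G assms(8) sub(2)] finite_G assms(2,12)
    by (intro harish_chandra.intro harish_chandra_axioms.intro)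
  then show ?thesis by (rule harish_chandra.Res_Hom_iso_Hom_HC_res)
qed

end
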